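(* Let $\mathcal{L}$ be an adequate logic and $T$ an $\mathcal{L}$-theory, and let $G$ be the generic $T$-model in $(\mathcal{C}_T,P_T)$. For every $(\mathcal{C},P)\in\mathrm{Ob}(\mathbf{FA})$ and every $T$-model $S$ in $(\mathcal{C},P)$ there is a morphism $\overline{S}:(\mathcal{C}_T,P_T)\to(\mathcal{C},P)$ in $\mathbf{FA}$ with $\overline{S}(G)=S$, and it is unique up to 2-isomorphism: any morphism $F:(\mathcal{C}_T,P_T)\to(\mathcal{C},P)$ with $F(G)=S$ is 2-isomorphic to $\overline{S}$.
   Context: Syntax and logics: a first-order language $\mathscr{L}$ has quantifier symbols $\mathscr{L}_q$ and connectives $\mathscr{L}_\omega$ with arities (designated $e\in\mathscr{L}_0$, $\otimes\in\mathscr{L}_2$). Signatures: sorts, function symbols $f:\sigma_1..\sigma_n\to\tau$, relation symbols $R\subseteq\sigma_1..\sigma_n$. Contexts $\Gamma=x_1:\sigma_1..x_n:\sigma_n$, terms-in-context, formulas-in-context from $R(\vec M)$, $M_1=_\sigma M_2$, connectives, and $\Omega_{x:\sigma}(\phi)\ [\Gamma]$ from $\phi\ [\Gamma,x:\sigma]$ (up to $\alpha$-equivalence). Assertions: equations-in-context and sequents-in-context $\phi_1..\phi_n\vdash\phi\ [\Gamma]$. A logic assigns to each signature a closure operator $T\mapsto T_{\mathcal{L}}$ on theories (sets of assertions) satisfying typed equational logic; $T$ is an $\mathcal{L}$-theory if $T=T_{\mathcal{L}}$. $\mathrm{Ob}(\mathbf{FA})$: prop-categories $(\mathcal{C},P)$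 ($\mathcal{C}$ with designated finite products, $P:\mathcal{C}^{op}\to\mathbf{Pos}$) with $\mathscr{L}_\omega$-algebra structures on each $P(c)$ preserved by $P(f)$, elements $Eq_c\in P(c\times c)$, maps $\Omega_{b,c}:P(b\times c)\to P(b)$ natural in $b$, such that $(P(c),\otimes,e_c)$ is a monoid, $\Omega_{b,1}\circ P(\pi_1^{b,1})=\mathrm{id}$, $\Omega_{b,c\times d}\circ P(a_{b,c,d})=\Omega_{b,c}\circ\Omega_{b\times c,d}$ (canonical associator $a$), $Eq_1=e_{1\times1}$, $Eq_{c_1\times c_2}=P(\langle\pi_1^{c_1,c_2}\pi_1,\pi_1^{c_1,c_2}\pi_2\rangle)(Eq_{c_1})\otimes P(\langle\pi_2^{c_1,c_2}\pi_1,\pi_2^{c_1,c_2}\pi_2\rangle)(Eq_{c_2})$. Structures: an $Sg$-structure assigns objects to sorts, morphisms to function symbols, elements of $P(\text{product})$ to relation symbols, and interprets terms as morphisms and formulas as elements of $P([\![\Gamma]\!])$ ($[\![R(\vec M)]\!]=P(\langle[\![M_i]\!]\rangle)[\![R]\!]$, $[\![M_1=_\tau M_2]\!]=P(\langle[\![M_1]\!],[\![M_2]\!]\rangle)Eq_{[\![\tau]\!]}$, connectives pointwise, $[\![\Omega_{x:\sigma}\phi[\Gamma]]\!]=\Omega_{[\![\Gamma]\!],[\![\sigma]\!]}(P(a)[\![\phi[\Gamma,x:\sigma]]\!])$). It satisfies an equation if both sides agree and a sequent if $\bigotimes[\![\phi_i]\!]\le[\![\phi]\!]$ (empty $\otimes$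 is $e$); a $T$-model satisfies all of $T$. Morphisms $F:(\mathcal{C},P)\to(\mathcal{D},Q)$: finite-product-preserving $F^o$ and natural $F^p:P\Rightarrow QF^o$ with each $F^p_c$ an $\mathscr{L}_\omega$-homomorphism, $F^p_b\Omega_{b,c}=\Omega_{F^ob,F^oc}Q(a_{F,b,c}^{-1})F^p_{b\times c}$, $F^p_{c\times c}(Eq_c)=Q(a_{F,c,c})(Eq_{F^oc})$ ($a_{F,b,c}:F^o(b\times c)\to F^ob\times F^oc$ canonical). A 2-cell $\eta:F\Rightarrow H$ is a natural transformation $\eta:F^o\Rightarrow H^o$ with $F^p_c=Q(\eta_c)\circ H^p_c$; a 2-isomorphism if $\eta$ is a natural isomorphism. For a structure $S$ in $(\mathcal{C},P)$, $F(S)$ is the structure in $(\mathcal{D},Q)$ with $F(S)[\![\sigma]\!]=F^oS[\![\sigma]\!]$, $F(S)[\![f]\!]=F^o(S[\![f]\!])\circ a_\Gamma^{-1}$, $F(S)[\![R]\!]=Q(a_\Gamma^{-1})(F^p_{S[\![\Gamma]\!]}S[\![R]\!])$, where $a_\Gamma:F^o(S[\![\Gamma]\!])\to F(S)[\![\Gamma]\!]$ is canonical. Classifying prop-category $(\mathcal{C}_T,P_T)$: objects contexts (up to renaming); morphisms $\Gamma'\to x_1:\sigma_1..x_n:\sigma_n$ are lists $[N_1..N_n]$ of terms $N_i:\sigma_i\ [\Gamma']$ modulo equality in $T$; composition by substitution; products by concatenation; $P_T(\Gamma)$ = formulas in $[\Gamma]$ modulo mutual derivability in $T$, ordered by $\phi\vdash\psi\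 [\Gamma]\in T$; action by simultaneous substitution; connectives on representatives; $\Omega_{\Gamma,\Gamma'}[\phi]=[\Omega_{y_1:\tau_1}\cdots\Omega_{y_m:\tau_m}\phi]$; $Eq_\Gamma=[x_1=_{\sigma_1}x_1'\otimes\dots\otimes x_n=_{\sigma_n}x_n']$, $Eq_{[\,]}=[e]$. $\mathcal{L}$ is adequate if for each $\mathcal{L}$-theory these data are well defined and lie in $\mathrm{Ob}(\mathbf{FA})$. The generic model $G$: $G[\![\sigma]\!]$ = context $x:\sigma$, $G[\![f]\!]=[f(x_1..x_n)]$ and $G[\![R]\!]=[R(x_1..x_n)\ [x_1:\sigma_1..x_n:\sigma_n]]$. *)

theory Defs
  imports Main
begin

section \<open>Languages, signatures, terms and formulas\<close>

text \<open>
  Quantifier symbols, connectives with their arities, and the designated connectives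
  \<open>e\<close> of arity 0 and \<open>\<otimes>\<close> of arity 2.
\<close>

record ('q, 'k) lang =
  quantifiers :: "'q set"
  connectives :: "'k \<rightharpoonup> nat"
  e_con :: 'k
  tensor_con :: 'k

definition wf_lang :: "('q, 'k) lang \<Rightarrow> bool" where
  "wf_lang Lg \<longleftrightarrow> connectives Lg (e_con Lg) = Some 0 \<and> connectives Lg (tensor_con Lg) = Some 2"

record ('s, 'f, 'r) sig =
  sorts :: "'s set"
  funs :: "'f \<rightharpoonup> 's list \<times> 's"
  rels :: "'r \<rightharpoonup> 's list"

definition wf_sig :: "('s, 'f, 'r) sig \<Rightarrow> bool" where
  "wf_sig Sg \<longleftrightarrow>
     (\<forall>f \<sigma>s \<tau>. funs Sg f = Some (\<sigma>s, \<tau>) \<longrightarrow> set \<sigma>s \<subseteq> sorts Sg \<and> \<tau> \<in> sorts Sg) \<and>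
     (\<forall>R \<sigma>s. rels Sg R = Some \<sigma>s \<longrightarrow> set \<sigma>s \<subseteq> sorts Sg)"

text \<open>
  Contexts up to renaming of variables are lists of sorts, and \<open>V i\<close> is the variable declared at
  position \<open>i\<close> of the context (de Bruijn levels).  In context \<open>\<Gamma>\<close> the formula \<open>Qt q \<sigma> \<phi>\<close> binds the
  variable at position \<open>length \<Gamma>\<close>, its body living in context \<open>\<Gamma> @ [\<sigma>]\<close>.  Hence
  alpha-equivalence of formulas-in-context is equality.
\<close>

datatype 'f tm = V nat | Fn 'f "'f tm list"

datatype ('s, 'f, 'r, 'q, 'k) fm =
    Rl 'r "'f tm list"
  | Eqn 's "'f tm" "'f tm"
  | Cn 'k "('s, 'f, 'r, 'q, 'k) fm list"
  | Qt 'q 's "('s, 'f, 'r, 'q, 'k) fm"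

definition contexts :: "('s, 'f, 'r) sig \<Rightarrow> 's list set" where
  "contexts Sg = {\<Gamma>. set \<Gamma> \<subseteq> sorts Sg}"

inductive tm_in :: "('s, 'f, 'r) sig \<Rightarrow> 's list \<Rightarrow> 'f tm \<Rightarrow> 's \<Rightarrow> bool"
  for Sg :: "('s, 'f, 'r) sig" and \<Gamma> :: "'s list" where
  tm_in_V: "i < length \<Gamma> \<Longrightarrow> tm_in Sg \<Gamma> (V i) (\<Gamma> ! i)"
| tm_in_Fn: "funs Sg f = Some (\<sigma>s, \<tau>) \<Longrightarrow> list_all2 (tm_in Sg \<Gamma>) Ms \<sigma>s
     \<Longrightarrow> tm_in Sg \<Gamma> (Fn f Ms) \<tau>"

fun fm_in ::
  "('q, 'k) lang \<Rightarrow> ('s, 'f, 'r) sig \<Rightarrow> 's list \<Rightarrow> ('s, 'f, 'r, 'q, 'k) fm \<Rightarrow> bool" where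
  "fm_in Lg Sg \<Gamma> (Rl R Ms) \<longleftrightarrow> (\<exists>\<sigma>s. rels Sg R = Some \<sigma>s \<and> list_all2 (tm_in Sg \<Gamma>) Ms \<sigma>s)"
| "fm_in Lg Sg \<Gamma> (Eqn \<sigma> M N) \<longleftrightarrow> \<sigma> \<in> sorts Sg \<and> tm_in Sg \<Gamma> M \<sigma> \<and> tm_in Sg \<Gamma> N \<sigma>"
| "fm_in Lg Sg \<Gamma> (Cn k \<phi>s) \<longleftrightarrow>
     connectives Lg k = Some (length \<phi>s) \<and> (\<forall>\<phi>\<in>set \<phi>s. fm_in Lg Sg \<Gamma> \<phi>)"
| "fm_in Lg Sg \<Gamma> (Qt q \<sigma> \<phi>) \<longleftrightarrow>
     q \<in> quantifiers Lg \<and> \<sigma> \<in> sorts Sg \<and> fm_in Lg Sg (\<Gamma> @ [\<sigma>]) \<phi>"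

definition formulas ::
  "('q, 'k) lang \<Rightarrow> ('s, 'f, 'r) sig \<Rightarrow> 's list \<Rightarrow> ('s, 'f, 'r, 'q, 'k) fm set" where
  "formulas Lg Sg \<Gamma> = {\<phi>. fm_in Lg Sg \<Gamma> \<phi>}"

text \<open>Lists of terms in context \<open>\<Gamma>'\<close> whose sorts are those of \<open>\<Gamma>\<close>.\<close>

definition term_lists :: "('s, 'f, 'r) sig \<Rightarrow> 's list \<Rightarrow> 's list \<Rightarrow> 'f tm list set" where
  "term_lists Sg \<Gamma>' \<Gamma> = {Ns. list_all2 (tm_in Sg \<Gamma>') Ns \<Gamma>}"

primrec tsubst :: "'f tm list \<Rightarrow> 'f tm \<Rightarrow> 'f tm" where
  "tsubst Ns (V i) = Ns ! i"
| "tsubst Ns (Fn f Ms) = Fn f (map (tsubst Ns) Ms)"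

text \<open>
  Simultaneous substitution of terms in a context of length \<open>m\<close>.  Since terms keep their levels
  when the context is extended at the end, \<open>Ns\<close> needs no shifting under a quantifier.
\<close>

fun fsubst ::
  "nat \<Rightarrow> 'f tm list \<Rightarrow> ('s, 'f, 'r, 'q, 'k) fm \<Rightarrow> ('s, 'f, 'r, 'q, 'k) fm" where
  "fsubst m Ns (Rl R Ms) = Rl R (map (tsubst Ns) Ms)"
| "fsubst m Ns (Eqn \<sigma> M N) = Eqn \<sigma> (tsubst Ns M) (tsubst Ns N)"
| "fsubst m Ns (Cn k \<phi>s) = Cn k (map (fsubst m Ns) \<phi>s)"
| "fsubst m Ns (Qt q \<sigma> \<phi>) = Qt q \<sigma> (fsubst (Suc m) (Ns @ [V m]) \<phi>)"

fun tensor_fm :: "('q, 'k) lang \<Rightarrow> ('s, 'f, 'r, 'q, 'k) fm list \<Rightarrow> ('s, 'f, 'r, 'q, 'k) fm" where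
  "tensor_fm Lg [] = Cn (e_con Lg) []"
| "tensor_fm Lg (\<phi> # \<phi>s) = foldl (\<lambda>\<psi> \<chi>. Cn (tensor_con Lg) [\<psi>, \<chi>]) \<phi> \<phi>s"

definition quantify :: "'q \<Rightarrow> 's list \<Rightarrow> ('s, 'f, 'r, 'q, 'k) fm \<Rightarrow> ('s, 'f, 'r, 'q, 'k) fm" where
  "quantify q \<tau>s \<phi> = foldr (Qt q) \<tau>s \<phi>"


section \<open>Assertions, theories and logics\<close>

datatype ('s, 'f, 'r, 'q, 'k) assertion =
    Equation "'s list" "'f tm" "'f tm" 's
  | Sequent "'s list" "('s, 'f, 'r, 'q, 'k) fm list" "('s, 'f, 'r, 'q, 'k) fm"

type_synonym ('s, 'f, 'r, 'q, 'k) thy = "('s, 'f, 'r, 'q, 'k) assertion set"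

fun wf_assertion ::
  "('q, 'k) lang \<Rightarrow> ('s, 'f, 'r) sig \<Rightarrow> ('s, 'f, 'r, 'q, 'k) assertion \<Rightarrow> bool" where
  "wf_assertion Lg Sg (Equation \<Gamma> M N \<tau>) \<longleftrightarrow>
     \<Gamma> \<in> contexts Sg \<and> tm_in Sg \<Gamma> M \<tau> \<and> tm_in Sg \<Gamma> N \<tau>"
| "wf_assertion Lg Sg (Sequent \<Gamma> \<phi>s \<psi>) \<longleftrightarrow>
     \<Gamma> \<in> contexts Sg \<and> set \<phi>s \<subseteq> formulas Lg Sg \<Gamma> \<and> \<psi> \<in> formulas Lg Sg \<Gamma>"

definition is_thy ::
  "('q, 'k) lang \<Rightarrow> ('s, 'f, 'r) sig \<Rightarrow> ('s, 'f, 'r, 'q, 'k) thy \<Rightarrow> bool" where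
  "is_thy Lg Sg T \<longleftrightarrow> (\<forall>a\<in>T. wf_assertion Lg Sg a)"

text \<open>
  Closure under the rules of typed equational logic.  The simultaneous substitution rule subsumes
  congruence, weakening, exchange and contraction.
\<close>

definition equational :: "('s, 'f, 'r) sig \<Rightarrow> ('s, 'f, 'r, 'q, 'k) thy \<Rightarrow> bool" where
  "equational Sg T \<longleftrightarrow>
     (\<forall>\<Gamma>\<in>contexts Sg. \<forall>M \<tau>. tm_in Sg \<Gamma> M \<tau> \<longrightarrow> Equation \<Gamma> M M \<tau> \<in> T) \<and>
     (\<forall>\<Gamma> M N \<tau>. Equation \<Gamma> M N \<tau> \<in> T \<longrightarrow> Equation \<Gamma> N M \<tau> \<in> T) \<and>
     (\<forall>\<Gamma> M N K \<tau>. Equation \<Gamma> M N \<tau> \<in> T \<longrightarrow> Equation \<Gamma> N K \<tau> \<in> T \<longrightarrow> Equation \<Gamma> M K \<tau> \<in> T) \<and>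
     (\<forall>\<Gamma>'\<in>contexts Sg. \<forall>\<Gamma> M M' \<tau> Ns Ns'.
        Equation \<Gamma> M M' \<tau> \<in> T \<longrightarrow> length Ns = length \<Gamma> \<longrightarrow> length Ns' = length \<Gamma> \<longrightarrow>
        (\<forall>i<length \<Gamma>. Equation \<Gamma>' (Ns ! i) (Ns' ! i) (\<Gamma> ! i) \<in> T) \<longrightarrow>
        Equation \<Gamma>' (tsubst Ns M) (tsubst Ns' M') \<tau> \<in> T)"

type_synonym ('s, 'f, 'r, 'q, 'k) logic =
  "('s, 'f, 'r) sig \<Rightarrow> ('s, 'f, 'r, 'q, 'k) thy \<Rightarrow> ('s, 'f, 'r, 'q, 'k) thy"

definition is_logic :: "('q, 'k) lang \<Rightarrow> ('s, 'f, 'r, 'q, 'k) logic \<Rightarrow> bool" where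
  "is_logic Lg L \<longleftrightarrow>
     (\<forall>Sg. wf_sig Sg \<longrightarrow>
        (\<forall>T. is_thy Lg Sg T \<longrightarrow>
           is_thy Lg Sg (L Sg T) \<and> T \<subseteq> L Sg T \<and> L Sg (L Sg T) = L Sg T \<and>
           equational Sg (L Sg T)) \<and>
        (\<forall>T T'. is_thy Lg Sg T \<longrightarrow> is_thy Lg Sg T' \<longrightarrow> T \<subseteq> T' \<longrightarrow> L Sg T \<subseteq> L Sg T'))"

definition is_theory_of ::
  "('q, 'k) lang \<Rightarrow> ('s, 'f, 'r, 'q, 'k) logic \<Rightarrow> ('s, 'f, 'r) sig
     \<Rightarrow> ('s, 'f, 'r, 'q, 'k) thy \<Rightarrow> bool" where
  "is_theory_of Lg L Sg T \<longleftrightarrow> is_thy Lg Sg T \<and> T = L Sg T"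


section \<open>Prop-categories\<close>

text \<open>
  The data of a prop-category with the extra operations: a category whose arrows know their
  source and target, a designated terminal object and designated binary products, the posets
  \<open>P(c)\<close> (carrier \<open>Pred c\<close>, order \<open>Le c\<close>), the maps \<open>P(f)\<close> (\<open>Act f\<close>), connectives \<open>Con c k\<close>,
  the elements \<open>EqP c\<close> of \<open>P(c \<times> c)\<close>, and the maps \<open>Quant q b c\<close> from \<open>P(b \<times> c)\<close> to \<open>P(b)\<close>.
\<close>

record ('o, 'm, 'p, 'q, 'k) propcat =
  Obj :: "'o set"
  Arr :: "'m set"
  Src :: "'m \<Rightarrow> 'o"
  Tgt :: "'m \<Rightarrow> 'o"
  Ident :: "'o \<Rightarrow> 'm"
  Comp :: "'m \<Rightarrow> 'm \<Rightarrow> 'm"  (infixr "\<odot>\<index>" 70)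
  One :: 'o
  Times :: "'o \<Rightarrow> 'o \<Rightarrow> 'o"
  Pr1 :: "'o \<Rightarrow> 'o \<Rightarrow> 'm"
  Pr2 :: "'o \<Rightarrow> 'o \<Rightarrow> 'm"
  Pred :: "'o \<Rightarrow> 'p set"
  Le :: "'o \<Rightarrow> 'p \<Rightarrow> 'p \<Rightarrow> bool"
  Act :: "'m \<Rightarrow> 'p \<Rightarrow> 'p"
  Con :: "'o \<Rightarrow> 'k \<Rightarrow> 'p list \<Rightarrow> 'p"
  EqP :: "'o \<Rightarrow> 'p"
  Quant :: "'q \<Rightarrow> 'o \<Rightarrow> 'o \<Rightarrow> 'p \<Rightarrow> 'p"

definition hom :: "('o, 'm, 'p, 'q, 'k) propcat \<Rightarrow> 'o \<Rightarrow> 'o \<Rightarrow> 'm set" where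
  "hom C a b = {f \<in> Arr C. Src C f = a \<and> Tgt C f = b}"

definition is_category :: "('o, 'm, 'p, 'q, 'k) propcat \<Rightarrow> bool" where
  "is_category C \<longleftrightarrow>
     (\<forall>f\<in>Arr C. Src C f \<in> Obj C \<and> Tgt C f \<in> Obj C) \<and>
     (\<forall>a\<in>Obj C. Ident C a \<in> hom C a a) \<and>
     (\<forall>a b c. \<forall>f\<in>hom C a b. \<forall>g\<in>hom C b c. g \<odot>\<^bsub>C\<^esub> f \<in> hom C a c) \<and>
     (\<forall>a b. \<forall>f\<in>hom C a b. f \<odot>\<^bsub>C\<^esub> Ident C a = f \<and> Ident C b \<odot>\<^bsub>C\<^esub> f = f) \<and>
     (\<forall>a b c d. \<forall>f\<in>hom C a b. \<forall>g\<in>hom C b c. \<forall>h\<in>hom C c d.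
        h \<odot>\<^bsub>C\<^esub> (g \<odot>\<^bsub>C\<^esub> f) = (h \<odot>\<^bsub>C\<^esub> g) \<odot>\<^bsub>C\<^esub> f)"

definition is_terminal :: "('o, 'm, 'p, 'q, 'k) propcat \<Rightarrow> 'o \<Rightarrow> bool" where
  "is_terminal C t \<longleftrightarrow> t \<in> Obj C \<and> (\<forall>a\<in>Obj C. \<exists>!h. h \<in> hom C a t)"

definition is_product ::
  "('o, 'm, 'p, 'q, 'k) propcat \<Rightarrow> 'o \<Rightarrow> 'o \<Rightarrow> 'o \<Rightarrow> 'm \<Rightarrow> 'm \<Rightarrow> bool" where
  "is_product C b c x p q \<longleftrightarrow>
     x \<in> Obj C \<and> p \<in> hom C x b \<and> q \<in> hom C x c \<and>
     (\<forall>a\<in>Obj C. \<forall>f\<in>hom C a b. \<forall>g\<in>hom C a c.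
        \<exists>!h. h \<in> hom C a x \<and> p \<odot>\<^bsub>C\<^esub> h = f \<and> q \<odot>\<^bsub>C\<^esub> h = g)"

definition has_designated_products :: "('o, 'm, 'p, 'q, 'k) propcat \<Rightarrow> bool" where
  "has_designated_products C \<longleftrightarrow>
     is_terminal C (One C) \<and>
     (\<forall>b\<in>Obj C. \<forall>c\<in>Obj C. is_product C b c (Times C b c) (Pr1 C b c) (Pr2 C b c))"

definition bang :: "('o, 'm, 'p, 'q, 'k) propcat \<Rightarrow> 'o \<Rightarrow> 'm" where
  "bang C a = (THE h. h \<in> hom C a (One C))"

definition pair :: "('o, 'm, 'p, 'q, 'k) propcat \<Rightarrow> 'm \<Rightarrow> 'm \<Rightarrow> 'm" where
  "pair C f g = (THE h. h \<in> hom C (Src C f) (Times C (Tgt C f) (Tgt C g)) \<and>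
     Pr1 C (Tgt C f) (Tgt C g) \<odot>\<^bsub>C\<^esub> h = f \<and> Pr2 C (Tgt C f) (Tgt C g) \<odot>\<^bsub>C\<^esub> h = g)"

definition is_inverse :: "('o, 'm, 'p, 'q, 'k) propcat \<Rightarrow> 'm \<Rightarrow> 'm \<Rightarrow> bool" where
  "is_inverse C f g \<longleftrightarrow> g \<in> hom C (Tgt C f) (Src C f) \<and>
     g \<odot>\<^bsub>C\<^esub> f = Ident C (Src C f) \<and> f \<odot>\<^bsub>C\<^esub> g = Ident C (Tgt C f)"

definition is_iso :: "('o, 'm, 'p, 'q, 'k) propcat \<Rightarrow> 'm \<Rightarrow> bool" where
  "is_iso C f \<longleftrightarrow> f \<in> Arr C \<and> (\<exists>g. is_inverse C f g)"

definition inv_arr :: "('o, 'm, 'p, 'q, 'k) propcat \<Rightarrow> 'm \<Rightarrow> 'm" where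
  "inv_arr C f = (THE g. is_inverse C f g)"

text \<open>
  Finite products are bracketed to the left: \<open>1\<close> for the empty list, \<open>c\<close> for \<open>[c]\<close>, and
  \<open>(c\<^sub>1 \<times> c\<^sub>2) \<times> c\<^sub>3\<close> etc.  \<open>projs\<close> is the list of projections and \<open>tuple C a fs\<close> the arrow out of
  \<open>a\<close> with components \<open>fs\<close>.
\<close>

fun list_prod :: "('o, 'm, 'p, 'q, 'k) propcat \<Rightarrow> 'o list \<Rightarrow> 'o" where
  "list_prod C [] = One C"
| "list_prod C (c # cs) = foldl (Times C) c cs"

fun projs :: "('o, 'm, 'p, 'q, 'k) propcat \<Rightarrow> 'o list \<Rightarrow> 'm list" where
  "projs C [] = []"
| "projs C (c # cs) =
     snd (foldl (\<lambda>(b, ps) d. (Times C b d, map (\<lambda>p. p \<odot>\<^bsub>C\<^esub> Pr1 C b d) ps @ [Pr2 C b d]))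
       (c, [Ident C c]) cs)"

fun tuple :: "('o, 'm, 'p, 'q, 'k) propcat \<Rightarrow> 'o \<Rightarrow> 'm list \<Rightarrow> 'm" where
  "tuple C a [] = bang C a"
| "tuple C a (f # fs) = foldl (pair C) f fs"

text \<open>The canonical arrows \<open>b \<times> (c \<times> d) \<rightarrow> (b \<times> c) \<times> d\<close> and \<open>(\<Pi> cs) \<times> c \<rightarrow> \<Pi> (cs @ [c])\<close>.\<close>

definition assoc :: "('o, 'm, 'p, 'q, 'k) propcat \<Rightarrow> 'o \<Rightarrow> 'o \<Rightarrow> 'o \<Rightarrow> 'm" where
  "assoc C b c d =
     pair C
       (pair C (Pr1 C b (Times C c d)) (Pr1 C c d \<odot>\<^bsub>C\<^esub> Pr2 C b (Times C c d)))
       (Pr2 C c d \<odot>\<^bsub>C\<^esub> Pr2 C b (Times C c d))"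

definition snoc_map :: "('o, 'm, 'p, 'q, 'k) propcat \<Rightarrow> 'o list \<Rightarrow> 'o \<Rightarrow> 'm" where
  "snoc_map C cs c =
     tuple C (Times C (list_prod C cs) c)
       (map (\<lambda>p. p \<odot>\<^bsub>C\<^esub> Pr1 C (list_prod C cs) c) (projs C cs) @ [Pr2 C (list_prod C cs) c])"

definition e_pred :: "('q, 'k) lang \<Rightarrow> ('o, 'm, 'p, 'q, 'k) propcat \<Rightarrow> 'o \<Rightarrow> 'p" where
  "e_pred Lg C c = Con C c (e_con Lg) []"

definition tensor ::
  "('q, 'k) lang \<Rightarrow> ('o, 'm, 'p, 'q, 'k) propcat \<Rightarrow> 'o \<Rightarrow> 'p \<Rightarrow> 'p \<Rightarrow> 'p" where
  "tensor Lg C c x y = Con C c (tensor_con Lg) [x, y]"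

fun tensor_list ::
  "('q, 'k) lang \<Rightarrow> ('o, 'm, 'p, 'q, 'k) propcat \<Rightarrow> 'o \<Rightarrow> 'p list \<Rightarrow> 'p" where
  "tensor_list Lg C c [] = e_pred Lg C c"
| "tensor_list Lg C c (x # xs) = foldl (tensor Lg C c) x xs"

definition is_Pos_functor :: "('o, 'm, 'p, 'q, 'k) propcat \<Rightarrow> bool" where
  "is_Pos_functor C \<longleftrightarrow>
     (\<forall>c\<in>Obj C. \<forall>x\<in>Pred C c. Le C c x x) \<and>
     (\<forall>c\<in>Obj C. \<forall>x\<in>Pred C c. \<forall>y\<in>Pred C c. Le C c x y \<longrightarrow> Le C c y x \<longrightarrow> x = y) \<and>
     (\<forall>c\<in>Obj C. \<forall>x\<in>Pred C c. \<forall>y\<in>Pred C c. \<forall>z\<in>Pred C c.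
        Le C c x y \<longrightarrow> Le C c y z \<longrightarrow> Le C c x z) \<and>
     (\<forall>a b. \<forall>f\<in>hom C a b. \<forall>x\<in>Pred C b. Act C f x \<in> Pred C a) \<and>
     (\<forall>a b. \<forall>f\<in>hom C a b. \<forall>x\<in>Pred C b. \<forall>y\<in>Pred C b.
        Le C b x y \<longrightarrow> Le C a (Act C f x) (Act C f y)) \<and>
     (\<forall>c\<in>Obj C. \<forall>x\<in>Pred C c. Act C (Ident C c) x = x) \<and>
     (\<forall>a b c. \<forall>f\<in>hom C a b. \<forall>g\<in>hom C b c. \<forall>x\<in>Pred C c.
        Act C (g \<odot>\<^bsub>C\<^esub> f) x = Act C f (Act C g x))"

definition has_connectives :: "('q, 'k) lang \<Rightarrow> ('o, 'm, 'p, 'q, 'k) propcat \<Rightarrow> bool" where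
  "has_connectives Lg C \<longleftrightarrow>
     (\<forall>c\<in>Obj C. \<forall>k xs. connectives Lg k = Some (length xs) \<longrightarrow> set xs \<subseteq> Pred C c \<longrightarrow>
        Con C c k xs \<in> Pred C c) \<and>
     (\<forall>a b. \<forall>f\<in>hom C a b. \<forall>k xs.
        connectives Lg k = Some (length xs) \<longrightarrow> set xs \<subseteq> Pred C b \<longrightarrow>
        Act C f (Con C b k xs) = Con C a k (map (Act C f) xs)) \<and>
     (\<forall>c\<in>Obj C. \<forall>x\<in>Pred C c.
        tensor Lg C c (e_pred Lg C c) x = x \<and> tensor Lg C c x (e_pred Lg C c) = x) \<and>
     (\<forall>c\<in>Obj C. \<forall>x\<in>Pred C c. \<forall>y\<in>Pred C c. \<forall>z\<in>Pred C c.
        tensor Lg C c (tensor Lg C c x y) z = tensor Lg C c x (tensor Lg C c y z))"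

definition has_quantifiers :: "('q, 'k) lang \<Rightarrow> ('o, 'm, 'p, 'q, 'k) propcat \<Rightarrow> bool" where
  "has_quantifiers Lg C \<longleftrightarrow> (\<forall>q\<in>quantifiers Lg.
     (\<forall>b\<in>Obj C. \<forall>c\<in>Obj C. \<forall>x\<in>Pred C (Times C b c). Quant C q b c x \<in> Pred C b) \<and>
     (\<forall>a b. \<forall>f\<in>hom C a b. \<forall>c\<in>Obj C. \<forall>x\<in>Pred C (Times C b c).
        Act C f (Quant C q b c x) =
        Quant C q a c (Act C (pair C (f \<odot>\<^bsub>C\<^esub> Pr1 C a c) (Pr2 C a c)) x)) \<and>
     (\<forall>b\<in>Obj C. \<forall>x\<in>Pred C b. Quant C q b (One C) (Act C (Pr1 C b (One C)) x) = x) \<and>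
     (\<forall>b\<in>Obj C. \<forall>c\<in>Obj C. \<forall>d\<in>Obj C. \<forall>x\<in>Pred C (Times C (Times C b c) d).
        Quant C q b (Times C c d) (Act C (assoc C b c d) x) =
        Quant C q b c (Quant C q (Times C b c) d x)))"

definition has_equality :: "('q, 'k) lang \<Rightarrow> ('o, 'm, 'p, 'q, 'k) propcat \<Rightarrow> bool" where
  "has_equality Lg C \<longleftrightarrow>
     (\<forall>c\<in>Obj C. EqP C c \<in> Pred C (Times C c c)) \<and>
     EqP C (One C) = e_pred Lg C (Times C (One C) (One C)) \<and>
     (\<forall>b\<in>Obj C. \<forall>c\<in>Obj C. let d = Times C b c in
        EqP C d =
        tensor Lg C (Times C d d)
          (Act C (pair C (Pr1 C b c \<odot>\<^bsub>C\<^esub> Pr1 C d d) (Pr1 C b c \<odot>\<^bsub>C\<^esub> Pr2 C d d)) (EqP C b))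
          (Act C (pair C (Pr2 C b c \<odot>\<^bsub>C\<^esub> Pr1 C d d) (Pr2 C b c \<odot>\<^bsub>C\<^esub> Pr2 C d d)) (EqP C c)))"

definition FA_obj :: "('q, 'k) lang \<Rightarrow> ('o, 'm, 'p, 'q, 'k) propcat \<Rightarrow> bool" where
  "FA_obj Lg C \<longleftrightarrow>
     is_category C \<and> has_designated_products C \<and> is_Pos_functor C \<and>
     has_connectives Lg C \<and> has_quantifiers Lg C \<and> has_equality Lg C"


section \<open>Structures and models\<close>

record ('s, 'f, 'r, 'o, 'm, 'p) str =
  SortI :: "'s \<Rightarrow> 'o"
  FunI :: "'f \<Rightarrow> 'm"
  RelI :: "'r \<Rightarrow> 'p"

definition ctxI ::
  "('o, 'm, 'p, 'q, 'k) propcat \<Rightarrow> ('s, 'f, 'r, 'o, 'm, 'p) str \<Rightarrow> 's list \<Rightarrow> 'o" where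
  "ctxI C S \<Gamma> = list_prod C (map (SortI S) \<Gamma>)"

definition is_structure ::
  "('s, 'f, 'r) sig \<Rightarrow> ('o, 'm, 'p, 'q, 'k) propcat
     \<Rightarrow> ('s, 'f, 'r, 'o, 'm, 'p) str \<Rightarrow> bool" where
  "is_structure Sg C S \<longleftrightarrow>
     (\<forall>\<sigma>\<in>sorts Sg. SortI S \<sigma> \<in> Obj C) \<and>
     (\<forall>f \<sigma>s \<tau>. funs Sg f = Some (\<sigma>s, \<tau>) \<longrightarrow> FunI S f \<in> hom C (ctxI C S \<sigma>s) (SortI S \<tau>)) \<and>
     (\<forall>R \<sigma>s. rels Sg R = Some \<sigma>s \<longrightarrow> RelI S R \<in> Pred C (ctxI C S \<sigma>s))"

text \<open>Equality of \<open>Sg\<close>-structures; values outside the signature are irrelevant.\<close>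

definition str_eq ::
  "('s, 'f, 'r) sig \<Rightarrow> ('s, 'f, 'r, 'o, 'm, 'p) str
     \<Rightarrow> ('s, 'f, 'r, 'o, 'm, 'p) str \<Rightarrow> bool" where
  "str_eq Sg S S' \<longleftrightarrow>
     (\<forall>\<sigma>\<in>sorts Sg. SortI S \<sigma> = SortI S' \<sigma>) \<and>
     (\<forall>f\<in>dom (funs Sg). FunI S f = FunI S' f) \<and>
     (\<forall>R\<in>dom (rels Sg). RelI S R = RelI S' R)"

primrec tmI ::
  "('o, 'm, 'p, 'q, 'k) propcat \<Rightarrow> ('s, 'f, 'r, 'o, 'm, 'p) str \<Rightarrow> 's list \<Rightarrow> 'f tm \<Rightarrow> 'm" where
  "tmI C S \<Gamma> (V i) = projs C (map (SortI S) \<Gamma>) ! i"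
| "tmI C S \<Gamma> (Fn f Ms) = FunI S f \<odot>\<^bsub>C\<^esub> tuple C (ctxI C S \<Gamma>) (map (tmI C S \<Gamma>) Ms)"

fun fmI ::
  "('o, 'm, 'p, 'q, 'k) propcat \<Rightarrow> ('s, 'f, 'r, 'o, 'm, 'p) str \<Rightarrow> 's list
     \<Rightarrow> ('s, 'f, 'r, 'q, 'k) fm \<Rightarrow> 'p" where
  "fmI C S \<Gamma> (Rl R Ms) = Act C (tuple C (ctxI C S \<Gamma>) (map (tmI C S \<Gamma>) Ms)) (RelI S R)"
| "fmI C S \<Gamma> (Eqn \<sigma> M N) = Act C (pair C (tmI C S \<Gamma> M) (tmI C S \<Gamma> N)) (EqP C (SortI S \<sigma>))"
| "fmI C S \<Gamma> (Cn k \<phi>s) = Con C (ctxI C S \<Gamma>) k (map (fmI C S \<Gamma>) \<phi>s)"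
| "fmI C S \<Gamma> (Qt q \<sigma> \<phi>) =
     Quant C q (ctxI C S \<Gamma>) (SortI S \<sigma>)
       (Act C (snoc_map C (map (SortI S) \<Gamma>) (SortI S \<sigma>)) (fmI C S (\<Gamma> @ [\<sigma>]) \<phi>))"

fun satisfies ::
  "('q, 'k) lang \<Rightarrow> ('o, 'm, 'p, 'q, 'k) propcat \<Rightarrow> ('s, 'f, 'r, 'o, 'm, 'p) str
     \<Rightarrow> ('s, 'f, 'r, 'q, 'k) assertion \<Rightarrow> bool" where
  "satisfies Lg C S (Equation \<Gamma> M N \<tau>) \<longleftrightarrow> tmI C S \<Gamma> M = tmI C S \<Gamma> N"
| "satisfies Lg C S (Sequent \<Gamma> \<phi>s \<psi>) \<longleftrightarrow>
     Le C (ctxI C S \<Gamma>) (tensor_list Lg C (ctxI C S \<Gamma>) (map (fmI C S \<Gamma>) \<phi>s)) (fmI C S \<Gamma> \<psi>)"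

definition is_model ::
  "('q, 'k) lang \<Rightarrow> ('s, 'f, 'r) sig \<Rightarrow> ('s, 'f, 'r, 'q, 'k) thy
     \<Rightarrow> ('o, 'm, 'p, 'q, 'k) propcat \<Rightarrow> ('s, 'f, 'r, 'o, 'm, 'p) str \<Rightarrow> bool" where
  "is_model Lg Sg T C S \<longleftrightarrow> is_structure Sg C S \<and> (\<forall>a\<in>T. satisfies Lg C S a)"


section \<open>Morphisms and 2-cells\<close>

record ('o, 'm, 'p, 'o2, 'm2, 'p2) mor =
  FObj :: "'o \<Rightarrow> 'o2"
  FArr :: "'m \<Rightarrow> 'm2"
  FPred :: "'o \<Rightarrow> 'p \<Rightarrow> 'p2"

definition is_functor ::
  "('o, 'm, 'p, 'q, 'k) propcat \<Rightarrow> ('o2, 'm2, 'p2, 'q, 'k) propcat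
     \<Rightarrow> ('o, 'm, 'p, 'o2, 'm2, 'p2) mor \<Rightarrow> bool" where
  "is_functor C D F \<longleftrightarrow>
     (\<forall>a\<in>Obj C. FObj F a \<in> Obj D) \<and>
     (\<forall>a b. \<forall>f\<in>hom C a b. FArr F f \<in> hom D (FObj F a) (FObj F b)) \<and>
     (\<forall>a\<in>Obj C. FArr F (Ident C a) = Ident D (FObj F a)) \<and>
     (\<forall>a b c. \<forall>f\<in>hom C a b. \<forall>g\<in>hom C b c. FArr F (g \<odot>\<^bsub>C\<^esub> f) = FArr F g \<odot>\<^bsub>D\<^esub> FArr F f)"

definition preserves_products ::
  "('o, 'm, 'p, 'q, 'k) propcat \<Rightarrow> ('o2, 'm2, 'p2, 'q, 'k) propcat
     \<Rightarrow> ('o, 'm, 'p, 'o2, 'm2, 'p2) mor \<Rightarrow> bool" where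
  "preserves_products C D F \<longleftrightarrow>
     is_terminal D (FObj F (One C)) \<and>
     (\<forall>b\<in>Obj C. \<forall>c\<in>Obj C.
        is_product D (FObj F b) (FObj F c) (FObj F (Times C b c))
          (FArr F (Pr1 C b c)) (FArr F (Pr2 C b c)))"

text \<open>The canonical arrows \<open>F(b \<times> c) \<rightarrow> F b \<times> F c\<close> and \<open>F(\<Pi> cs) \<rightarrow> \<Pi> (F cs)\<close>.\<close>

definition prod_map ::
  "('o, 'm, 'p, 'q, 'k) propcat \<Rightarrow> ('o2, 'm2, 'p2, 'q, 'k) propcat
     \<Rightarrow> ('o, 'm, 'p, 'o2, 'm2, 'p2) mor \<Rightarrow> 'o \<Rightarrow> 'o \<Rightarrow> 'm2" where
  "prod_map C D F b c = pair D (FArr F (Pr1 C b c)) (FArr F (Pr2 C b c))"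

definition list_prod_map ::
  "('o, 'm, 'p, 'q, 'k) propcat \<Rightarrow> ('o2, 'm2, 'p2, 'q, 'k) propcat
     \<Rightarrow> ('o, 'm, 'p, 'o2, 'm2, 'p2) mor \<Rightarrow> 'o list \<Rightarrow> 'm2" where
  "list_prod_map C D F cs = tuple D (FObj F (list_prod C cs)) (map (FArr F) (projs C cs))"

definition FA_mor ::
  "('q, 'k) lang \<Rightarrow> ('o, 'm, 'p, 'q, 'k) propcat \<Rightarrow> ('o2, 'm2, 'p2, 'q, 'k) propcat
     \<Rightarrow> ('o, 'm, 'p, 'o2, 'm2, 'p2) mor \<Rightarrow> bool" where
  "FA_mor Lg C D F \<longleftrightarrow>
     is_functor C D F \<and> preserves_products C D F \<and>
     (\<forall>c\<in>Obj C. \<forall>x\<in>Pred C c. FPred F c x \<in> Pred D (FObj F c)) \<and>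
     (\<forall>c\<in>Obj C. \<forall>x\<in>Pred C c. \<forall>y\<in>Pred C c.
        Le C c x y \<longrightarrow> Le D (FObj F c) (FPred F c x) (FPred F c y)) \<and>
     (\<forall>a b. \<forall>f\<in>hom C a b. \<forall>x\<in>Pred C b. FPred F a (Act C f x) = Act D (FArr F f) (FPred F b x)) \<and>
     (\<forall>c\<in>Obj C. \<forall>k xs. connectives Lg k = Some (length xs) \<longrightarrow> set xs \<subseteq> Pred C c \<longrightarrow>
        FPred F c (Con C c k xs) = Con D (FObj F c) k (map (FPred F c) xs)) \<and>
     (\<forall>q\<in>quantifiers Lg. \<forall>b\<in>Obj C. \<forall>c\<in>Obj C. \<forall>x\<in>Pred C (Times C b c).
        FPred F b (Quant C q b c x) =
        Quant D q (FObj F b) (FObj F c)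
          (Act D (inv_arr D (prod_map C D F b c)) (FPred F (Times C b c) x))) \<and>
     (\<forall>c\<in>Obj C. FPred F (Times C c c) (EqP C c) = Act D (prod_map C D F c c) (EqP D (FObj F c)))"

definition is_2cell ::
  "('o, 'm, 'p, 'q, 'k) propcat \<Rightarrow> ('o2, 'm2, 'p2, 'q, 'k) propcat
     \<Rightarrow> ('o, 'm, 'p, 'o2, 'm2, 'p2) mor \<Rightarrow> ('o, 'm, 'p, 'o2, 'm2, 'p2) mor
     \<Rightarrow> ('o \<Rightarrow> 'm2) \<Rightarrow> bool" where
  "is_2cell C D F H \<eta> \<longleftrightarrow>
     (\<forall>c\<in>Obj C. \<eta> c \<in> hom D (FObj F c) (FObj H c)) \<and>
     (\<forall>a b. \<forall>f\<in>hom C a b. \<eta> b \<odot>\<^bsub>D\<^esub> FArr F f = FArr H f \<odot>\<^bsub>D\<^esub> \<eta> a) \<and>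
     (\<forall>c\<in>Obj C. \<forall>x\<in>Pred C c. FPred F c x = Act D (\<eta> c) (FPred H c x))"

definition two_isomorphic ::
  "('o, 'm, 'p, 'q, 'k) propcat \<Rightarrow> ('o2, 'm2, 'p2, 'q, 'k) propcat
     \<Rightarrow> ('o, 'm, 'p, 'o2, 'm2, 'p2) mor \<Rightarrow> ('o, 'm, 'p, 'o2, 'm2, 'p2) mor \<Rightarrow> bool" where
  "two_isomorphic C D F H \<longleftrightarrow>
     (\<exists>\<eta>. is_2cell C D F H \<eta> \<and> (\<forall>c\<in>Obj C. is_iso D (\<eta> c)))"

text \<open>
  The image \<open>F(S)\<close> of an \<open>Sg\<close>-structure.  (For a symbol outside \<open>Sg\<close> the value is irrelevant.)
\<close>

definition image_str ::
  "('s, 'f, 'r) sig \<Rightarrow> ('o, 'm, 'p, 'q, 'k) propcat \<Rightarrow> ('o2, 'm2, 'p2, 'q, 'k) propcat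
     \<Rightarrow> ('o, 'm, 'p, 'o2, 'm2, 'p2) mor \<Rightarrow> ('s, 'f, 'r, 'o, 'm, 'p) str
     \<Rightarrow> ('s, 'f, 'r, 'o2, 'm2, 'p2) str" where
  "image_str Sg C D F S =
     \<lparr> SortI = (\<lambda>\<sigma>. FObj F (SortI S \<sigma>)),
       FunI = (\<lambda>f. let \<Gamma> = fst (the (funs Sg f)) in
         FArr F (FunI S f) \<odot>\<^bsub>D\<^esub> inv_arr D (list_prod_map C D F (map (SortI S) \<Gamma>))),
       RelI = (\<lambda>R. let \<Gamma> = the (rels Sg R) in
         Act D (inv_arr D (list_prod_map C D F (map (SortI S) \<Gamma>)))
           (FPred F (ctxI C S \<Gamma>) (RelI S R))) \<rparr>"


section \<open>The classifying prop-category\<close>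

definition term_eq ::
  "('s, 'f, 'r, 'q, 'k) thy \<Rightarrow> 's list \<Rightarrow> 's list \<Rightarrow> ('f tm list \<times> 'f tm list) set" where
  "term_eq T \<Gamma>' \<Gamma> = {(Ns, Ns'). length Ns = length \<Gamma> \<and> length Ns' = length \<Gamma> \<and>
     (\<forall>i<length \<Gamma>. Equation \<Gamma>' (Ns ! i) (Ns' ! i) (\<Gamma> ! i) \<in> T)}"

definition fm_eq ::
  "('s, 'f, 'r, 'q, 'k) thy \<Rightarrow> 's list
     \<Rightarrow> (('s, 'f, 'r, 'q, 'k) fm \<times> ('s, 'f, 'r, 'q, 'k) fm) set" where
  "fm_eq T \<Gamma> = {(\<phi>, \<psi>). Sequent \<Gamma> [\<phi>] \<psi> \<in> T \<and> Sequent \<Gamma> [\<psi>] \<phi> \<in> T}"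

text \<open>Arrows \<open>\<Gamma>' \<rightarrow> \<Gamma>\<close> are triples consisting of \<open>\<Gamma>'\<close>, \<open>\<Gamma>\<close> and a class of lists of terms.\<close>

type_synonym ('s, 'f) syn_arr = "'s list \<times> 's list \<times> 'f tm list set"

definition tm_class ::
  "('s, 'f, 'r, 'q, 'k) thy \<Rightarrow> 's list \<Rightarrow> 's list \<Rightarrow> 'f tm list \<Rightarrow> ('s, 'f) syn_arr" where
  "tm_class T \<Gamma>' \<Gamma> Ns = (\<Gamma>', \<Gamma>, term_eq T \<Gamma>' \<Gamma> `` {Ns})"

definition fm_class ::
  "('s, 'f, 'r, 'q, 'k) thy \<Rightarrow> 's list \<Rightarrow> ('s, 'f, 'r, 'q, 'k) fm
     \<Rightarrow> ('s, 'f, 'r, 'q, 'k) fm set" where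
  "fm_class T \<Gamma> \<phi> = fm_eq T \<Gamma> `` {\<phi>}"

definition rep :: "'a set \<Rightarrow> 'a" where
  "rep X = (SOME x. x \<in> X)"

definition eq_fm :: "('q, 'k) lang \<Rightarrow> 's list \<Rightarrow> ('s, 'f, 'r, 'q, 'k) fm" where
  "eq_fm Lg \<Gamma> =
     tensor_fm Lg (map (\<lambda>i. Eqn (\<Gamma> ! i) (V i) (V (length \<Gamma> + i))) [0..<length \<Gamma>])"

definition classifying ::
  "('q, 'k) lang \<Rightarrow> ('s, 'f, 'r) sig \<Rightarrow> ('s, 'f, 'r, 'q, 'k) thy
     \<Rightarrow> ('s list, ('s, 'f) syn_arr, ('s, 'f, 'r, 'q, 'k) fm set, 'q, 'k) propcat" where
  "classifying Lg Sg T =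
     \<lparr> Obj = contexts Sg,
       Arr = {(\<Gamma>', \<Gamma>, X). \<Gamma>' \<in> contexts Sg \<and> \<Gamma> \<in> contexts Sg \<and>
               X \<in> term_lists Sg \<Gamma>' \<Gamma> // term_eq T \<Gamma>' \<Gamma>},
       Src = (\<lambda>(\<Gamma>', \<Gamma>, X). \<Gamma>'),
       Tgt = (\<lambda>(\<Gamma>', \<Gamma>, X). \<Gamma>),
       Ident = (\<lambda>\<Gamma>. tm_class T \<Gamma> \<Gamma> (map V [0..<length \<Gamma>])),
       Comp = (\<lambda>(\<Gamma>, \<Delta>, Y) (\<Gamma>', _, X). tm_class T \<Gamma>' \<Delta> (map (tsubst (rep X)) (rep Y))),
       One = [],
       Times = (\<lambda>\<Gamma> \<Delta>. \<Gamma> @ \<Delta>),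
       Pr1 = (\<lambda>\<Gamma> \<Delta>. tm_class T (\<Gamma> @ \<Delta>) \<Gamma> (map V [0..<length \<Gamma>])),
       Pr2 = (\<lambda>\<Gamma> \<Delta>. tm_class T (\<Gamma> @ \<Delta>) \<Delta> (map V [length \<Gamma>..<length \<Gamma> + length \<Delta>])),
       Pred = (\<lambda>\<Gamma>. formulas Lg Sg \<Gamma> // fm_eq T \<Gamma>),
       Le = (\<lambda>\<Gamma> X Y. Sequent \<Gamma> [rep X] (rep Y) \<in> T),
       Act = (\<lambda>(\<Gamma>', \<Gamma>, X) Y. fm_class T \<Gamma>' (fsubst (length \<Gamma>') (rep X) (rep Y))),
       Con = (\<lambda>\<Gamma> k Xs. fm_class T \<Gamma> (Cn k (map rep Xs))),
       EqP = (\<lambda>\<Gamma>. fm_class T (\<Gamma> @ \<Gamma>) (eq_fm Lg \<Gamma>)),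
       Quant = (\<lambda>q \<Gamma> \<Gamma>' X. fm_class T \<Gamma> (quantify q \<Gamma>' (rep X))) \<rparr>"

text \<open>
  Well-definedness of the data above: the two relations are equivalences, and composition, order,
  action, connectives and quantifiers do not depend on the chosen representatives.
\<close>

definition classifying_well_defined ::
  "('q, 'k) lang \<Rightarrow> ('s, 'f, 'r) sig \<Rightarrow> ('s, 'f, 'r, 'q, 'k) thy \<Rightarrow> bool" where
  "classifying_well_defined Lg Sg T \<longleftrightarrow>
     (\<forall>\<Gamma>'\<in>contexts Sg. \<forall>\<Gamma>\<in>contexts Sg. equiv (term_lists Sg \<Gamma>' \<Gamma>) (term_eq T \<Gamma>' \<Gamma>)) \<and>
     (\<forall>\<Gamma>'\<in>contexts Sg. \<forall>\<Gamma>\<in>contexts Sg. \<forall>\<Delta>\<in>contexts Sg.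
        \<forall>(Ns, Ns')\<in>term_eq T \<Gamma>' \<Gamma>. \<forall>(Ms, Ms')\<in>term_eq T \<Gamma> \<Delta>.
          (map (tsubst Ns) Ms, map (tsubst Ns') Ms') \<in> term_eq T \<Gamma>' \<Delta>) \<and>
     (\<forall>\<Gamma>\<in>contexts Sg. equiv (formulas Lg Sg \<Gamma>) (fm_eq T \<Gamma>)) \<and>
     (\<forall>\<Gamma>\<in>contexts Sg. \<forall>(\<phi>, \<phi>')\<in>fm_eq T \<Gamma>. \<forall>(\<psi>, \<psi>')\<in>fm_eq T \<Gamma>.
        Sequent \<Gamma> [\<phi>] \<psi> \<in> T \<longrightarrow> Sequent \<Gamma> [\<phi>'] \<psi>' \<in> T) \<and>
     (\<forall>\<Gamma>'\<in>contexts Sg. \<forall>\<Gamma>\<in>contexts Sg. \<forall>(Ns, Ns')\<in>term_eq T \<Gamma>' \<Gamma>. \<forall>(\<phi>, \<phi>')\<in>fm_eq T \<Gamma>.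
        (fsubst (length \<Gamma>') Ns \<phi>, fsubst (length \<Gamma>') Ns' \<phi>') \<in> fm_eq T \<Gamma>') \<and>
     (\<forall>\<Gamma>\<in>contexts Sg. \<forall>k \<phi>s \<phi>s'.
        connectives Lg k = Some (length \<phi>s) \<longrightarrow>
        list_all2 (\<lambda>\<phi> \<phi>'. (\<phi>, \<phi>') \<in> fm_eq T \<Gamma>) \<phi>s \<phi>s' \<longrightarrow>
        (Cn k \<phi>s, Cn k \<phi>s') \<in> fm_eq T \<Gamma>) \<and>
     (\<forall>q\<in>quantifiers Lg. \<forall>\<Gamma>\<in>contexts Sg. \<forall>\<Gamma>'\<in>contexts Sg. \<forall>(\<phi>, \<phi>')\<in>fm_eq T (\<Gamma> @ \<Gamma>').
        (quantify q \<Gamma>' \<phi>, quantify q \<Gamma>' \<phi>') \<in> fm_eq T \<Gamma>)"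

definition adequate :: "('q, 'k) lang \<Rightarrow> ('s, 'f, 'r, 'q, 'k) logic \<Rightarrow> bool" where
  "adequate Lg L \<longleftrightarrow>
     (\<forall>Sg T. wf_sig Sg \<longrightarrow> is_theory_of Lg L Sg T \<longrightarrow>
        classifying_well_defined Lg Sg T \<and> FA_obj Lg (classifying Lg Sg T))"

definition generic ::
  "('s, 'f, 'r) sig \<Rightarrow> ('s, 'f, 'r, 'q, 'k) thy
     \<Rightarrow> ('s, 'f, 'r, 's list, ('s, 'f) syn_arr, ('s, 'f, 'r, 'q, 'k) fm set) str" where
  "generic Sg T =
     \<lparr> SortI = (\<lambda>\<sigma>. [\<sigma>]),
       FunI = (\<lambda>f. let (\<sigma>s, \<tau>) = the (funs Sg f) in
         tm_class T \<sigma>s [\<tau>] [Fn f (map V [0..<length \<sigma>s])]),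
       RelI = (\<lambda>R. let \<sigma>s = the (rels Sg R) in
         fm_class T \<sigma>s (Rl R (map V [0..<length \<sigma>s]))) \<rparr>"

end

theory Submission
  imports Defs
begin

text \<open>
  Terms and formulas are interpreted in the model \<open>S\<close> by \<open>tmI\<close> and \<open>fmI\<close>; since \<open>S\<close> satisfies \<open>T\<close>,
  both descend to the classes that make up the classifying prop-category and define the morphism
  \<open>\<Gamma> \<mapsto> ctxI C S \<Gamma>\<close>.  Functoriality and naturality are the substitution lemma, whose quantifier case
  is the naturality of \<open>\<Omega>\<close>; compatibility with \<open>\<Omega>\<close> and \<open>Eq\<close> on whole contexts follows from the
  one-variable case by the axioms for \<open>\<Omega>\<close> and \<open>Eq\<close> on products.  Conversely, every context is the
  product of its one-variable contexts, so a morphism \<open>F\<close> sending the generic model to \<open>S\<close> has a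
  canonical isomorphism from \<open>F \<Gamma>\<close> to the product of the \<open>F [\<sigma>] = S \<sigma>\<close>; induction on terms and on
  formulas shows that these isomorphisms form a 2-cell.
\<close>


section \<open>Finite products\<close>

text \<open>Two mismatches of products shape the proof. In the classifying category a product is a
  concatenation of lists, hence strictly associative, while in \<open>C\<close> contexts are
  bracketed to the left, so the image of \<open>\<Gamma> @ \<Delta>\<close> is a product of the two
  images without being their designated product. Moreover a morphism \<open>F\<close> preserves
  products only in the sense of the universal property. Products of lists are therefore given with
  arbitrary vertex and projections, and arrows into a product are compared by their projections; the
  associator occurs only where the axiom for \<Omega> names it.

  The classes are handled through adequacy alone. Well-definedness also supplies that substitution
  and quantification lead to well-formed terms and formulas, since the relations live on these.

  That the image of G equals \<open>S\<close> strictly, although products are preserved only up to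
  isomorphism, is due to the one-variable contexts: \<open>G\<close> interprets a context by itself,
  and there the comparison arrow of the induced morphism is an identity.\<close>

definition cone ::
  "('o, 'm, 'p, 'q, 'k) propcat \<Rightarrow> 'o \<Rightarrow> 'm list \<Rightarrow> 'o list \<Rightarrow> bool" where
  "cone C a fs cs \<longleftrightarrow> list_all2 (\<lambda>f c. f \<in> hom C a c) fs cs"

text \<open>Vertex and projections are arbitrary, because the image of a context under a morphism is
  a product of the images of its sorts but need not be the designated one. Uniqueness is a separate
  clause so that it can be used as a principle for proving arrows equal.\<close>

definition is_list_product ::
  "('o, 'm, 'p, 'q, 'k) propcat \<Rightarrow> 'o list \<Rightarrow> 'o \<Rightarrow> 'm list \<Rightarrow> bool" where
  "is_list_product C cs x ps \<longleftrightarrow>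
     x \<in> Obj C \<and> cone C x ps cs \<and>
     (\<forall>a fs. a \<in> Obj C \<longrightarrow> cone C a fs cs \<longrightarrow>
        (\<exists>h\<in>hom C a x. map (\<lambda>p. p \<odot>\<^bsub>C\<^esub> h) ps = fs)) \<and>
     (\<forall>a. \<forall>h\<in>hom C a x. \<forall>h'\<in>hom C a x.
        map (\<lambda>p. p \<odot>\<^bsub>C\<^esub> h) ps = map (\<lambda>p. p \<odot>\<^bsub>C\<^esub> h') ps \<longrightarrow> h = h')"

lemma cone_length: "cone C a fs cs \<Longrightarrow> length fs = length cs"
  by (simp add: cone_def list_all2_lengthD)

lemma cone_nth: "cone C a fs cs \<Longrightarrow> i < length cs \<Longrightarrow> fs ! i \<in> hom C a (cs ! i)"
  by (auto simp: cone_def dest: list_all2_nthD2)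

lemma cone_snoc: "cone C a (fs @ [f]) (cs @ [c]) \<longleftrightarrow> cone C a fs cs \<and> f \<in> hom C a c"
  by (cases "length fs = length cs")
     (auto simp: cone_def list_all2_append dest: list_all2_lengthD)

lemma cone_snocE:
  assumes "cone C a fs (cs @ [c])"
  obtains fs' f where "fs = fs' @ [f]" "cone C a fs' cs" "f \<in> hom C a c"
  using assms by (auto simp: cone_def list_all2_append2 list_all2_Cons2)

locale cartesian_category =
  fixes C :: "('o, 'm, 'p, 'q, 'k) propcat" (structure)
  assumes category: "is_category C"
    and designated_products: "has_designated_products C"
begin

lemma hom_objs:
  assumes "f \<in> hom C a b"
  shows "a \<in> Obj C" and "b \<in> Obj C"
  using category assms unfolding is_category_def hom_def by auto

lemma src_hom: "f \<in> hom C a b \<Longrightarrow> Src C f = a"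
  and tgt_hom: "f \<in> hom C a b \<Longrightarrow> Tgt C f = b"
  by (auto simp: hom_def)

lemma ident_hom: "a \<in> Obj C \<Longrightarrow> Ident C a \<in> hom C a a"
  using category unfolding is_category_def by auto

lemma comp_hom: "g \<in> hom C b c \<Longrightarrow> f \<in> hom C a b \<Longrightarrow> g \<odot> f \<in> hom C a c"
  using category unfolding is_category_def by blast

lemma comp_ident: "f \<in> hom C a b \<Longrightarrow> f \<odot> Ident C a = f"
  and ident_comp: "f \<in> hom C a b \<Longrightarrow> Ident C b \<odot> f = f"
  using category unfolding is_category_def by blast+

lemma comp_assoc:
  "h \<in> hom C c d \<Longrightarrow> g \<in> hom C b c \<Longrightarrow> f \<in> hom C a b \<Longrightarrow> (h \<odot> g) \<odot> f = h \<odot> (g \<odot> f)"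
  using category unfolding is_category_def by metis

lemma cone_objs: "cone C a fs cs \<Longrightarrow> set cs \<subseteq> Obj C"
  using hom_objs(2) by (fastforce simp: cone_def list_all2_conv_all_nth in_set_conv_nth)

lemma cone_comp:
  assumes "cone C a fs cs" "h \<in> hom C b a"
  shows "cone C b (map (\<lambda>f. f \<odot> h) fs) cs"
  using assms by (auto simp: cone_def list_all2_conv_all_nth intro: comp_hom)

text \<open>\<open>Comp\<close> is a total function, associative only on composable arrows, so
  \<open>comp_assoc\<close> does not rewrite freely. This form, for all members of a cone at once,
  is the rebracketing rule in later computations with projections.\<close>

lemma cone_comp_comp:
  assumes "cone C a fs cs" "h \<in> hom C b a" "k \<in> hom C c b"
  shows "map (\<lambda>f. f \<odot> k) (map (\<lambda>f. f \<odot> h) fs) = map (\<lambda>f. f \<odot> (h \<odot> k)) fs"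
proof (rule nth_equalityI)
  fix i assume "i < length (map (\<lambda>f. f \<odot> k) (map (\<lambda>f. f \<odot> h) fs))"
  then show "map (\<lambda>f. f \<odot> k) (map (\<lambda>f. f \<odot> h) fs) ! i = map (\<lambda>f. f \<odot> (h \<odot> k)) fs ! i"
    using comp_assoc[OF cone_nth[OF assms(1)] assms(2,3)] cone_length[OF assms(1)] by auto
qed simp

section \<open>Binary products and pairing of arrows\<close>

lemma product_ex:
  assumes "is_product C b c x p q" "f \<in> hom C a b" "g \<in> hom C a c"
  shows "\<exists>h\<in>hom C a x. p \<odot> h = f \<and> q \<odot> h = g"
  using assms hom_objs(1)[OF assms(2)] unfolding is_product_def by blast

lemma product_eq:
  assumes P: "is_product C b c x p q" and h: "h \<in> hom C a x" and h': "h' \<in> hom C a x"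
    and eq: "p \<odot> h = p \<odot> h'" "q \<odot> h = q \<odot> h'"
  shows "h = h'"
proof -
  have "p \<odot> h \<in> hom C a b" "q \<odot> h \<in> hom C a c"
    using P h unfolding is_product_def by (auto intro: comp_hom)
  then show ?thesis
    using P hom_objs(1)[OF h] h h' eq unfolding is_product_def by metis
qed

lemma product_hom:
  assumes "is_product C b c x p q"
  shows "x \<in> Obj C" "p \<in> hom C x b" "q \<in> hom C x c"
  using assms unfolding is_product_def by auto

lemma is_productI:
  assumes "x \<in> Obj C" "p \<in> hom C x b" "q \<in> hom C x c"
    and "\<And>a f g. f \<in> hom C a b \<Longrightarrow> g \<in> hom C a c \<Longrightarrow> \<exists>h\<in>hom C a x. p \<odot> h = f \<and> q \<odot> h = g"
    and "\<And>a h h'. h \<in> hom C a x \<Longrightarrow> h' \<in> hom C a x \<Longrightarrow> p \<odot> h = p \<odot> h' \<Longrightarrow> q \<odot> h = q \<odot> h' \<Longrightarrow> h = h'"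
  shows "is_product C b c x p q"
  using assms unfolding is_product_def by metis

lemma times_product:
  "b \<in> Obj C \<Longrightarrow> c \<in> Obj C \<Longrightarrow> is_product C b c (Times C b c) (Pr1 C b c) (Pr2 C b c)"
  using designated_products unfolding has_designated_products_def by blast

lemmas times_obj = product_hom(1)[OF times_product]
  and pr1_hom = product_hom(2)[OF times_product]
  and pr2_hom = product_hom(3)[OF times_product]

lemma one_terminal: "is_terminal C (One C)"
  using designated_products unfolding has_designated_products_def by blast

lemma one_obj: "One C \<in> Obj C"
  using one_terminal unfolding is_terminal_def by blast

lemma pair_char:
  assumes f: "f \<in> hom C a b" and g: "g \<in> hom C a c"
  shows pair_hom: "pair C f g \<in> hom C a (Times C b c)"
    and pr1_pair: "Pr1 C b c \<odot> pair C f g = f"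
    and pr2_pair: "Pr2 C b c \<odot> pair C f g = g"
proof -
  have P: "is_product C b c (Times C b c) (Pr1 C b c) (Pr2 C b c)"
    using times_product f g hom_objs(2) by blast
  then have "\<exists>!h. h \<in> hom C a (Times C b c) \<and> Pr1 C b c \<odot> h = f \<and> Pr2 C b c \<odot> h = g"
    using product_ex[OF P f g] product_eq[OF P] by metis
  from theI'[OF this] show "pair C f g \<in> hom C a (Times C b c)"
    "Pr1 C b c \<odot> pair C f g = f" "Pr2 C b c \<odot> pair C f g = g"
    unfolding pair_def src_hom[OF f] tgt_hom[OF f] tgt_hom[OF g] by auto
qed

lemma pair_eqI:
  assumes "b \<in> Obj C" "c \<in> Obj C" "h \<in> hom C a (Times C b c)"
    and "Pr1 C b c \<odot> h = f" "Pr2 C b c \<odot> h = g"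
  shows "pair C f g = h"
proof -
  have "f \<in> hom C a b" "g \<in> hom C a c"
    using assms comp_hom[OF pr1_hom assms(3)] comp_hom[OF pr2_hom assms(3)] by auto
  from pair_char[OF this] show ?thesis
    using product_eq[OF times_product[OF assms(1,2)] _ assms(3)] assms(4,5) by metis
qed

lemma pair_comp:
  assumes f: "f \<in> hom C a b" and g: "g \<in> hom C a c" and h: "h \<in> hom C d a"
  shows "pair C f g \<odot> h = pair C (f \<odot> h) (g \<odot> h)"
proof (rule sym, rule pair_eqI)
  show b: "b \<in> Obj C" and c: "c \<in> Obj C" using f g hom_objs by auto
  show "pair C f g \<odot> h \<in> hom C d (Times C b c)" using pair_hom[OF f g] h by (rule comp_hom)
  show "Pr1 C b c \<odot> pair C f g \<odot> h = f \<odot> h"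
    using comp_assoc[OF pr1_hom[OF b c] pair_hom[OF f g] h] pr1_pair[OF f g] by simp
  show "Pr2 C b c \<odot> pair C f g \<odot> h = g \<odot> h"
    using comp_assoc[OF pr2_hom[OF b c] pair_hom[OF f g] h] pr2_pair[OF f g] by simp
qed

lemma bang_hom:
  assumes "a \<in> Obj C"
  shows "bang C a \<in> hom C a (One C)"
proof -
  have "\<exists>!h. h \<in> hom C a (One C)" using one_terminal assms unfolding is_terminal_def by blast
  from theI'[OF this] show ?thesis unfolding bang_def .
qed

subsection \<open>Products of lists\<close>

lemma list_product_obj: "is_list_product C cs x ps \<Longrightarrow> x \<in> Obj C"
  and list_product_cone: "is_list_product C cs x ps \<Longrightarrow> cone C x ps cs"
  unfolding is_list_product_def by auto

lemma list_product_ex: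
  assumes "is_list_product C cs x ps" "a \<in> Obj C" "cone C a fs cs"
  obtains h where "h \<in> hom C a x" "map (\<lambda>p. p \<odot> h) ps = fs"
  using assms unfolding is_list_product_def by metis

lemma list_product_eq:
  assumes "is_list_product C cs x ps" "h \<in> hom C a x" "h' \<in> hom C a x"
    and "map (\<lambda>p. p \<odot> h) ps = map (\<lambda>p. p \<odot> h') ps"
  shows "h = h'"
  using assms unfolding is_list_product_def by metis

lemma list_product_Nil: "is_terminal C t \<Longrightarrow> is_list_product C [] t []"
  unfolding is_list_product_def is_terminal_def cone_def using hom_objs(1) by simp metis

lemma list_product_single: "c \<in> Obj C \<Longrightarrow> is_list_product C [c] c [Ident C c]"
  unfolding is_list_product_def cone_def list_all2_Cons2
  by (auto simp: ident_hom ident_comp)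

text \<open>As \<open>z\<close> may be any product of \<open>x\<close> and \<open>c\<close>, this
  serves both the designated products and their images under a product-preserving functor. An arrow
  into \<open>z\<close> is found by lifting all components but the last to \<open>x\<close>.\<close>

lemma list_product_snoc:
  assumes P: "is_list_product C cs x ps" and Q: "is_product C x c z p q"
  shows "is_list_product C (cs @ [c]) z (map (\<lambda>r. r \<odot> p) ps @ [q])"
  unfolding is_list_product_def
proof (intro conjI allI impI ballI)
  note z = product_hom[OF Q] and ps = list_product_cone[OF P]
  show "z \<in> Obj C" by (rule z)
  show "cone C z (map (\<lambda>r. r \<odot> p) ps @ [q]) (cs @ [c])"
    using cone_comp[OF ps z(2)] z(3) by (simp add: cone_snoc)
  fix a
  {
    fix fs assume a: "a \<in> Obj C" and "cone C a fs (cs @ [c])"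
    then obtain fs' f where fs: "fs = fs' @ [f]" "cone C a fs' cs" "f \<in> hom C a c"
      by (elim cone_snocE)
    obtain k where k: "k \<in> hom C a x" "map (\<lambda>p. p \<odot> k) ps = fs'"
      using list_product_ex[OF P a fs(2)] .
    obtain h where h: "h \<in> hom C a z" "p \<odot> h = k" "q \<odot> h = f"
      using product_ex[OF Q k(1) fs(3)] by blast
    show "\<exists>h\<in>hom C a z. map (\<lambda>p. p \<odot> h) (map (\<lambda>r. r \<odot> p) ps @ [q]) = fs"
      using h k fs cone_comp_comp[OF ps z(2) h(1)] by auto
  }
  fix h h' assume h: "h \<in> hom C a z" "h' \<in> hom C a z"
    and eq: "map (\<lambda>p. p \<odot> h) (map (\<lambda>r. r \<odot> p) ps @ [q]) =
             map (\<lambda>p. p \<odot> h') (map (\<lambda>r. r \<odot> p) ps @ [q])"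
  have "map (\<lambda>r. r \<odot> (p \<odot> h)) ps = map (\<lambda>r. r \<odot> (p \<odot> h')) ps"
    using eq cone_comp_comp[OF ps z(2) h(1)] cone_comp_comp[OF ps z(2) h(2)]
      by (simp del: map_eq_conv)
  then have "p \<odot> h = p \<odot> h'"
    using list_product_eq[OF P] comp_hom[OF z(2)] h by blast
  with eq show "h = h'" using product_eq[OF Q h] by simp
qed

lemma product_list_product:
  assumes "is_product C b c x p q"
  shows "is_list_product C [b, c] x [p, q]"
proof -
  have "b \<in> Obj C" using product_hom(2)[OF assms] hom_objs by blast
  from list_product_snoc[OF list_product_single[OF this] assms]
  show ?thesis using ident_comp[OF product_hom(2)[OF assms]] by simp
qed

text \<open>Arrows into \<open>z\<close> come from the flat universal property and are recognised
  half by half in \<open>x\<close> and \<open>y\<close>, so that no associativity isomorphism has to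
  be constructed.\<close>

lemma product_of_list_products:
  assumes P: "is_list_product C cs x ps" and Q: "is_list_product C ds y qs"
    and R: "is_list_product C (cs @ ds) z (map (\<lambda>r. r \<odot> p) ps @ map (\<lambda>r. r \<odot> q) qs)"
    and p: "p \<in> hom C z x" and q: "q \<in> hom C z y"
  shows "is_product C x y z p q"
proof (rule is_productI)
  note ps = list_product_cone[OF P] and qs = list_product_cone[OF Q]
  show "z \<in> Obj C" using R by (rule list_product_obj)
  show "p \<in> hom C z x" "q \<in> hom C z y" by (rule p q)+
  fix a
  {
    fix f g assume f: "f \<in> hom C a x" and g: "g \<in> hom C a y"
    let ?fs = "map (\<lambda>r. r \<odot> f) ps" and ?gs = "map (\<lambda>r. r \<odot> g) qs"
    have "cone C a (?fs @ ?gs) (cs @ ds)"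
      using cone_comp[OF ps f] cone_comp[OF qs g] unfolding cone_def by (rule list_all2_appendI)
    then obtain h where h: "h \<in> hom C a z"
      and "map (\<lambda>r. r \<odot> h) (map (\<lambda>r. r \<odot> p) ps @ map (\<lambda>r. r \<odot> q) qs) = ?fs @ ?gs"
      using list_product_ex[OF R hom_objs(1)[OF f]] by blast
    then have "map (\<lambda>r. r \<odot> (p \<odot> h)) ps = ?fs" "map (\<lambda>r. r \<odot> (q \<odot> h)) qs = ?gs"
      using cone_comp_comp[OF ps p h] cone_comp_comp[OF qs q h] by (simp_all del: map_eq_conv)
    then have "p \<odot> h = f" "q \<odot> h = g"
      using list_product_eq[OF P comp_hom[OF p h] f] list_product_eq[OF Q comp_hom[OF q h] g]
        by auto
    then show "\<exists>h\<in>hom C a z. p \<odot> h = f \<and> q \<odot> h = g" using h by blast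
  }
  fix h h' assume h: "h \<in> hom C a z" "h' \<in> hom C a z" and "p \<odot> h = p \<odot> h'" "q \<odot> h = q \<odot> h'"
  then show "h = h'"
    using cone_comp_comp[OF ps p h(1)] cone_comp_comp[OF qs q h(1)]
      cone_comp_comp[OF ps p h(2)] cone_comp_comp[OF qs q h(2)]
    by (intro list_product_eq[OF R h]) (simp del: map_eq_conv)
qed

section \<open>Isomorphisms between products of the same list\<close>

lemma list_product_endo:
  assumes P: "is_list_product C cs x ps" and h: "h \<in> hom C x x" and "map (\<lambda>p. p \<odot> h) ps = ps"
  shows "h = Ident C x"
proof (rule list_product_eq[OF P h ident_hom[OF list_product_obj[OF P]]])
  show "map (\<lambda>p. p \<odot> h) ps = map (\<lambda>p. p \<odot> Ident C x) ps"
    using list_product_cone[OF P] assms(3) comp_ident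
    by (auto intro!: nth_equalityI simp: cone_def list_all2_conv_all_nth)
qed

lemma is_inverse_iff:
  "f \<in> hom C a b \<Longrightarrow>
    is_inverse C f g \<longleftrightarrow> g \<in> hom C b a \<and> g \<odot> f = Ident C a \<and> f \<odot> g = Ident C b"
  by (auto simp: is_inverse_def hom_def)

text \<open>The source of invertibility for \<open>list_prod_map\<close> and
  \<open>prod_map\<close>. The inverse comes from the universal property; both composites fix all
  projections, hence are identities.\<close>

lemma list_product_iso:
  assumes P: "is_list_product C cs x ps" and Q: "is_list_product C cs y qs"
    and h: "h \<in> hom C x y" and eq: "map (\<lambda>q. q \<odot> h) qs = ps"
  shows "is_iso C h"
proof -
  note ps = list_product_cone[OF P] and qs = list_product_cone[OF Q]
  obtain k where k: "k \<in> hom C y x" "map (\<lambda>p. p \<odot> k) ps = qs"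
    using list_product_ex[OF P list_product_obj[OF Q] qs] .
  have "k \<odot> h = Ident C x"
    using cone_comp_comp[OF ps k(1) h] k eq
    by (intro list_product_endo[OF P comp_hom[OF k(1) h]]) (simp del: map_eq_conv)
  moreover have "h \<odot> k = Ident C y"
    using cone_comp_comp[OF qs h k(1)] k eq
    by (intro list_product_endo[OF Q comp_hom[OF h k(1)]]) (simp del: map_eq_conv)
  ultimately have "is_inverse C h k" using k(1) unfolding is_inverse_iff[OF h] by blast
  moreover have "h \<in> Arr C" using h by (simp add: hom_def)
  ultimately show ?thesis unfolding is_iso_def by blast
qed

lemma inverse_unique:
  assumes "is_inverse C f g" "is_inverse C f g'" and f: "f \<in> hom C a b"
  shows "g = g'"
proof -
  note g = assms(1,2)[unfolded is_inverse_iff[OF f]]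
  have "g = (g' \<odot> f) \<odot> g" using g ident_comp by metis
  also have "\<dots> = g' \<odot> (f \<odot> g)" using comp_assoc f g by blast
  also have "\<dots> = g'" using g comp_ident by metis
  finally show ?thesis .
qed

lemma inv_arr_eq:
  assumes "is_inverse C f g" "f \<in> hom C a b"
  shows "inv_arr C f = g"
  unfolding inv_arr_def using assms inverse_unique by (metis the_equality)

lemma inv_arr:
  assumes "is_iso C f" and f: "f \<in> hom C a b"
  shows "inv_arr C f \<in> hom C b a"
    and "inv_arr C f \<odot> f = Ident C a"
    and "f \<odot> inv_arr C f = Ident C b"
proof -
  obtain g where "is_inverse C f g" using assms(1) unfolding is_iso_def by blast
  then have "is_inverse C f (inv_arr C f)" using inv_arr_eq f by metis
  then show "inv_arr C f \<in> hom C b a" "inv_arr C f \<odot> f = Ident C a" "f \<odot> inv_arr C f = Ident C b"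
    unfolding is_inverse_iff[OF f] by auto
qed

lemma inv_arr_ident: "a \<in> Obj C \<Longrightarrow> inv_arr C (Ident C a) = Ident C a"
  using inv_arr_eq is_inverse_iff ident_hom ident_comp by metis

subsection \<open>Designated products of lists\<close>

text \<open>False in general for the empty list: the product of \<open>[c]\<close> is
  \<open>c\<close>, not \<open>Times C (One C) c\<close>. Inductions over designated products
  therefore go from the right and treat empty, one-element and longer lists separately.\<close>

lemma list_prod_snoc: "cs \<noteq> [] \<Longrightarrow> list_prod C (cs @ [c]) = Times C (list_prod C cs) c"
  by (cases cs) auto

lemma projs_snoc:
  assumes "cs \<noteq> []"
  shows "projs C (cs @ [c]) =
    map (\<lambda>p. p \<odot> Pr1 C (list_prod C cs) c) (projs C cs) @ [Pr2 C (list_prod C cs) c]"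
proof -
  obtain d ds where cs: "cs = d # ds" using assms by (cases cs) auto
  \<comment> \<open>The fold defining \<open>projs\<close> carries the product built so far; this
    first component does not depend on the accumulated projections.\<close>
  have "fst (foldl (\<lambda>(b, ps) d. (Times C b d, map (\<lambda>p. p \<odot> Pr1 C b d) ps @ [Pr2 C b d])) (x, xs) ds)
      = foldl (Times C) x ds" for x xs
    by (induction ds arbitrary: x xs) auto
  then show ?thesis unfolding cs by (auto simp: split_beta)
qed

lemma tuple_snoc: "fs \<noteq> [] \<Longrightarrow> tuple C a (fs @ [f]) = pair C (tuple C a fs) f"
  by (cases fs) auto

lemma list_prod_product:
  assumes "set cs \<subseteq> Obj C"
  shows "is_list_product C cs (list_prod C cs) (projs C cs)"
  using assms
proof (induction cs rule: rev_induct)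
  case Nil
  then show ?case using list_product_Nil[OF one_terminal] by simp
next
  case (snoc c cs)
  show ?case
  proof (cases "cs = []")
    case True
    then show ?thesis using snoc.prems list_product_single by simp
  next
    case False
    have "is_list_product C cs (list_prod C cs) (projs C cs)" using snoc by simp
    from list_product_snoc[OF this times_product[OF list_product_obj[OF this]]]
    show ?thesis using snoc.prems by (simp only: list_prod_snoc[OF False] projs_snoc[OF False]) simp
  qed
qed

lemmas list_prod_obj = list_product_obj[OF list_prod_product]
  and projs_cone = list_product_cone[OF list_prod_product]

text \<open>A single arrow is its own tuple, in step with \<open>list_prod\<close>, so the singleton
  is again a case of its own. That \<open>a\<close> is an object is assumed explicitly because an
  empty cone says nothing about it.\<close>

lemma tuple_char:
  assumes "a \<in> Obj C" and "cone C a fs cs"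
  shows tuple_hom: "tuple C a fs \<in> hom C a (list_prod C cs)"
    and projs_tuple: "map (\<lambda>p. p \<odot> tuple C a fs) (projs C cs) = fs"
proof -
  have "tuple C a fs \<in> hom C a (list_prod C cs) \<and> map (\<lambda>p. p \<odot> tuple C a fs) (projs C cs) = fs"
    using assms
  proof (induction cs arbitrary: fs rule: rev_induct)
    case Nil
    then show ?case using bang_hom by (simp add: cone_def)
  next
    case (snoc c cs)
    obtain fs' f where fs: "fs = fs' @ [f]" "cone C a fs' cs" "f \<in> hom C a c"
      using snoc.prems(2) by (elim cone_snocE)
    show ?case
    proof (cases "cs = []")
      case True
      then show ?thesis using fs ident_comp by (simp add: cone_def)
    next
      case False
      then have "fs' \<noteq> []" using cone_length[OF fs(2)] by auto
      note t = tuple_snoc[OF this, of a f]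
      have I: "tuple C a fs' \<in> hom C a (list_prod C cs)"
        "map (\<lambda>p. p \<odot> tuple C a fs') (projs C cs) = fs'"
        using snoc.IH[OF snoc.prems(1) fs(2)] by auto
      let ?L = "list_prod C cs"
      have L: "?L \<in> Obj C" "c \<in> Obj C" using hom_objs(2)[OF I(1)] hom_objs(2)[OF fs(3)] .
      note p = pair_char[OF I(1) fs(3)]
      from cone_comp_comp[OF projs_cone[OF cone_objs[OF fs(2)]] pr1_hom[OF L] p(1)]
      have "map (\<lambda>q. q \<odot> pair C (tuple C a fs') f) (projs C (cs @ [c])) = fs"
        using I(2) p by (simp add: projs_snoc[OF False] fs(1) del: map_map)
      then show ?thesis
        using p(1) fs by (simp only: list_prod_snoc[OF False] t simp_thms)
    qed
  qed
  then show "tuple C a fs \<in> hom C a (list_prod C cs)"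
    "map (\<lambda>p. p \<odot> tuple C a fs) (projs C cs) = fs" by auto
qed

lemma tuple_eqI:
  assumes "set cs \<subseteq> Obj C" "h \<in> hom C a (list_prod C cs)" "map (\<lambda>p. p \<odot> h) (projs C cs) = fs"
  shows "tuple C a fs = h"
proof -
  have "cone C a fs cs" using cone_comp[OF projs_cone[OF assms(1)] assms(2)] assms(3) by simp
  from tuple_char[OF hom_objs(1)[OF assms(2)] this] show ?thesis
    using list_product_eq[OF list_prod_product[OF assms(1)] _ assms(2)] assms(3) by blast
qed

lemma tuple_comp:
  assumes "cone C a fs cs" "h \<in> hom C b a"
  shows "tuple C a fs \<odot> h = tuple C b (map (\<lambda>f. f \<odot> h) fs)"
proof (rule sym, rule tuple_eqI)
  have a: "a \<in> Obj C" using assms(2) hom_objs by blast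
  note t = tuple_char[OF a assms(1)]
  show cs: "set cs \<subseteq> Obj C" using assms(1) by (rule cone_objs)
  show "tuple C a fs \<odot> h \<in> hom C b (list_prod C cs)" using t(1) assms(2) by (rule comp_hom)
  show "map (\<lambda>p. p \<odot> tuple C a fs \<odot> h) (projs C cs) = map (\<lambda>f. f \<odot> h) fs"
    using cone_comp_comp[OF projs_cone[OF cs] t(1) assms(2)] t(2) by (simp del: map_map)
qed

lemma tuple_projs:
  assumes "set cs \<subseteq> Obj C"
  shows "tuple C (list_prod C cs) (projs C cs) = Ident C (list_prod C cs)"
  using assms
proof (rule tuple_eqI)
  show "Ident C (list_prod C cs) \<in> hom C (list_prod C cs) (list_prod C cs)"
    using list_prod_obj[OF assms] by (rule ident_hom)
  show "map (\<lambda>p. p \<odot> Ident C (list_prod C cs)) (projs C cs) = projs C cs"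
    using projs_cone[OF assms] comp_ident
    by (auto intro!: nth_equalityI simp: cone_def list_all2_conv_all_nth)
qed

lemma snoc_map_hom:
  assumes "set cs \<subseteq> Obj C" "c \<in> Obj C"
  shows "snoc_map C cs c \<in> hom C (Times C (list_prod C cs) c) (list_prod C (cs @ [c]))"
    and "map (\<lambda>p. p \<odot> snoc_map C cs c) (projs C (cs @ [c])) =
      map (\<lambda>p. p \<odot> Pr1 C (list_prod C cs) c) (projs C cs) @ [Pr2 C (list_prod C cs) c]"
proof -
  have L: "list_prod C cs \<in> Obj C" using assms list_prod_obj by blast
  have c: "cone C (Times C (list_prod C cs) c)
      (map (\<lambda>p. p \<odot> Pr1 C (list_prod C cs) c) (projs C cs) @ [Pr2 C (list_prod C cs) c]) (cs @ [c])"
    using cone_comp[OF projs_cone[OF assms(1)] pr1_hom[OF L assms(2)]] pr2_hom[OF L assms(2)]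
    by (simp add: cone_snoc)
  show "snoc_map C cs c \<in> hom C (Times C (list_prod C cs) c) (list_prod C (cs @ [c]))"
    and "map (\<lambda>p. p \<odot> snoc_map C cs c) (projs C (cs @ [c])) =
      map (\<lambda>p. p \<odot> Pr1 C (list_prod C cs) c) (projs C cs) @ [Pr2 C (list_prod C cs) c]"
    unfolding snoc_map_def using tuple_char[OF times_obj[OF L assms(2)] c] by auto
qed

subsection \<open>Product-preserving functors\<close>

text \<open>The image of \<open>list_prod C cs\<close> need not be designated in \<open>D\<close>,
  yet \<open>list_product_snoc\<close> applies there to the image of each binary product.\<close>

lemma functor_list_product:
  assumes D: "cartesian_category D" and F: "is_functor C D F" "preserves_products C D F"
    and cs: "set cs \<subseteq> Obj C"
  shows "is_list_product D (map (FObj F) cs) (FObj F (list_prod C cs)) (map (FArr F) (projs C cs))"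
  using cs
proof (induction cs rule: rev_induct)
  case Nil
  then show ?case
    using F(2) cartesian_category.list_product_Nil[OF D] by (simp add: preserves_products_def)
next
  case (snoc c cs)
  then have cs: "set cs \<subseteq> Obj C" "c \<in> Obj C" by auto
  show ?case
  proof (cases "cs = []")
    case True
    then show ?thesis
      using F(1) cs(2) cartesian_category.list_product_single[OF D] by (simp add: is_functor_def)
  next
    case False
    let ?L = "list_prod C cs"
    note L = list_prod_obj[OF cs(1)]
    have "is_product D (FObj F ?L) (FObj F c) (FObj F (Times C ?L c)) (FArr F (Pr1 C ?L c))
      (FArr F (Pr2 C ?L c))"
      using F(2) L cs(2) by (simp add: preserves_products_def)
    note * = cartesian_category.list_product_snoc[OF D snoc.IH[OF cs(1)] this]
    \<comment> \<open>\<open>F\<close> respects composites of arrows of \<open>C\<close> only, so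
      each \<open>p\<close> in the list is located as a projection with known source and
      target.\<close>
    have "FArr F (p \<odot> Pr1 C ?L c) = FArr F p \<odot>\<^bsub>D\<^esub> FArr F (Pr1 C ?L c)" if p: "p \<in> set
      (projs C cs)" for p
    proof -
      obtain d where "p \<in> hom C ?L d"
        using p cone_nth[OF projs_cone[OF cs(1)]] cone_length[OF projs_cone[OF cs(1)]]
        by (metis in_set_conv_nth)
      then show ?thesis using F(1) pr1_hom[OF L cs(2)] unfolding is_functor_def by blast
    qed
    with * show ?thesis
      by (simp add: list_prod_snoc[OF False] projs_snoc[OF False] o_def cong: map_cong)
  qed
qed

lemma list_prod_map:
  assumes D: "cartesian_category D" and F: "is_functor C D F" "preserves_products C D F"
    and cs: "set cs \<subseteq> Obj C"
  shows "list_prod_map C D F cs \<in> hom D (FObj F (list_prod C cs)) (list_prod D (map (FObj F) cs))"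
    and "map (\<lambda>p. p \<odot>\<^bsub>D\<^esub> list_prod_map C D F cs) (projs D (map (FObj F) cs)) =
      map (FArr F) (projs C cs)"
    and "is_iso D (list_prod_map C D F cs)"
proof -
  note P = functor_list_product[OF D F cs]
  have o: "set (map (FObj F) cs) \<subseteq> Obj D" using cs F(1) by (auto simp: is_functor_def)
  note t = cartesian_category.tuple_char[OF D cartesian_category.list_product_obj[OF D P]
      cartesian_category.list_product_cone[OF D P]]
  show "list_prod_map C D F cs \<in> hom D (FObj F (list_prod C cs)) (list_prod D (map (FObj F) cs))"
    "map (\<lambda>p. p \<odot>\<^bsub>D\<^esub> list_prod_map C D F cs) (projs D (map (FObj F) cs)) =
      map (FArr F) (projs C cs)"
    "is_iso D (list_prod_map C D F cs)"
    using t cartesian_category.list_product_iso[OF D P cartesian_category.list_prod_product[OF D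
      o] t]
    by (simp_all add: list_prod_map_def)
qed

text \<open>A binary product is a list product of length two, so \<open>list_product_iso\<close>
  yields invertibility here as well.\<close>

lemma prod_map:
  assumes D: "cartesian_category D" and F: "is_functor C D F" "preserves_products C D F"
    and bc: "b \<in> Obj C" "c \<in> Obj C"
  shows "prod_map C D F b c \<in> hom D (FObj F (Times C b c)) (Times D (FObj F b) (FObj F c))"
    and "Pr1 D (FObj F b) (FObj F c) \<odot>\<^bsub>D\<^esub> prod_map C D F b c = FArr F (Pr1 C b c)"
    and "Pr2 D (FObj F b) (FObj F c) \<odot>\<^bsub>D\<^esub> prod_map C D F b c = FArr F (Pr2 C b c)"
    and "is_iso D (prod_map C D F b c)"
proof -
  have P: "is_product D (FObj F b) (FObj F c) (FObj F (Times C b c)) (FArr F (Pr1 C b c)) (FArr F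
    (Pr2 C b c))"
    using F(2) bc by (simp add: preserves_products_def)
  have o: "FObj F b \<in> Obj D" "FObj F c \<in> Obj D" using F(1) bc by (auto simp: is_functor_def)
  note p = cartesian_category.pair_char[OF D cartesian_category.product_hom(2,3)[OF D P]]
  show "prod_map C D F b c \<in> hom D (FObj F (Times C b c)) (Times D (FObj F b) (FObj F c))"
    "Pr1 D (FObj F b) (FObj F c) \<odot>\<^bsub>D\<^esub> prod_map C D F b c = FArr F (Pr1 C b c)"
    "Pr2 D (FObj F b) (FObj F c) \<odot>\<^bsub>D\<^esub> prod_map C D F b c = FArr F (Pr2 C b c)"
    "is_iso D (prod_map C D F b c)"
    using p cartesian_category.list_product_iso[OF D
        cartesian_category.product_list_product[OF D P]
        cartesian_category.product_list_product[OF D cartesian_category.times_product[OF D o]] p(1)]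
    by (simp_all add: prod_map_def)
qed

end


section \<open>Objects of FA\<close>

locale fa_object =
  fixes Lg :: "('q, 'k) lang" and C :: "('o, 'm, 'p, 'q, 'k) propcat" (structure)
  assumes lang: "wf_lang Lg" and fa: "FA_obj Lg C"
begin

sublocale cartesian_category C
  using fa by unfold_locales (auto simp: FA_obj_def)

lemma le_antisym:
  "c \<in> Obj C \<Longrightarrow> x \<in> Pred C c \<Longrightarrow> y \<in> Pred C c \<Longrightarrow> Le C c x y \<Longrightarrow> Le C c y x \<Longrightarrow> x = y"
  using fa unfolding FA_obj_def is_Pos_functor_def by metis

lemma act_pred: "f \<in> hom C a b \<Longrightarrow> x \<in> Pred C b \<Longrightarrow> Act C f x \<in> Pred C a"
  using fa unfolding FA_obj_def is_Pos_functor_def by blast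

lemma act_ident: "c \<in> Obj C \<Longrightarrow> x \<in> Pred C c \<Longrightarrow> Act C (Ident C c) x = x"
  using fa unfolding FA_obj_def is_Pos_functor_def by blast

lemma act_comp:
  "g \<in> hom C b c \<Longrightarrow> f \<in> hom C a b \<Longrightarrow> x \<in> Pred C c \<Longrightarrow>
    Act C (g \<odot> f) x = Act C f (Act C g x)"
  using fa unfolding FA_obj_def is_Pos_functor_def by blast

lemma con_pred:
  "c \<in> Obj C \<Longrightarrow> connectives Lg k = Some (length xs) \<Longrightarrow> set xs \<subseteq> Pred C c \<Longrightarrow>
    Con C c k xs \<in> Pred C c"
  using fa unfolding FA_obj_def has_connectives_def by blast

lemma act_con:
  "f \<in> hom C a b \<Longrightarrow> connectives Lg k = Some (length xs) \<Longrightarrow> set xs \<subseteq> Pred C b \<Longrightarrow>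
    Act C f (Con C b k xs) = Con C a k (map (Act C f) xs)"
  using fa unfolding FA_obj_def has_connectives_def by blast

lemma quant_pred:
  "q \<in> quantifiers Lg \<Longrightarrow> b \<in> Obj C \<Longrightarrow> c \<in> Obj C \<Longrightarrow> x \<in> Pred C (Times C b c) \<Longrightarrow>
    Quant C q b c x \<in> Pred C b"
  using fa unfolding FA_obj_def has_quantifiers_def by blast

lemma act_quant:
  "q \<in> quantifiers Lg \<Longrightarrow> f \<in> hom C a b \<Longrightarrow> c \<in> Obj C \<Longrightarrow> x \<in> Pred C (Times C b c) \<Longrightarrow>
    Act C f (Quant C q b c x) = Quant C q a c (Act C (pair C (f \<odot> Pr1 C a c) (Pr2 C a c)) x)"
  using fa unfolding FA_obj_def has_quantifiers_def by blast

lemma quant_one: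
  "q \<in> quantifiers Lg \<Longrightarrow> b \<in> Obj C \<Longrightarrow> x \<in> Pred C b \<Longrightarrow>
    Quant C q b (One C) (Act C (Pr1 C b (One C)) x) = x"
  using fa unfolding FA_obj_def has_quantifiers_def by blast

lemma quant_times:
  "q \<in> quantifiers Lg \<Longrightarrow> b \<in> Obj C \<Longrightarrow> c \<in> Obj C \<Longrightarrow> d \<in> Obj C \<Longrightarrow>
    x \<in> Pred C (Times C (Times C b c) d) \<Longrightarrow>
    Quant C q b (Times C c d) (Act C (assoc C b c d) x) =
      Quant C q b c (Quant C q (Times C b c) d x)"
  using fa unfolding FA_obj_def has_quantifiers_def by blast

lemma eq_pred: "c \<in> Obj C \<Longrightarrow> EqP C c \<in> Pred C (Times C c c)"
  and eq_one: "EqP C (One C) = e_pred Lg C (Times C (One C) (One C))"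
  using fa unfolding FA_obj_def has_equality_def by auto

section \<open>Pulling back the unit, the tensor and the equality predicates\<close>

lemma act_e: "f \<in> hom C a b \<Longrightarrow> Act C f (e_pred Lg C b) = e_pred Lg C a"
  unfolding e_pred_def using act_con lang by (simp add: wf_lang_def)

lemma act_tensor:
  "f \<in> hom C a b \<Longrightarrow> x \<in> Pred C b \<Longrightarrow> y \<in> Pred C b \<Longrightarrow>
    Act C f (tensor Lg C b x y) = tensor Lg C a (Act C f x) (Act C f y)"
  unfolding tensor_def using act_con lang by (simp add: wf_lang_def)

lemma tensor_list_snoc:
  "xs \<noteq> [] \<Longrightarrow> tensor_list Lg C c (xs @ [x]) = tensor Lg C c (tensor_list Lg C c xs) x"
  by (cases xs) auto

text \<open>The axiom for \<open>Eq\<close> on a product, pulled back along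
  \<open>pair C f g\<close>. With generalized elements \<open>f\<close> and \<open>g\<close> the
  projections out of the double product disappear, which makes iteration along a list
  possible.\<close>

lemma act_pair_eq_times:
  assumes bc: "b \<in> Obj C" "c \<in> Obj C" and f: "f \<in> hom C a (Times C b c)"
    and g: "g \<in> hom C a (Times C b c)"
  shows "Act C (pair C f g) (EqP C (Times C b c)) =
    tensor Lg C a (Act C (pair C (Pr1 C b c \<odot> f) (Pr1 C b c \<odot> g)) (EqP C b))
      (Act C (pair C (Pr2 C b c \<odot> f) (Pr2 C b c \<odot> g)) (EqP C c))"
proof -
  let ?d = "Times C b c"
  note d = times_obj[OF bc]
  note p = pair_hom[OF f g] and pd = pr1_hom[OF d d] pr2_hom[OF d d]
  have *: "pair C (u \<odot> Pr1 C ?d ?d) (u \<odot> Pr2 C ?d ?d) \<in> hom C (Times C ?d ?d) (Times C x x)"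
    "pair C (u \<odot> Pr1 C ?d ?d) (u \<odot> Pr2 C ?d ?d) \<odot> pair C f g = pair C (u \<odot> f) (u \<odot> g)"
    if u: "u \<in> hom C ?d x" for u x
  proof -
    note up = comp_hom[OF u pd(1)] comp_hom[OF u pd(2)]
    show "pair C (u \<odot> Pr1 C ?d ?d) (u \<odot> Pr2 C ?d ?d) \<in> hom C (Times C ?d ?d) (Times C x x)"
      by (rule pair_hom[OF up])
    show "pair C (u \<odot> Pr1 C ?d ?d) (u \<odot> Pr2 C ?d ?d) \<odot> pair C f g = pair C (u \<odot> f) (u \<odot> g)"
      using pair_comp[OF up p] comp_assoc[OF u pd(1) p] comp_assoc[OF u pd(2) p]
        pr1_pair[OF f g] pr2_pair[OF f g] by simp
  qed
  note p1 = *[OF pr1_hom[OF bc]] and p2 = *[OF pr2_hom[OF bc]]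
  note e = eq_pred[OF bc(1)] eq_pred[OF bc(2)]
  have "EqP C ?d = tensor Lg C (Times C ?d ?d)
      (Act C (pair C (Pr1 C b c \<odot> Pr1 C ?d ?d) (Pr1 C b c \<odot> Pr2 C ?d ?d)) (EqP C b))
      (Act C (pair C (Pr2 C b c \<odot> Pr1 C ?d ?d) (Pr2 C b c \<odot> Pr2 C ?d ?d)) (EqP C c))"
    using fa bc unfolding FA_obj_def has_equality_def Let_def by blast
  then show ?thesis
    using act_tensor[OF p act_pred[OF p1(1) e(1)] act_pred[OF p2(1) e(2)]]
      act_comp[OF p1(1) p e(1)] act_comp[OF p2(1) p e(2)] p1(2) p2(2) by simp
qed

text \<open>\<open>f\<close> and \<open>g\<close> stay arbitrary because the step applies the
  induction hypothesis to their composites with the first projection. The empty case is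
  \<open>Eq_1 = e\<close>, preserved by \<open>Act\<close>; otherwise \<open>tensor_list\<close> is
  bracketed to the left just as \<open>list_prod\<close> is, so the step is exactly the binary
  case.\<close>

lemma act_pair_eq_list_prod:
  assumes "set cs \<subseteq> Obj C" "f \<in> hom C a (list_prod C cs)" "g \<in> hom C a (list_prod C cs)"
  shows "Act C (pair C f g) (EqP C (list_prod C cs)) =
    tensor_list Lg C a (map (\<lambda>i. Act C (pair C (projs C cs ! i \<odot> f) (projs C cs ! i \<odot> g)) (EqP C
      (cs ! i)))
      [0..<length cs])"
  using assms
proof (induction cs arbitrary: f g rule: rev_induct)
  case Nil
  then show ?case using act_e[OF pair_hom, of f a "One C" g "One C"] by (simp add: eq_one)
next
  case (snoc c cs)
  show ?case
  proof (cases "cs = []")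
    case True
    then show ?thesis using snoc.prems ident_comp by simp
  next
    case False
    let ?L = "list_prod C cs"
    have cs: "set cs \<subseteq> Obj C" "c \<in> Obj C" using snoc.prems by auto
    note L = list_prod_obj[OF cs(1)]
    note f = snoc.prems(2,3)[unfolded list_prod_snoc[OF False]]
    note pr = projs_cone[OF cs(1)]
    have "projs C (cs @ [c]) ! i \<odot> h = projs C cs ! i \<odot> (Pr1 C ?L c \<odot> h)"
      if "i < length cs" "h \<in> hom C a (Times C ?L c)" for i h
      using that cone_length[OF pr] comp_assoc[OF cone_nth[OF pr that(1)] pr1_hom[OF L cs(2)]
        that(2)]
      by (simp add: projs_snoc[OF False] nth_append)
    then have "map (\<lambda>i. Act C (pair C (projs C (cs @ [c]) ! i \<odot> f) (projs C (cs @ [c]) ! i \<odot> g))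
      (EqP C ((cs @ [c]) ! i)))
      [0..<length cs] = map (\<lambda>i. Act C (pair C (projs C cs ! i \<odot> (Pr1 C ?L c \<odot> f))
        (projs C cs ! i \<odot> (Pr1 C ?L c \<odot> g))) (EqP C (cs ! i)))
      [0..<length cs]"
      using f by (auto simp: nth_append)
    moreover have "projs C (cs @ [c]) ! length cs = Pr2 C ?L c"
      using cone_length[OF pr] by (simp add: projs_snoc[OF False] nth_append)
    moreover have "Act C (pair C f g) (EqP C (Times C ?L c)) =
      tensor Lg C a (Act C (pair C (Pr1 C ?L c \<odot> f) (Pr1 C ?L c \<odot> g)) (EqP C ?L))
      (Act C (pair C (Pr2 C ?L c \<odot> f) (Pr2 C ?L c \<odot> g)) (EqP C c))"
      using act_pair_eq_times[OF L cs(2) f] .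
    ultimately show ?thesis
      using snoc.IH[OF cs(1) comp_hom[OF pr1_hom[OF L cs(2)] f(1)] comp_hom[OF pr1_hom[OF L cs(2)]
        f(2)]] False
      by (simp add: list_prod_snoc[OF False] tensor_list_snoc del: map_eq_conv)
  qed
qed

end


section \<open>Interpretation of terms and formulas\<close>

lemma tm_in_V_iff [simp]: "tm_in Sg \<Gamma> (V i) \<tau> \<longleftrightarrow> i < length \<Gamma> \<and> \<tau> = \<Gamma> ! i"
  by (subst tm_in.simps) auto

lemma tm_in_Fn_iff [simp]:
  "tm_in Sg \<Gamma> (Fn f Ms) \<tau> \<longleftrightarrow> (\<exists>\<sigma>s. funs Sg f = Some (\<sigma>s, \<tau>) \<and> list_all2 (tm_in Sg \<Gamma>) Ms \<sigma>s)"
  by (subst tm_in.simps) auto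

lemma tm_in_append: "tm_in Sg \<Gamma> M \<tau> \<Longrightarrow> tm_in Sg (\<Gamma> @ \<Delta>) M \<tau>"
  by (induction rule: tm_in.induct) (auto simp: nth_append elim: list_all2_mono)

text \<open>This is the list that \<open>fsubst\<close> carries under a quantifier: the old terms
  keep their levels, and the bound variable of the result sits at \<open>length \<Gamma>'\<close>,
  not at \<open>length \<Gamma>\<close>.\<close>

lemma term_lists_snoc:
  assumes "Ns \<in> term_lists Sg \<Gamma>' \<Gamma>"
  shows "Ns @ [V (length \<Gamma>')] \<in> term_lists Sg (\<Gamma>' @ [\<sigma>]) (\<Gamma> @ [\<sigma>])"
  using assms unfolding term_lists_def
  by (auto intro!: list_all2_appendI elim: list_all2_mono simp: tm_in_append)

lemma contexts_append [simp]: "\<Gamma> @ \<Delta> \<in> contexts Sg \<longleftrightarrow> \<Gamma> \<in> contexts Sg \<and> \<Delta> \<in> contexts Sg"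
  by (auto simp: contexts_def)

lemma contexts_single [simp]: "[\<sigma>] \<in> contexts Sg \<longleftrightarrow> \<sigma> \<in> sorts Sg"
  by (auto simp: contexts_def)

lemma contexts_Nil [simp]: "[] \<in> contexts Sg"
  by (auto simp: contexts_def)

lemma var_term_lists: "map V [0..<length \<Gamma>] \<in> term_lists Sg \<Gamma> \<Gamma>"
  "map V [0..<length \<Gamma>] \<in> term_lists Sg (\<Gamma> @ \<Delta>) \<Gamma>"
  "map V [length \<Gamma>..<length \<Gamma> + length \<Delta>] \<in> term_lists Sg (\<Gamma> @ \<Delta>) \<Delta>"
  by (auto simp: term_lists_def list_all2_conv_all_nth nth_append)

section \<open>Interpretation of terms in an arbitrary structure\<close>

locale fa_structure = fa_object Lg C
  for Lg :: "('q, 'k) lang" and C :: "('o, 'm, 'p, 'q, 'k) propcat" (structure) +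
  fixes Sg :: "('s, 'f, 'r) sig" and S :: "('s, 'f, 'r, 'o, 'm, 'p) str"
  assumes sig: "wf_sig Sg" and str: "is_structure Sg C S"
begin

abbreviation ctx :: "'s list \<Rightarrow> 'o" where "ctx \<equiv> ctxI C S"
abbreviation sortsI :: "'s list \<Rightarrow> 'o list" where "sortsI \<equiv> map (SortI S)"

text \<open>The future value of the induced morphism on the class of \<open>Ns\<close>. For lists of
  variables it also names the projections out of a longer context.\<close>

definition tmsI :: "'s list \<Rightarrow> 'f tm list \<Rightarrow> 'm" where
  "tmsI \<Gamma> Ns = tuple C (ctx \<Gamma>) (map (tmI C S \<Gamma>) Ns)"

lemma sort_obj: "\<sigma> \<in> sorts Sg \<Longrightarrow> SortI S \<sigma> \<in> Obj C"
  using str by (auto simp: is_structure_def)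

lemma sortsI_objs: "\<Gamma> \<in> contexts Sg \<Longrightarrow> set (sortsI \<Gamma>) \<subseteq> Obj C"
  using str by (auto simp: is_structure_def contexts_def)

lemma ctx_product: "\<Gamma> \<in> contexts Sg \<Longrightarrow> is_list_product C (sortsI \<Gamma>) (ctx \<Gamma>) (projs C (sortsI \<Gamma>))"
  unfolding ctxI_def by (rule list_prod_product[OF sortsI_objs])

lemmas ctx_obj = list_product_obj[OF ctx_product]
  and ctx_projs = list_product_cone[OF ctx_product]

lemma tmI_hom:
  assumes "\<Gamma> \<in> contexts Sg" "tm_in Sg \<Gamma> M \<tau>"
  shows "tmI C S \<Gamma> M \<in> hom C (ctx \<Gamma>) (SortI S \<tau>)"
  using assms(2)
proof (induction rule: tm_in.induct)
  case (tm_in_V i)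
  then show ?case using cone_nth[OF ctx_projs[OF assms(1)]] by simp
next
  case (tm_in_Fn f \<sigma>s \<tau> Ms)
  have "cone C (ctx \<Gamma>) (map (tmI C S \<Gamma>) Ms) (sortsI \<sigma>s)"
    using tm_in_Fn(2) by (auto simp: cone_def list_all2_map1 list_all2_map2 elim: list_all2_mono)
  moreover have "FunI S f \<in> hom C (ctx \<sigma>s) (SortI S \<tau>)"
    using str tm_in_Fn(1) by (simp add: is_structure_def)
  ultimately show ?case
    using comp_hom tuple_hom[OF ctx_obj[OF assms(1)]] by (simp add: ctxI_def)
qed

lemma tms_cone:
  "\<Gamma>' \<in> contexts Sg \<Longrightarrow> Ns \<in> term_lists Sg \<Gamma>' \<Gamma> \<Longrightarrow>
    cone C (ctx \<Gamma>') (map (tmI C S \<Gamma>') Ns) (sortsI \<Gamma>)"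
  unfolding cone_def term_lists_def
  by (auto simp: list_all2_map1 list_all2_map2 tmI_hom elim: list_all2_mono)

lemma tmsI_hom:
  "\<Gamma>' \<in> contexts Sg \<Longrightarrow> Ns \<in> term_lists Sg \<Gamma>' \<Gamma> \<Longrightarrow> tmsI \<Gamma>' Ns \<in> hom C (ctx \<Gamma>') (ctx \<Gamma>)"
  unfolding tmsI_def using tuple_hom[OF ctx_obj tms_cone] by (simp add: ctxI_def)

lemma projs_tmsI:
  "\<Gamma>' \<in> contexts Sg \<Longrightarrow> Ns \<in> term_lists Sg \<Gamma>' \<Gamma> \<Longrightarrow>
    map (\<lambda>p. p \<odot> tmsI \<Gamma>' Ns) (projs C (sortsI \<Gamma>)) = map (tmI C S \<Gamma>') Ns"
  unfolding tmsI_def using projs_tuple[OF ctx_obj tms_cone] .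

text \<open>\<open>h\<close> starts at an arbitrary object, so the lemma serves substitution as well
  as the comparison arrow of a morphism \<open>F\<close>.\<close>

lemma tmI_Fn_comp:
  assumes "\<Gamma> \<in> contexts Sg" "funs Sg f =
    Some (\<sigma>s, \<tau>)" "list_all2 (tm_in Sg \<Gamma>) Ms \<sigma>s" "h \<in> hom C a (ctx \<Gamma>)"
  shows "tmI C S \<Gamma> (Fn f Ms) \<odot> h = FunI S f \<odot> tuple C a (map (\<lambda>M. tmI C S \<Gamma> M \<odot> h) Ms)"
proof -
  have Ms: "Ms \<in> term_lists Sg \<Gamma> \<sigma>s" using assms(3) by (simp add: term_lists_def)
  have "FunI S f \<in> hom C (ctx \<sigma>s) (SortI S \<tau>)"
    using str assms(2) by (simp add: is_structure_def)
  from comp_assoc[OF this tmsI_hom[OF assms(1) Ms] assms(4)]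
  show ?thesis using tuple_comp[OF tms_cone[OF assms(1) Ms] assms(4)]
    by (simp add: tmsI_def o_def)
qed

text \<open>
  Common generalization of substitution (\<open>h'\<close> an identity) and of weakening (\<open>Ns\<close> the variables).
\<close>

lemma tmI_comp_cong:
  assumes "tm_in Sg \<Gamma> M \<tau>" and "h \<in> hom C a (ctx \<Gamma>)" "h' \<in> hom C a (ctx \<Gamma>')"
    and "\<Gamma> \<in> contexts Sg" "\<Gamma>' \<in> contexts Sg" "Ns \<in> term_lists Sg \<Gamma>' \<Gamma>"
    and "\<And>i. i < length \<Gamma> \<Longrightarrow> tmI C S \<Gamma>' (Ns ! i) \<odot> h' = projs C (sortsI \<Gamma>) ! i \<odot> h"
  shows "tmI C S \<Gamma>' (tsubst Ns M) \<odot> h' = tmI C S \<Gamma> M \<odot> h \<and> tm_in Sg \<Gamma>' (tsubst Ns M) \<tau>"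
  using assms(1)
proof (induction rule: tm_in.induct)
  case (tm_in_V i)
  then show ?case using assms(6,7) by (auto simp: term_lists_def list_all2_conv_all_nth)
next
  case (tm_in_Fn f \<sigma>s \<tau> Ms)
  \<comment> \<open>\<open>tmI_Fn_comp\<close> requires the substituted arguments to be well typed,
    which is why typing is carried through the induction together with the equation.\<close>
  have Ms: "list_all2 (tm_in Sg \<Gamma>) Ms \<sigma>s" "list_all2 (tm_in Sg \<Gamma>') (map (tsubst Ns) Ms) \<sigma>s"
    using tm_in_Fn(2) by (auto simp: list_all2_map1 elim: list_all2_mono)
  have "map (\<lambda>M. tmI C S \<Gamma>' M \<odot> h') (map (tsubst Ns) Ms) = map (\<lambda>M. tmI C S \<Gamma> M \<odot> h) Ms"
    using tm_in_Fn(2) by (auto simp: list_all2_conv_all_nth in_set_conv_nth)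
  then show ?case
    using tmI_Fn_comp[OF assms(4) tm_in_Fn(1) Ms(1) assms(2)]
      tmI_Fn_comp[OF assms(5) tm_in_Fn(1) Ms(2) assms(3)] Ms(2) tm_in_Fn(1)
    by (simp add: o_def cong: map_cong)
qed

lemma tmI_subst:
  assumes "\<Gamma> \<in> contexts Sg" "\<Gamma>' \<in> contexts Sg" "Ns \<in> term_lists Sg \<Gamma>' \<Gamma>" "tm_in Sg \<Gamma> M \<tau>"
  shows "tmI C S \<Gamma>' (tsubst Ns M) = tmI C S \<Gamma> M \<odot> tmsI \<Gamma>' Ns"
proof -
  have n: "length Ns = length \<Gamma>" "\<And>i. i < length \<Gamma> \<Longrightarrow> tm_in Sg \<Gamma>' (Ns ! i) (\<Gamma> ! i)"
    using assms(3) by (auto simp: term_lists_def list_all2_conv_all_nth)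
  note id = ident_hom[OF ctx_obj[OF assms(2)]]
  have "tmI C S \<Gamma>' (Ns ! i) \<odot> Ident C (ctx \<Gamma>') = projs C (sortsI \<Gamma>) ! i \<odot> tmsI \<Gamma>' Ns"
    if i: "i < length \<Gamma>" for i
    using arg_cong[OF projs_tmsI[OF assms(2,3)], of "\<lambda>l. l ! i"] i n(1)
      cone_length[OF ctx_projs[OF assms(1)]] comp_ident[OF tmI_hom[OF assms(2) n(2)[OF i]]]
    by simp
  from tmI_comp_cong[OF assms(4) tmsI_hom[OF assms(2,3)] id assms(1-3) this]
  show ?thesis using comp_ident[OF tmI_hom[OF assms(2)]] by auto
qed

lemma tsubst_ident: "tm_in Sg \<Gamma> M \<tau> \<Longrightarrow> tsubst (map V [0..<length \<Gamma>]) M = M"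
  by (induction rule: tm_in.induct)
    (auto simp: list_all2_conv_all_nth in_set_conv_nth intro!: nth_equalityI)

section \<open>Context extension and substitution in formulas\<close>

lemma snoc_map_ctx:
  assumes "\<Gamma> \<in> contexts Sg" "\<sigma> \<in> sorts Sg"
  shows "snoc_map C (sortsI \<Gamma>) (SortI S \<sigma>) \<in> hom C (Times C (ctx \<Gamma>) (SortI S \<sigma>)) (ctx (\<Gamma> @ [\<sigma>]))"
    and "map (\<lambda>p. p \<odot> snoc_map C (sortsI \<Gamma>) (SortI S \<sigma>)) (projs C (sortsI (\<Gamma> @ [\<sigma>]))) =
      map (\<lambda>p. p \<odot> Pr1 C (ctx \<Gamma>) (SortI S \<sigma>)) (projs C (sortsI \<Gamma>)) @ [Pr2 C (ctx \<Gamma>) (SortI S \<sigma>)]"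
  using snoc_map_hom[OF sortsI_objs[OF assms(1)] sort_obj[OF assms(2)]] by (simp_all add: ctxI_def)

lemma projs_snoc_map:
  assumes "\<Gamma> \<in> contexts Sg" "\<sigma> \<in> sorts Sg"
  shows "i < length \<Gamma> \<Longrightarrow> projs C (sortsI (\<Gamma> @ [\<sigma>])) ! i \<odot> snoc_map C (sortsI \<Gamma>) (SortI S \<sigma>) =
       projs C (sortsI \<Gamma>) ! i \<odot> Pr1 C (ctx \<Gamma>) (SortI S \<sigma>)"
    and "projs C (sortsI (\<Gamma> @ [\<sigma>])) ! length \<Gamma> \<odot> snoc_map C (sortsI \<Gamma>) (SortI S \<sigma>) =
      Pr2 C (ctx \<Gamma>) (SortI S \<sigma>)"
proof -
  have c: "\<Gamma> @ [\<sigma>] \<in> contexts Sg" using assms by simp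
  have l: "length (projs C (sortsI \<Gamma>)) = length \<Gamma>" "length (projs C (sortsI (\<Gamma> @ [\<sigma>]))) =
    Suc (length \<Gamma>)"
    using cone_length[OF ctx_projs[OF assms(1)]] cone_length[OF ctx_projs[OF c]] by auto
  note * = arg_cong[OF snoc_map_ctx(2)[OF assms], of "\<lambda>l. l ! i" for i]
  show "i < length \<Gamma> \<Longrightarrow> projs C (sortsI (\<Gamma> @ [\<sigma>])) ! i \<odot> snoc_map C (sortsI \<Gamma>) (SortI S \<sigma>) =
       projs C (sortsI \<Gamma>) ! i \<odot> Pr1 C (ctx \<Gamma>) (SortI S \<sigma>)"
    using *[of i] l by (simp add: nth_append)
  show "projs C (sortsI (\<Gamma> @ [\<sigma>])) ! length \<Gamma> \<odot> snoc_map C (sortsI \<Gamma>) (SortI S \<sigma>) =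
    Pr2 C (ctx \<Gamma>) (SortI S \<sigma>)"
    using *[of "length \<Gamma>"] l by (simp add: nth_append)
qed

text \<open>Weakening. With levels a weakened term is the same term, so \<open>tmI_comp_cong\<close>
  is applied to the list of variables of \<Gamma>, whose substitution is the identity.\<close>

lemma tmI_snoc_map:
  assumes "\<Gamma> \<in> contexts Sg" "\<sigma> \<in> sorts Sg" "tm_in Sg \<Gamma> M \<tau>"
  shows "tmI C S (\<Gamma> @ [\<sigma>]) M \<odot> snoc_map C (sortsI \<Gamma>) (SortI S \<sigma>) =
    tmI C S \<Gamma> M \<odot> Pr1 C (ctx \<Gamma>) (SortI S \<sigma>)"
proof -
  have "map V [0..<length \<Gamma>] \<in> term_lists Sg (\<Gamma> @ [\<sigma>]) \<Gamma>"
    by (auto simp: term_lists_def list_all2_conv_all_nth nth_append)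
  from tmI_comp_cong[OF assms(3) pr1_hom[OF ctx_obj[OF assms(1)] sort_obj[OF assms(2)]]
      snoc_map_ctx(1)[OF assms(1,2)] assms(1) _ this]
  show ?thesis using assms projs_snoc_map(1)[OF assms(1,2)] tsubst_ident[OF assms(3)] by simp
qed

lemma fmI_pred: "\<Gamma> \<in> contexts Sg \<Longrightarrow> fm_in Lg Sg \<Gamma> \<phi> \<Longrightarrow> fmI C S \<Gamma> \<phi> \<in> Pred C (ctx \<Gamma>)"
proof (induction \<phi> arbitrary: \<Gamma>)
  case (Rl R Ms)
  then obtain \<sigma>s where R: "rels Sg R = Some \<sigma>s" and Ms: "Ms \<in> term_lists Sg \<Gamma> \<sigma>s"
    by (auto simp: term_lists_def)
  have "RelI S R \<in> Pred C (ctx \<sigma>s)" using str R by (simp add: is_structure_def)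
  from act_pred[OF tmsI_hom[OF Rl(1) Ms] this] show ?case by (simp add: tmsI_def)
next
  case (Eqn \<sigma> M N)
  then show ?case using act_pred[OF pair_hom eq_pred] tmI_hom sort_obj by simp
next
  case (Cn k \<phi>s)
  then show ?case using con_pred[OF ctx_obj] by (auto simp: image_subset_iff)
next
  case (Qt q \<sigma> \<phi>)
  then have "\<sigma> \<in> sorts Sg" "q \<in> quantifiers Lg"
    and I: "fmI C S (\<Gamma> @ [\<sigma>]) \<phi> \<in> Pred C (ctx (\<Gamma> @ [\<sigma>]))" by auto
  then show ?case
    using quant_pred act_pred[OF snoc_map_ctx(1) I] ctx_obj sort_obj Qt(2) by simp
qed

text \<open>Contexts and \<open>Ns\<close> vary in the induction because a quantifier extends both
  contexts and appends a variable to the list. Its case reduces to a commuting square: up to the two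
  arrows \<open>snoc_map\<close>, the extended substitution is the product of the old one with an
  identity.\<close>

lemma fmI_subst:
  "\<Gamma> \<in> contexts Sg \<Longrightarrow> \<Gamma>' \<in> contexts Sg \<Longrightarrow> Ns \<in> term_lists Sg \<Gamma>' \<Gamma> \<Longrightarrow> fm_in Lg Sg \<Gamma> \<phi> \<Longrightarrow>
    fmI C S \<Gamma>' (fsubst (length \<Gamma>') Ns \<phi>) = Act C (tmsI \<Gamma>' Ns) (fmI C S \<Gamma> \<phi>)"
proof (induction \<phi> arbitrary: \<Gamma> \<Gamma>' Ns)
  case (Rl R Ms)
  then obtain \<sigma>s where R: "rels Sg R = Some \<sigma>s" and Ms: "Ms \<in> term_lists Sg \<Gamma> \<sigma>s"
    by (auto simp: term_lists_def)
  have RI: "RelI S R \<in> Pred C (ctx \<sigma>s)" using str R by (simp add: is_structure_def)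
  have "tmI C S \<Gamma>' (tsubst Ns M) = tmI C S \<Gamma> M \<odot> tmsI \<Gamma>' Ns" if "M \<in> set Ms" for M
    using that Ms tmI_subst[OF Rl(1-3)]
      by (auto simp: term_lists_def list_all2_conv_all_nth in_set_conv_nth)
  then have "map (tmI C S \<Gamma>') (map (tsubst Ns) Ms) = map (\<lambda>f. f \<odot> tmsI \<Gamma>' Ns) (map (tmI C S \<Gamma>) Ms)"
    by simp
  then show ?case
    using act_comp[OF tmsI_hom[OF Rl(1) Ms] tmsI_hom[OF Rl(2,3)] RI]
      tuple_comp[OF tms_cone[OF Rl(1) Ms] tmsI_hom[OF Rl(2,3)]]
    by (simp add: tmsI_def[of \<Gamma> Ms] o_def cong: map_cong)
next
  case (Eqn \<sigma> M N)
  then have M: "\<sigma> \<in> sorts Sg" "tm_in Sg \<Gamma> M \<sigma>" "tm_in Sg \<Gamma> N \<sigma>" by auto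
  note h = tmI_hom[OF Eqn(1) M(2)] tmI_hom[OF Eqn(1) M(3)] and t = tmsI_hom[OF Eqn(2,3)]
  show ?case
    using tmI_subst[OF Eqn(1-3)] M pair_comp[OF h t] act_comp[OF pair_hom[OF h]
      t eq_pred[OF sort_obj]] by simp
next
  case (Cn k \<phi>s)
  have IH: "fmI C S \<Gamma>' (fsubst (length \<Gamma>') Ns \<phi>) =
    Act C (tmsI \<Gamma>' Ns) (fmI C S \<Gamma> \<phi>)" if "\<phi> \<in> set \<phi>s" for \<phi>
    using Cn that by auto
  have "fmI C S \<Gamma> ` set \<phi>s \<subseteq> Pred C (ctx \<Gamma>)" using Cn(2,5) fmI_pred by auto
  then show ?case
    using act_con[OF tmsI_hom[OF Cn(3,4)], of k "map (fmI C S \<Gamma>) \<phi>s"] Cn(5) IH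
    by (auto simp: o_def cong: map_cong)
next
  case (Qt q \<sigma> \<phi>)
  then have q: "q \<in> quantifiers Lg" and s: "\<sigma> \<in> sorts Sg" and f: "fm_in Lg Sg (\<Gamma> @ [\<sigma>]) \<phi>" by auto
  have c: "\<Gamma> @ [\<sigma>] \<in> contexts Sg" "\<Gamma>' @ [\<sigma>] \<in> contexts Sg" using s Qt(2,3) by auto
  let ?c = "SortI S \<sigma>" and ?X = "fmI C S (\<Gamma> @ [\<sigma>]) \<phi>"
  let ?Ns = "Ns @ [V (length \<Gamma>')]" and ?h = "tmsI \<Gamma>' Ns"
  let ?s = "snoc_map C (sortsI \<Gamma>) ?c" and ?s' = "snoc_map C (sortsI \<Gamma>') ?c"
  note so = sort_obj[OF s]
  note X = fmI_pred[OF c(1) f]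
  note h = tmsI_hom[OF Qt(3,4)]
  note Ns = term_lists_snoc[OF Qt(4)]
  note h' = tmsI_hom[OF c(2) Ns]
  note sn = snoc_map_ctx(1)[OF Qt(2) s] and sn' = snoc_map_ctx(1)[OF Qt(3) s]
  note p = pr1_hom[OF ctx_obj[OF Qt(3)] so] pr2_hom[OF ctx_obj[OF Qt(3)] so]
  note p0 = pr1_hom[OF ctx_obj[OF Qt(2)] so] pr2_hom[OF ctx_obj[OF Qt(2)] so]
  \<comment> \<open>This is \<open>?h \<times> id\<close>, the arrow along which naturality of
    \<open>Quant\<close> pulls the body back.\<close>
  let ?k = "pair C (?h \<odot> Pr1 C (ctx \<Gamma>') ?c) (Pr2 C (ctx \<Gamma>') ?c)"
  note hp = comp_hom[OF h p(1)]
  note k = pair_hom[OF hp p(2)]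
  let ?ps = "projs C (sortsI (\<Gamma> @ [\<sigma>]))"
  have "tmsI (\<Gamma>' @ [\<sigma>]) ?Ns \<odot> ?s' = ?s \<odot> ?k"
  proof (rule list_product_eq[OF ctx_product[OF c(1)] comp_hom[OF h' sn'] comp_hom[OF sn k]])
    have "map (\<lambda>p. p \<odot> (tmsI (\<Gamma>' @ [\<sigma>]) ?Ns \<odot> ?s')) ?ps =
      map (\<lambda>p. p \<odot> ?s') (map (tmI C S (\<Gamma>' @ [\<sigma>])) ?Ns)"
      using cone_comp_comp[OF ctx_projs[OF c(1)] h' sn'] unfolding projs_tmsI[OF c(2) Ns]
        by (rule sym)
    \<comment> \<open>The old terms are weakened ones, and the appended variable becomes the last
      projection.\<close>
    also have "\<dots> = map (\<lambda>N. tmI C S \<Gamma>' N \<odot> Pr1 C (ctx \<Gamma>') ?c) Ns @ [Pr2 C (ctx \<Gamma>') ?c]"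
    proof -
      have "\<exists>\<tau>. tm_in Sg \<Gamma>' N \<tau>" if "N \<in> set Ns" for N
        using Qt(4) that by (auto simp: term_lists_def list_all2_conv_all_nth in_set_conv_nth)
      then have "tmI C S (\<Gamma>' @ [\<sigma>]) N \<odot> ?s' =
        tmI C S \<Gamma>' N \<odot> Pr1 C (ctx \<Gamma>') ?c" if "N \<in> set Ns" for N
        using that tmI_snoc_map[OF Qt(3) s] by blast
      then show ?thesis using projs_snoc_map(2)[OF Qt(3) s] by simp
    qed
    also have "\<dots> = map (\<lambda>p. p \<odot> (?h \<odot> Pr1 C (ctx \<Gamma>') ?c)) (projs C (sortsI \<Gamma>)) @ [Pr2 C
      (ctx \<Gamma>') ?c]"
      using cone_comp_comp[OF ctx_projs[OF Qt(2)] h p(1)] projs_tmsI[OF Qt(3,4)]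
        by (simp add: o_def)
    also have "\<dots> = map (\<lambda>p. p \<odot> ?k) (map (\<lambda>p. p \<odot> Pr1 C (ctx \<Gamma>) ?c) (projs C (sortsI \<Gamma>)) @ [Pr2 C
      (ctx \<Gamma>) ?c])"
      using cone_comp_comp[OF ctx_projs[OF Qt(2)] p0(1) k] pr1_pair[OF hp p(2)]
        pr2_pair[OF hp p(2)] by simp
    also have "\<dots> = map (\<lambda>p. p \<odot> (?s \<odot> ?k)) ?ps"
      using cone_comp_comp[OF ctx_projs[OF c(1)] sn k] unfolding snoc_map_ctx(2)[OF Qt(2) s] .
    finally show "map (\<lambda>p. p \<odot> (tmsI (\<Gamma>' @ [\<sigma>]) ?Ns \<odot> ?s')) ?ps = map (\<lambda>p. p \<odot> (?s \<odot> ?k)) ?ps" .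
  qed
  moreover have "fmI C S (\<Gamma>' @ [\<sigma>]) (fsubst (Suc (length \<Gamma>')) ?Ns \<phi>) =
    Act C (tmsI (\<Gamma>' @ [\<sigma>]) ?Ns) ?X"
    using Qt.IH[OF c Ns f] by simp
  ultimately show ?case
    using act_quant[OF q h so act_pred[OF sn X]] act_comp[OF h' sn' X] act_comp[OF sn k X] by simp
qed

section \<open>Equality and quantification over whole contexts\<close>

lemma fmI_tensor_fm:
  "fmI C S \<Gamma> (tensor_fm Lg \<phi>s) = tensor_list Lg C (ctx \<Gamma>) (map (fmI C S \<Gamma>) \<phi>s)"
proof (cases \<phi>s)
  case (Cons \<phi> \<psi>s)
  have "fmI C S \<Gamma> (foldl (\<lambda>\<psi> \<chi>. Cn (tensor_con Lg) [\<psi>, \<chi>]) \<phi> \<psi>s) =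
      foldl (tensor Lg C (ctx \<Gamma>)) (fmI C S \<Gamma> \<phi>) (map (fmI C S \<Gamma>) \<psi>s)"
    by (induction \<psi>s arbitrary: \<phi>) (simp_all add: tensor_def)
  then show ?thesis using Cons by simp
qed (simp add: e_pred_def)

lemma projs_tmsI_nth:
  assumes "\<Gamma> \<in> contexts Sg" "\<Gamma>' \<in> contexts Sg" "Ns \<in> term_lists Sg \<Gamma>' \<Gamma>" "i < length \<Gamma>"
  shows "projs C (sortsI \<Gamma>) ! i \<odot> tmsI \<Gamma>' Ns = tmI C S \<Gamma>' (Ns ! i)"
  using arg_cong[OF projs_tmsI[OF assms(2,3)], of "\<lambda>l. l ! i"] assms(3,4)
    cone_length[OF ctx_projs[OF assms(1)]]
  by (simp add: term_lists_def list_all2_conv_all_nth)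

text \<open>\<open>act_pair_eq_list_prod\<close> for the two halves of the doubled context:
  composition with projection \<open>i\<close> turns the two arrows into the variables
  \<open>i\<close> and \<open>n + i\<close>, so the factors are those of \<open>eq_fm\<close>. The
  right-hand side already has the form required of a morphism, as the two arrows are the images of
  the projections of \<open>\<Gamma> @ \<Gamma>\<close>.\<close>

lemma fmI_eq_fm:
  assumes "\<Gamma> \<in> contexts Sg"
  defines "n \<equiv> length \<Gamma>"
  shows "fmI C S (\<Gamma> @ \<Gamma>) (eq_fm Lg \<Gamma>) =
    Act C (pair C (tmsI (\<Gamma> @ \<Gamma>) (map V [0..<n])) (tmsI (\<Gamma> @ \<Gamma>) (map V [n..<n + n]))) (EqP C
      (ctx \<Gamma>))"
proof -
  have V: "map V [0..<n] \<in> term_lists Sg (\<Gamma> @ \<Gamma>) \<Gamma>" "map V [n..<n + n] \<in> term_lists Sg (\<Gamma> @ \<Gamma>) \<Gamma>"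
    by (auto simp: term_lists_def list_all2_conv_all_nth nth_append n_def)
  have c: "\<Gamma> @ \<Gamma> \<in> contexts Sg" using assms by simp
  note h = tmsI_hom[OF c V(1), unfolded ctxI_def[of C S \<Gamma>]]
    tmsI_hom[OF c V(2), unfolded ctxI_def[of C S \<Gamma>]]
  have "map (\<lambda>i. Act C (pair C (projs C (sortsI \<Gamma>) ! i \<odot> tmsI (\<Gamma> @ \<Gamma>) (map V [0..<n]))
          (projs C (sortsI \<Gamma>) ! i \<odot> tmsI (\<Gamma> @ \<Gamma>) (map V [n..<n + n]))) (EqP C (sortsI \<Gamma> ! i)))
        [0..<length (sortsI \<Gamma>)] =
      map (fmI C S (\<Gamma> @ \<Gamma>)) (map (\<lambda>i. Eqn (\<Gamma> ! i) (V i) (V (n + i))) [0..<n])"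
    using projs_tmsI_nth[OF assms(1) c V(1)] projs_tmsI_nth[OF assms(1) c V(2)]
    by (auto simp: n_def)
  with act_pair_eq_list_prod[OF sortsI_objs[OF assms(1)] h] show ?thesis
    by (simp add: eq_fm_def fmI_tensor_fm n_def ctxI_def[of C S \<Gamma>] del: map_eq_conv map_map)
qed

text \<open>
  \<open>u\<close> is the canonical arrow.  Products of contexts are bracketed to the left, so appending a
  variable to \<open>\<Delta>\<close> is an instance of the axiom for \<open>\<Omega>\<close> on \<open>c \<times> d\<close>, unless \<open>\<Delta> = []\<close>: the product
  of \<open>[c]\<close> is \<open>c\<close> and not \<open>1 \<times> c\<close>.
\<close>

lemma fmI_quantify:
  assumes "q \<in> quantifiers Lg" "\<Gamma> \<in> contexts Sg" "\<Delta> \<in> contexts Sg" "fm_in Lg Sg (\<Gamma> @ \<Delta>) \<phi>"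
    and "u \<in> hom C (Times C (ctx \<Gamma>) (ctx \<Delta>)) (ctx (\<Gamma> @ \<Delta>))"
    and "map (\<lambda>p. p \<odot> u) (projs C (sortsI (\<Gamma> @ \<Delta>))) =
      map (\<lambda>p. p \<odot> Pr1 C (ctx \<Gamma>) (ctx \<Delta>)) (projs C (sortsI \<Gamma>)) @
      map (\<lambda>p. p \<odot> Pr2 C (ctx \<Gamma>) (ctx \<Delta>)) (projs C (sortsI \<Delta>))"
  shows "fmI C S \<Gamma> (quantify q \<Delta> \<phi>) = Quant C q (ctx \<Gamma>) (ctx \<Delta>) (Act C u (fmI C S (\<Gamma> @ \<Delta>) \<phi>))"
  using assms(3-)
proof (induction \<Delta> arbitrary: \<phi> u rule: rev_induct)
  case Nil
  have o: "ctx [] = One C" by (simp add: ctxI_def)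
  \<comment> \<open>An arrow with the components of the first projection is that projection, so the
    axiom for \<Omega> over \<open>One\<close> applies.\<close>
  have "u = Pr1 C (ctx \<Gamma>) (One C)"
    using Nil pr1_hom[OF ctx_obj[OF assms(2)] one_obj]
    by (intro list_product_eq[OF ctx_product[OF assms(2)]]) (auto simp: o)
  then show ?case
    using quant_one[OF assms(1) ctx_obj fmI_pred, OF assms(2) assms(2)] Nil(2)
      by (simp add: o quantify_def)
next
  case (snoc \<sigma> \<Delta>)
  let ?s = "SortI S \<sigma>" and ?B = "ctx \<Gamma>" and ?D = "ctx \<Delta>"
  have D: "\<Delta> \<in> contexts Sg" "\<sigma> \<in> sorts Sg" using snoc.prems(1) by auto
  have cs: "\<Gamma> @ \<Delta> \<in> contexts Sg" "\<Gamma> @ \<Delta> @ [\<sigma>] \<in> contexts Sg" "(\<Gamma> @ \<Delta>) @ [\<sigma>] \<in> contexts Sg"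
    using D assms(2) by auto
  note B = ctx_obj[OF assms(2)] ctx_obj[OF D(1)] sort_obj[OF D(2)]
  note BD = times_obj[OF B(1,2)] and Ds = times_obj[OF B(2,3)]
  show ?case
  proof (cases "\<Delta> = []")
    case True
    have s: "ctx [\<sigma>] = ?s" by (simp add: ctxI_def)
    \<comment> \<open>Here \<open>u\<close> is forced to be the arrow built into the interpretation
      of \<open>Qt\<close>, so the claim is its defining equation.\<close>
    have "u = snoc_map C (sortsI \<Gamma>) ?s"
      using snoc.prems(3,4) snoc_map_ctx[OF assms(2) D(2)] ident_comp[OF pr2_hom[OF B(1,3)]] True
      by (intro list_product_eq[OF ctx_product[OF cs(3)]]) (auto simp: s simp del: map_eq_conv)
    then show ?thesis using True by (simp add: quantify_def s)
  next
    case False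
    have D': "ctx (\<Delta> @ [\<sigma>]) = Times C ?D ?s"
      using list_prod_snoc[of "sortsI \<Delta>" ?s] False by (simp add: ctxI_def)
    let ?P = "\<lambda>\<Gamma>. projs C (sortsI \<Gamma>)"
    have PD: "?P (\<Delta> @ [\<sigma>]) = map (\<lambda>p. p \<odot> Pr1 C ?D ?s) (?P \<Delta>) @ [Pr2 C ?D ?s]"
      using projs_snoc[of "sortsI \<Delta>" ?s] False by (simp add: ctxI_def)
    have "cone C (Times C ?B ?D) (map (\<lambda>p. p \<odot> Pr1 C ?B ?D) (?P \<Gamma>) @ map (\<lambda>p. p \<odot> Pr2 C ?B ?D)
      (?P \<Delta>))
      (sortsI (\<Gamma> @ \<Delta>))"
      using cone_comp[OF ctx_projs[OF assms(2)] pr1_hom[OF B(1,2)]]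
        cone_comp[OF ctx_projs[OF D(1)] pr2_hom[OF B(1,2)]]
      unfolding cone_def map_append by (rule list_all2_appendI)
    \<comment> \<open>The canonical arrow for the shorter list, to which the induction hypothesis is
      applied.\<close>
    then obtain u' where u': "u' \<in> hom C (Times C ?B ?D) (ctx (\<Gamma> @ \<Delta>))"
      "map (\<lambda>p. p \<odot> u') (?P (\<Gamma> @ \<Delta>)) = map (\<lambda>p. p \<odot> Pr1 C ?B ?D) (?P \<Gamma>) @ map (\<lambda>p. p \<odot>
        Pr2 C ?B ?D) (?P \<Delta>)"
      using list_product_ex[OF ctx_product[OF cs(1)] BD] by blast
    let ?X = "fmI C S ((\<Gamma> @ \<Delta>) @ [\<sigma>]) \<phi>" and ?sn = "snoc_map C (sortsI (\<Gamma> @ \<Delta>)) ?s"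
    let ?p1 = "Pr1 C (Times C ?B ?D) ?s" and ?p2 = "Pr2 C (Times C ?B ?D) ?s"
    let ?k = "pair C (u' \<odot> ?p1) ?p2" and ?a = "assoc C ?B ?D ?s"
    let ?q1 = "Pr1 C ?B (Times C ?D ?s)" and ?q2 = "Pr2 C ?B (Times C ?D ?s)"
    let ?w = "pair C ?q1 (Pr1 C ?D ?s \<odot> ?q2)"
    have f: "fm_in Lg Sg ((\<Gamma> @ \<Delta>) @ [\<sigma>]) \<phi>" using snoc.prems(2) by simp
    note X = fmI_pred[OF cs(3) f]
    note sn = snoc_map_ctx(1)[OF cs(1) D(2)]
    note p = pr1_hom[OF BD B(3)] pr2_hom[OF BD B(3)]
    note q = pr1_hom[OF B(1) Ds] pr2_hom[OF B(1) Ds]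
    note q' = comp_hom[OF pr1_hom[OF B(2,3)] q(2)] comp_hom[OF pr2_hom[OF B(2,3)] q(2)]
    note w = pair_hom[OF q(1) q'(1)]
    note up = comp_hom[OF u'(1) p(1)]
    note k = pair_hom[OF up p(2)]
    have a: "?a \<in> hom C (Times C ?B (Times C ?D ?s)) (Times C (Times C ?B ?D) ?s)"
      unfolding assoc_def by (rule pair_hom[OF w q'(2)])
    have pa: "?p1 \<odot> ?a = ?w" "?p2 \<odot> ?a = Pr2 C ?D ?s \<odot> ?q2"
      unfolding assoc_def by (rule pr1_pair[OF w q'(2)], rule pr2_pair[OF w q'(2)])
    note ka = comp_hom[OF k a]
    note PP = pr1_hom[OF ctx_obj[OF cs(1)] B(3)] pr2_hom[OF ctx_obj[OF cs(1)] B(3)]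
    have ka1: "Pr1 C (ctx (\<Gamma> @ \<Delta>)) ?s \<odot> (?k \<odot> ?a) = u' \<odot> ?w"
      using comp_assoc[OF PP(1) k a] pr1_pair[OF up p(2)] comp_assoc[OF u'(1) p(1) a] pa(1) by simp
    have ka2: "Pr2 C (ctx (\<Gamma> @ \<Delta>)) ?s \<odot> (?k \<odot> ?a) = Pr2 C ?D ?s \<odot> ?q2"
      using comp_assoc[OF PP(2) k a] pr2_pair[OF up p(2)] pa(2) by simp
    have u: "u \<in> hom C (Times C ?B (Times C ?D ?s)) (ctx ((\<Gamma> @ \<Delta>) @ [\<sigma>]))"
      using snoc.prems(3) by (simp add: D')
    \<comment> \<open>Splits \<open>u\<close> into rebracketing, \<open>u' \<times> id\<close> and
      \<open>snoc_map\<close>. The factor \<open>?a\<close> is absorbed by the axiom for \<Omega> on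
      a product, \<open>?k\<close> by naturality, and \<open>?sn\<close> by the interpretation of
      \<open>Qt\<close>.\<close>
    have "?sn \<odot> (?k \<odot> ?a) = u"
    proof (rule list_product_eq[OF ctx_product[OF cs(3)] comp_hom[OF sn ka] u])
      have "map (\<lambda>p. p \<odot> (?sn \<odot> (?k \<odot> ?a))) (?P ((\<Gamma> @ \<Delta>) @ [\<sigma>])) =
          map (\<lambda>p. p \<odot> (?k \<odot> ?a)) (map (\<lambda>p. p \<odot> Pr1 C (ctx (\<Gamma> @ \<Delta>)) ?s) (?P (\<Gamma> @ \<Delta>)) @ [Pr2 C (ctx
            (\<Gamma> @ \<Delta>)) ?s])"
        using cone_comp_comp[OF ctx_projs[OF cs(3)] sn ka]
        unfolding snoc_map_ctx(2)[OF cs(1) D(2)] by (rule sym)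
      also have "\<dots> = map (\<lambda>p. p \<odot> (u' \<odot> ?w)) (?P (\<Gamma> @ \<Delta>)) @ [Pr2 C ?D ?s \<odot> ?q2]"
        using cone_comp_comp[OF ctx_projs[OF cs(1)] PP(1) ka] ka1 ka2 by (simp del: map_eq_conv)
      also have "map (\<lambda>p. p \<odot> (u' \<odot> ?w)) (?P (\<Gamma> @ \<Delta>)) =
          map (\<lambda>p. p \<odot> ?w) (map (\<lambda>p. p \<odot> Pr1 C ?B ?D) (?P \<Gamma>) @ map (\<lambda>p. p \<odot> Pr2 C ?B ?D) (?P \<Delta>))"
        using cone_comp_comp[OF ctx_projs[OF cs(1)] u'(1) w] unfolding u'(2) by (rule sym)
      also have "\<dots> = map (\<lambda>p. p \<odot> ?q1) (?P \<Gamma>) @ map (\<lambda>p. p \<odot> (Pr1 C ?D ?s \<odot> ?q2)) (?P \<Delta>)"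
        using cone_comp_comp[OF ctx_projs[OF assms(2)] pr1_hom[OF B(1,2)] w]
          cone_comp_comp[OF ctx_projs[OF D(1)] pr2_hom[OF B(1,2)] w]
          pr1_pair[OF q(1) q'(1)] pr2_pair[OF q(1) q'(1)]
        by (simp del: map_eq_conv)
      also have "(\<dots>) @ [Pr2 C ?D ?s \<odot> ?q2] =
          map (\<lambda>p. p \<odot> ?q1) (?P \<Gamma>) @ map (\<lambda>p. p \<odot> ?q2) (?P (\<Delta> @ [\<sigma>]))"
        using cone_comp_comp[OF ctx_projs[OF D(1)] pr1_hom[OF B(2,3)] q(2)] unfolding PD
        by (simp del: map_eq_conv)
      also have "\<dots> = map (\<lambda>p. p \<odot> u) (?P ((\<Gamma> @ \<Delta>) @ [\<sigma>]))"
        using snoc.prems(4) unfolding D' append_assoc by (rule sym)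
      finally show "map (\<lambda>p. p \<odot> (?sn \<odot> (?k \<odot> ?a))) (?P ((\<Gamma> @ \<Delta>) @ [\<sigma>])) =
          map (\<lambda>p. p \<odot> u) (?P ((\<Gamma> @ \<Delta>) @ [\<sigma>]))" .
    qed
    then have "Act C u ?X = Act C ?a (Act C ?k (Act C ?sn ?X))"
      using act_comp[OF sn ka X] act_comp[OF k a act_pred[OF sn X]] by simp
    \<comment> \<open>The last variable is bound innermost, so removing it from the end of the
      context moves its quantifier into the body.\<close>
    moreover have "fmI C S \<Gamma> (quantify q \<Delta> (Qt q \<sigma> \<phi>)) =
        Quant C q ?B ?D (Act C u' (fmI C S (\<Gamma> @ \<Delta>) (Qt q \<sigma> \<phi>)))"
      using snoc.IH[OF D(1) _ u'] f D(2) assms(1) by simp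
    moreover have "Act C u' (Quant C q (ctx (\<Gamma> @ \<Delta>)) ?s (Act C ?sn ?X)) =
        Quant C q (Times C ?B ?D) ?s (Act C ?k (Act C ?sn ?X))"
      by (rule act_quant[OF assms(1) u'(1) B(3) act_pred[OF sn X]])
    moreover note quant_times[OF assms(1) B act_pred[OF k act_pred[OF sn X]]]
    ultimately show ?thesis by (simp add: quantify_def D')
  qed
qed

section \<open>Identities, composites and projections as lists of terms\<close>

lemma tmsI_vars: "\<Gamma> \<in> contexts Sg \<Longrightarrow> tmsI \<Gamma> (map V [0..<length \<Gamma>]) = Ident C (ctx \<Gamma>)"
  using tuple_projs[OF sortsI_objs] cone_length[OF ctx_projs] map_nth[of "projs C (sortsI \<Gamma>)"]
  by (simp add: tmsI_def o_def ctxI_def)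

lemma tmsI_comp:
  assumes "\<Gamma> \<in> contexts Sg" "\<Gamma>' \<in> contexts Sg" "Ns \<in> term_lists Sg \<Gamma>' \<Gamma>" "Ms \<in> term_lists Sg \<Gamma> \<Delta>"
  shows "tmsI \<Gamma>' (map (tsubst Ns) Ms) = tmsI \<Gamma> Ms \<odot> tmsI \<Gamma>' Ns"
proof -
  have "\<exists>\<tau>. tm_in Sg \<Gamma> M \<tau>" if "M \<in> set Ms" for M
    using assms(4) that by (auto simp: term_lists_def list_all2_conv_all_nth in_set_conv_nth)
  then have "tmI C S \<Gamma>' (tsubst Ns M) = tmI C S \<Gamma> M \<odot> tmsI \<Gamma>' Ns" if "M \<in> set Ms" for M
    using that tmI_subst[OF assms(1-3)] by blast
  then have eq: "map (tmI C S \<Gamma>') (map (tsubst Ns) Ms) =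
    map (\<lambda>f. f \<odot> tmsI \<Gamma>' Ns) (map (tmI C S \<Gamma>) Ms)"
    by simp
  show ?thesis
    unfolding tmsI_def[of \<Gamma>' "map (tsubst Ns) Ms"] tmsI_def[of \<Gamma> Ms] eq
    by (rule tuple_comp[OF tms_cone[OF assms(1,4)] tmsI_hom[OF assms(2,3)], symmetric])
qed

text \<open>Links the flat projections of a concatenated context to its two halves. It yields both
  the preservation of products by the induced morphism and the components of the inverse comparison
  arrow in \<open>induced_quant\<close>.\<close>

lemma projs_append:
  assumes "\<Gamma> \<in> contexts Sg" "\<Delta> \<in> contexts Sg"
  shows "map (\<lambda>p. p \<odot> tmsI (\<Gamma> @ \<Delta>) (map V [0..<length \<Gamma>])) (projs C (sortsI \<Gamma>)) @
    map (\<lambda>p. p \<odot> tmsI (\<Gamma> @ \<Delta>) (map V [length \<Gamma>..<length \<Gamma> + length \<Delta>])) (projs C (sortsI \<Delta>)) =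
    projs C (sortsI (\<Gamma> @ \<Delta>))"
proof -
  have c: "\<Gamma> @ \<Delta> \<in> contexts Sg" using assms by simp
  have "map (tmI C S (\<Gamma> @ \<Delta>)) (map V [0..<length \<Gamma>] @ map V [length \<Gamma>..<length \<Gamma> + length \<Delta>]) =
      projs C (sortsI (\<Gamma> @ \<Delta>))"
    using cone_length[OF ctx_projs[OF c]]
    by (auto intro!: nth_equalityI simp: nth_append)
  then show ?thesis
    unfolding projs_tmsI[OF c var_term_lists(2)] projs_tmsI[OF c var_term_lists(3)] by simp
qed

end


section \<open>The classifying prop-category\<close>

lemma rep_related:
  assumes "equiv A r" "x \<in> A"
  shows "(x, rep (r `` {x})) \<in> r"
proof -
  have "x \<in> r `` {x}" using assms by (rule equiv_class_self)
  then have "rep (r `` {x}) \<in> r `` {x}" unfolding rep_def by (rule someI)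
  then show ?thesis by simp
qed

text \<open>What adequacy supplies for a single theory, detached from the logic.\<close>

locale classifying_theory =
  fixes Lg :: "('q, 'k) lang" and Sg :: "('s, 'f, 'r) sig" and T :: "('s, 'f, 'r, 'q, 'k) thy"
  assumes signature: "wf_sig Sg" and language: "wf_lang Lg"
    and well_defined: "classifying_well_defined Lg Sg T"
    and fa_classifying: "FA_obj Lg (classifying Lg Sg T)"
begin

abbreviation CT where "CT \<equiv> classifying Lg Sg T"

sublocale syn: fa_object Lg "classifying Lg Sg T"
  by unfold_locales (rule language, rule fa_classifying)

lemma classifying_simps [simp]:
  "Obj CT = contexts Sg" "One CT = []" "Times CT \<Gamma> \<Delta> = \<Gamma> @ \<Delta>"
  "Ident CT \<Gamma> = tm_class T \<Gamma> \<Gamma> (map V [0..<length \<Gamma>])"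
  "Pr1 CT \<Gamma> \<Delta> = tm_class T (\<Gamma> @ \<Delta>) \<Gamma> (map V [0..<length \<Gamma>])"
  "Pr2 CT \<Gamma> \<Delta> = tm_class T (\<Gamma> @ \<Delta>) \<Delta> (map V [length \<Gamma>..<length \<Gamma> + length \<Delta>])"
  "Pred CT \<Gamma> = formulas Lg Sg \<Gamma> // fm_eq T \<Gamma>"
  "EqP CT \<Gamma> = fm_class T (\<Gamma> @ \<Gamma>) (eq_fm Lg \<Gamma>)"
  by (simp_all add: classifying_def)

lemma term_eq_equiv:
  "\<Gamma>' \<in> contexts Sg \<Longrightarrow> \<Gamma> \<in> contexts Sg \<Longrightarrow> equiv (term_lists Sg \<Gamma>' \<Gamma>) (term_eq T \<Gamma>' \<Gamma>)"
  using well_defined[unfolded classifying_well_defined_def, THEN conjunct1] by blast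

lemma term_eq_subst:
  "\<Gamma>' \<in> contexts Sg \<Longrightarrow> \<Gamma> \<in> contexts Sg \<Longrightarrow> \<Delta> \<in> contexts Sg \<Longrightarrow>
    (Ns, Ns') \<in> term_eq T \<Gamma>' \<Gamma> \<Longrightarrow> (Ms, Ms') \<in> term_eq T \<Gamma> \<Delta> \<Longrightarrow>
    (map (tsubst Ns) Ms, map (tsubst Ns') Ms') \<in> term_eq T \<Gamma>' \<Delta>"
  using well_defined[unfolded classifying_well_defined_def, THEN conjunct2, THEN conjunct1] by fast

lemma fm_eq_equiv: "\<Gamma> \<in> contexts Sg \<Longrightarrow> equiv (formulas Lg Sg \<Gamma>) (fm_eq T \<Gamma>)"
  using well_defined[unfolded classifying_well_defined_def, THEN conjunct2, THEN conjunct2,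
    THEN conjunct1] by blast

lemma fm_eq_sequent:
  "\<Gamma> \<in> contexts Sg \<Longrightarrow> (\<phi>, \<phi>') \<in> fm_eq T \<Gamma> \<Longrightarrow> (\<psi>, \<psi>') \<in> fm_eq T \<Gamma> \<Longrightarrow>
    Sequent \<Gamma> [\<phi>] \<psi> \<in> T \<Longrightarrow> Sequent \<Gamma> [\<phi>'] \<psi>' \<in> T"
  using well_defined[unfolded classifying_well_defined_def, THEN conjunct2, THEN conjunct2,
    THEN conjunct2, THEN conjunct1] by fast

lemma fm_eq_subst:
  "\<Gamma>' \<in> contexts Sg \<Longrightarrow> \<Gamma> \<in> contexts Sg \<Longrightarrow>
    (Ns, Ns') \<in> term_eq T \<Gamma>' \<Gamma> \<Longrightarrow> (\<phi>, \<phi>') \<in> fm_eq T \<Gamma> \<Longrightarrow>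
    (fsubst (length \<Gamma>') Ns \<phi>, fsubst (length \<Gamma>') Ns' \<phi>') \<in> fm_eq T \<Gamma>'"
  using well_defined[unfolded classifying_well_defined_def, THEN conjunct2, THEN conjunct2,
    THEN conjunct2, THEN conjunct2, THEN conjunct1] by fast

lemma fm_eq_con:
  "\<Gamma> \<in> contexts Sg \<Longrightarrow> connectives Lg k = Some (length \<phi>s) \<Longrightarrow>
    list_all2 (\<lambda>\<phi> \<phi>'. (\<phi>, \<phi>') \<in> fm_eq T \<Gamma>) \<phi>s \<phi>s' \<Longrightarrow> (Cn k \<phi>s, Cn k \<phi>s') \<in> fm_eq T \<Gamma>"
  using well_defined[unfolded classifying_well_defined_def, THEN conjunct2, THEN conjunct2,
    THEN conjunct2, THEN conjunct2, THEN conjunct2, THEN conjunct1] by blast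

lemma fm_eq_quantify:
  "q \<in> quantifiers Lg \<Longrightarrow> \<Gamma> \<in> contexts Sg \<Longrightarrow> \<Delta> \<in> contexts Sg \<Longrightarrow>
    (\<phi>, \<phi>') \<in> fm_eq T (\<Gamma> @ \<Delta>) \<Longrightarrow> (quantify q \<Delta> \<phi>, quantify q \<Delta> \<phi>') \<in> fm_eq T \<Gamma>"
  using well_defined[unfolded classifying_well_defined_def, THEN conjunct2, THEN conjunct2,
    THEN conjunct2, THEN conjunct2, THEN conjunct2, THEN conjunct2] by fast

lemma fm_eq_formulas:
  assumes "\<Gamma> \<in> contexts Sg" "(\<phi>, \<psi>) \<in> fm_eq T \<Gamma>"
  shows "\<phi> \<in> formulas Lg Sg \<Gamma>"
  using fm_eq_equiv[OF assms(1)] assms(2) unfolding equiv_def by blast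

lemma fm_eq_refl: "\<Gamma> \<in> contexts Sg \<Longrightarrow> \<phi> \<in> formulas Lg Sg \<Gamma> \<Longrightarrow> (\<phi>, \<phi>) \<in> fm_eq T \<Gamma>"
  using fm_eq_equiv unfolding equiv_def refl_on_def by blast

lemma term_eq_refl:
  "\<Gamma>' \<in> contexts Sg \<Longrightarrow> \<Gamma> \<in> contexts Sg \<Longrightarrow> Ns \<in> term_lists Sg \<Gamma>' \<Gamma> \<Longrightarrow> (Ns, Ns) \<in> term_eq T \<Gamma>' \<Gamma>"
  using term_eq_equiv unfolding equiv_def refl_on_def by blast

text \<open>Well-formedness without induction: each list is related to itself, compatibility relates
  the result to itself, and the relation lives on well-formed lists. The next two lemmas treat
  formulas in the same way.\<close>

lemma subst_term_lists:
  assumes "\<Gamma>' \<in> contexts Sg" "\<Gamma> \<in> contexts Sg" "\<Delta> \<in> contexts Sg"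
    and "Ns \<in> term_lists Sg \<Gamma>' \<Gamma>" "Ms \<in> term_lists Sg \<Gamma> \<Delta>"
  shows "map (tsubst Ns) Ms \<in> term_lists Sg \<Gamma>' \<Delta>"
  using term_eq_subst[OF assms(1-3) term_eq_refl[OF assms(1,2,4)] term_eq_refl[OF assms(2,3,5)]]
    term_eq_equiv[OF assms(1,3)] unfolding equiv_def by blast

lemma subst_formulas:
  assumes "\<Gamma>' \<in> contexts Sg" "\<Gamma> \<in> contexts Sg" "Ns \<in> term_lists Sg \<Gamma>' \<Gamma>" "\<phi> \<in> formulas Lg Sg \<Gamma>"
  shows "fsubst (length \<Gamma>') Ns \<phi> \<in> formulas Lg Sg \<Gamma>'"
  by (rule fm_eq_formulas[OF assms(1) fm_eq_subst[OF assms(1,2) term_eq_refl[OF assms(1-3)]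
    fm_eq_refl[OF assms(2,4)]]])

lemma quantify_formulas:
  assumes "q \<in> quantifiers Lg" "\<Gamma> \<in> contexts Sg" "\<Delta> \<in> contexts Sg" "\<phi> \<in> formulas Lg Sg (\<Gamma> @ \<Delta>)"
  shows "quantify q \<Delta> \<phi> \<in> formulas Lg Sg \<Gamma>"
  using fm_eq_formulas[OF assms(2) fm_eq_quantify[OF assms(1-3) fm_eq_refl]] assms(2-4) by simp

section \<open>Operations on classes, computed on arbitrary representatives\<close>

lemma term_lists_rep:
  assumes "\<Gamma>' \<in> contexts Sg" "\<Gamma> \<in> contexts Sg" "Ns \<in> term_lists Sg \<Gamma>' \<Gamma>"
  shows "(Ns, rep (term_eq T \<Gamma>' \<Gamma> `` {Ns})) \<in> term_eq T \<Gamma>' \<Gamma>"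
  by (rule rep_related[OF term_eq_equiv[OF assms(1,2)] assms(3)])

lemma fm_rep:
  assumes "\<Gamma> \<in> contexts Sg" "\<phi> \<in> formulas Lg Sg \<Gamma>"
  shows "(\<phi>, rep (fm_class T \<Gamma> \<phi>)) \<in> fm_eq T \<Gamma>"
  unfolding fm_class_def by (rule rep_related[OF fm_eq_equiv[OF assms(1)] assms(2)])

lemma tm_class_eq:
  assumes "\<Gamma>' \<in> contexts Sg" "\<Gamma> \<in> contexts Sg" "(Ns, Ns') \<in> term_eq T \<Gamma>' \<Gamma>"
  shows "tm_class T \<Gamma>' \<Gamma> Ns = tm_class T \<Gamma>' \<Gamma> Ns'"
  unfolding tm_class_def using equiv_class_eq[OF term_eq_equiv[OF assms(1,2)] assms(3)] by simp

lemma fm_class_eq: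
  assumes "\<Gamma> \<in> contexts Sg" "(\<phi>, \<phi>') \<in> fm_eq T \<Gamma>"
  shows "fm_class T \<Gamma> \<phi> = fm_class T \<Gamma> \<phi>'"
  unfolding fm_class_def using equiv_class_eq[OF fm_eq_equiv[OF assms(1)] assms(2)] .

lemma fm_eq_sym: "(\<phi>, \<phi>') \<in> fm_eq T \<Gamma> \<Longrightarrow> (\<phi>', \<phi>) \<in> fm_eq T \<Gamma>"
  by (auto simp: fm_eq_def)

lemma tm_class_hom:
  "\<Gamma>' \<in> contexts Sg \<Longrightarrow> \<Gamma> \<in> contexts Sg \<Longrightarrow> Ns \<in> term_lists Sg \<Gamma>' \<Gamma> \<Longrightarrow>
    tm_class T \<Gamma>' \<Gamma> Ns \<in> hom CT \<Gamma>' \<Gamma>"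
  by (simp add: hom_def classifying_def tm_class_def quotientI)

lemma hom_classifyingE:
  assumes "f \<in> hom CT \<Gamma>' \<Gamma>"
  obtains Ns where "\<Gamma>' \<in> contexts Sg" "\<Gamma> \<in> contexts Sg" "Ns \<in> term_lists Sg \<Gamma>' \<Gamma>" "f =
    tm_class T \<Gamma>' \<Gamma> Ns"
  using assms by (auto simp: hom_def classifying_def tm_class_def elim: quotientE)

lemma fm_class_pred: "\<phi> \<in> formulas Lg Sg \<Gamma> \<Longrightarrow> fm_class T \<Gamma> \<phi> \<in> Pred CT \<Gamma>"
  by (simp add: fm_class_def quotientI)

lemma pred_classifyingE:
  assumes "X \<in> Pred CT \<Gamma>"
  obtains \<phi> where "\<phi> \<in> formulas Lg Sg \<Gamma>" "X = fm_class T \<Gamma> \<phi>"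
  using assms by (auto simp: fm_class_def elim: quotientE)

text \<open>\<open>Comp\<close> works on representatives chosen by \<open>rep\<close>; these are
  related to the given ones, so well-definedness exchanges them. The same argument serves
  \<open>Act\<close>, \<open>Con\<close>, \<open>Quant\<close> and \<open>Le\<close>.\<close>

lemma comp_tm_class:
  assumes "\<Gamma>' \<in> contexts Sg" "\<Gamma> \<in> contexts Sg" "\<Delta> \<in> contexts Sg"
    and "Ns \<in> term_lists Sg \<Gamma>' \<Gamma>" "Ms \<in> term_lists Sg \<Gamma> \<Delta>"
  shows "tm_class T \<Gamma> \<Delta> Ms \<odot>\<^bsub>CT\<^esub> tm_class T \<Gamma>' \<Gamma> Ns = tm_class T \<Gamma>' \<Delta> (map (tsubst Ns) Ms)"
proof -
  let ?Ns = "rep (term_eq T \<Gamma>' \<Gamma> `` {Ns})" and ?Ms = "rep (term_eq T \<Gamma> \<Delta> `` {Ms})"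
  have "(map (tsubst Ns) Ms, map (tsubst ?Ns) ?Ms) \<in> term_eq T \<Gamma>' \<Delta>"
    using term_eq_subst[OF assms(1-3) term_lists_rep[OF assms(1,2,4)]
      term_lists_rep[OF assms(2,3,5)]] .
  from tm_class_eq[OF assms(1,3) this] show ?thesis
    by (simp add: classifying_def tm_class_def)
qed

lemma act_fm_class:
  assumes "\<Gamma>' \<in> contexts Sg" "\<Gamma> \<in> contexts Sg" "Ns \<in> term_lists Sg \<Gamma>' \<Gamma>" "\<phi> \<in> formulas Lg Sg \<Gamma>"
  shows "Act CT (tm_class T \<Gamma>' \<Gamma> Ns) (fm_class T \<Gamma> \<phi>) = fm_class T \<Gamma>' (fsubst (length \<Gamma>') Ns \<phi>)"
proof -
  let ?Ns = "rep (term_eq T \<Gamma>' \<Gamma> `` {Ns})" and ?\<phi> = "rep (fm_class T \<Gamma> \<phi>)"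
  have "(fsubst (length \<Gamma>') Ns \<phi>, fsubst (length \<Gamma>') ?Ns ?\<phi>) \<in> fm_eq T \<Gamma>'"
    using fm_eq_subst[OF assms(1,2) term_lists_rep[OF assms(1-3)] fm_rep[OF assms(2,4)]] .
  from fm_class_eq[OF assms(1) this] show ?thesis
    by (simp add: classifying_def tm_class_def)
qed

lemma con_fm_class:
  assumes "\<Gamma> \<in> contexts Sg" "connectives Lg k = Some (length \<phi>s)" "set \<phi>s \<subseteq> formulas Lg Sg \<Gamma>"
  shows "Con CT \<Gamma> k (map (fm_class T \<Gamma>) \<phi>s) = fm_class T \<Gamma> (Cn k \<phi>s)"
proof -
  let ?\<phi>s = "map (\<lambda>\<phi>. rep (fm_class T \<Gamma> \<phi>)) \<phi>s"
  have "list_all2 (\<lambda>\<phi> \<phi>'. (\<phi>, \<phi>') \<in> fm_eq T \<Gamma>) \<phi>s ?\<phi>s"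
    using assms(3) fm_rep[OF assms(1)] by (auto simp: list_all2_conv_all_nth subset_iff)
  then have "(Cn k \<phi>s, Cn k ?\<phi>s) \<in> fm_eq T \<Gamma>"
    using fm_eq_con[OF assms(1,2)] by blast
  from fm_class_eq[OF assms(1) this] show ?thesis
    by (simp add: classifying_def o_def)
qed

lemma quant_fm_class:
  assumes "q \<in> quantifiers Lg" "\<Gamma> \<in> contexts Sg" "\<Delta> \<in> contexts Sg" "\<phi> \<in> formulas Lg Sg (\<Gamma> @ \<Delta>)"
  shows "Quant CT q \<Gamma> \<Delta> (fm_class T (\<Gamma> @ \<Delta>) \<phi>) = fm_class T \<Gamma> (quantify q \<Delta> \<phi>)"
proof -
  have "(\<phi>, rep (fm_class T (\<Gamma> @ \<Delta>) \<phi>)) \<in> fm_eq T (\<Gamma> @ \<Delta>)" using fm_rep assms by simp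
  then have "(quantify q \<Delta> \<phi>, quantify q \<Delta> (rep (fm_class T (\<Gamma> @ \<Delta>) \<phi>))) \<in> fm_eq T \<Gamma>"
    by (rule fm_eq_quantify[OF assms(1-3)])
  from fm_class_eq[OF assms(2) this] show ?thesis by (simp add: classifying_def)
qed

lemma le_fm_class:
  assumes "\<Gamma> \<in> contexts Sg" "\<phi> \<in> formulas Lg Sg \<Gamma>" "\<psi> \<in> formulas Lg Sg \<Gamma>"
    and "Le CT \<Gamma> (fm_class T \<Gamma> \<phi>) (fm_class T \<Gamma> \<psi>)"
  shows "Sequent \<Gamma> [\<phi>] \<psi> \<in> T"
proof -
  have "Sequent \<Gamma> [rep (fm_class T \<Gamma> \<phi>)] (rep (fm_class T \<Gamma> \<psi>)) \<in> T"
    using assms(4) by (simp add: classifying_def)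
  moreover have "(rep (fm_class T \<Gamma> \<phi>), \<phi>) \<in> fm_eq T \<Gamma>" "(rep (fm_class T \<Gamma> \<psi>), \<psi>) \<in> fm_eq T \<Gamma>"
    using fm_rep[OF assms(1)] assms(2,3) fm_eq_sym by auto
  ultimately show ?thesis using fm_eq_sequent[OF assms(1)] by blast
qed

text \<open>Read off from \<open>EqP \<Gamma> \<in> Pred (\<Gamma> @ \<Gamma>)\<close>, as related formulas are formulas in context.\<close>

lemma eq_fm_formulas:
  assumes "\<Gamma> \<in> contexts Sg"
  shows "eq_fm Lg \<Gamma> \<in> formulas Lg Sg (\<Gamma> @ \<Gamma>)"
proof -
  have c: "\<Gamma> @ \<Gamma> \<in> contexts Sg" using assms by simp
  have "fm_class T (\<Gamma> @ \<Gamma>) (eq_fm Lg \<Gamma>) \<in> Pred CT (\<Gamma> @ \<Gamma>)" using syn.eq_pred[of \<Gamma>] assms by simp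
  then obtain \<phi> where \<phi>: "\<phi> \<in> formulas Lg Sg (\<Gamma> @ \<Gamma>)" "fm_class T (\<Gamma> @ \<Gamma>) (eq_fm Lg \<Gamma>) =
    fm_class T (\<Gamma> @ \<Gamma>) \<phi>"
    by (elim pred_classifyingE)
  then have "(eq_fm Lg \<Gamma>, \<phi>) \<in> fm_eq T (\<Gamma> @ \<Gamma>)"
    using fm_eq_refl[OF c \<phi>(1)] unfolding fm_class_def by blast
  then show ?thesis by (rule fm_eq_formulas[OF c])
qed

section \<open>A context as the product of its variables\<close>

lemma singleton_contexts: "\<Gamma> \<in> contexts Sg \<Longrightarrow> set (map (\<lambda>\<sigma>. [\<sigma>]) \<Gamma>) \<subseteq> Obj CT"
  by (auto simp: contexts_def)

text \<open>\<open>Times\<close> is concatenation, so bracketing leaves no trace and the product of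
  the one-variable contexts is \<Gamma> itself. This equality of objects makes
  \<open>FObj F \<Gamma>\<close> the source of a comparison arrow, and the generic model interpret
  each context by itself.\<close>

lemma singleton_products:
  assumes "\<Gamma> \<in> contexts Sg"
  shows "list_prod CT (map (\<lambda>\<sigma>. [\<sigma>]) \<Gamma>) = \<Gamma> \<and>
    projs CT (map (\<lambda>\<sigma>. [\<sigma>]) \<Gamma>) = map (\<lambda>i. tm_class T \<Gamma> [\<Gamma> ! i] [V i]) [0..<length \<Gamma>]"
  using assms
proof (induction \<Gamma> rule: rev_induct)
  case Nil
  then show ?case by simp
next
  case (snoc \<sigma> \<Gamma>)
  then have G: "\<Gamma> \<in> contexts Sg" "\<sigma> \<in> sorts Sg" by auto
  show ?case
  proof (cases "\<Gamma> = []")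
    case True
    then show ?thesis by simp
  next
    case False
    then have F: "map (\<lambda>\<sigma>. [\<sigma>]) \<Gamma> \<noteq> []" by simp
    have "tm_class T \<Gamma> [\<Gamma> ! i] [V i] \<odot>\<^bsub>CT\<^esub> Pr1 CT \<Gamma> [\<sigma>] = tm_class T (\<Gamma> @ [\<sigma>]) [\<Gamma> ! i] [V i]"
      if "i < length \<Gamma>" for i
    proof -
      have "\<Gamma> ! i \<in> sorts Sg" using G(1) that by (auto simp: contexts_def)
      then show ?thesis
        using comp_tm_class[OF _ G(1) _ var_term_lists(2), of "[\<sigma>]" "[\<Gamma> ! i]" "[V i]"] G that
        by (simp add: term_lists_def)
    qed
    then show ?thesis
      using snoc.IH[OF G(1)]
      by (simp add: syn.list_prod_snoc[OF F] syn.projs_snoc[OF F] nth_append)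
  qed
qed

end


section \<open>The morphism induced by a model\<close>

locale theory_model =
  classifying_theory Lg Sg T + fa_structure Lg C Sg S
  for Lg :: "('q, 'k) lang" and C :: "('o, 'm, 'p, 'q, 'k) propcat" (structure)
    and Sg :: "('s, 'f, 'r) sig" and S :: "('s, 'f, 'r, 'o, 'm, 'p) str"
    and T :: "('s, 'f, 'r, 'q, 'k) thy" +
  assumes models: "\<And>a. a \<in> T \<Longrightarrow> satisfies Lg C S a"
begin

text \<open>Values on classes are read off at chosen representatives. \<open>induced_arr\<close> and
  \<open>induced_pred\<close> show that any other representative gives the same value, and serve as
  the working equations.\<close>

definition induced :: "('s list, ('s, 'f) syn_arr,
  ('s, 'f, 'r, 'q, 'k) fm set, 'o, 'm, 'p) mor" where
  "induced = \<lparr> FObj = ctx, FArr = (\<lambda>(\<Gamma>', \<Gamma>, X). tmsI \<Gamma>' (rep X)), FPred =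
    (\<lambda>\<Gamma> X. fmI C S \<Gamma> (rep X)) \<rparr>"

lemma induced_obj [simp]: "FObj induced = ctx"
  by (simp add: induced_def)

lemma induced_arr:
  assumes "\<Gamma>' \<in> contexts Sg" "\<Gamma> \<in> contexts Sg" "Ns \<in> term_lists Sg \<Gamma>' \<Gamma>"
  shows "FArr induced (tm_class T \<Gamma>' \<Gamma> Ns) = tmsI \<Gamma>' Ns"
proof -
  let ?Ns = "rep (term_eq T \<Gamma>' \<Gamma> `` {Ns})"
  have r: "length Ns = length ?Ns" "i < length Ns \<Longrightarrow> Equation \<Gamma>' (Ns ! i) (?Ns ! i)
    (\<Gamma> ! i) \<in> T" for i
    using term_lists_rep[OF assms] by (auto simp: term_eq_def)
  have "map (tmI C S \<Gamma>') Ns = map (tmI C S \<Gamma>') ?Ns"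
    using r(1) models[OF r(2)] by (intro nth_equalityI) auto
  then show ?thesis by (simp add: induced_def tm_class_def tmsI_def)
qed

text \<open>Related formulas are mutually derivable, so a model gives inequalities in both
  directions and antisymmetry makes them an equality. Antisymmetry holds on the carrier
  \<open>Pred\<close> only, hence the check that the chosen representative is a formula in
  context.\<close>

lemma induced_pred:
  assumes "\<Gamma> \<in> contexts Sg" "\<phi> \<in> formulas Lg Sg \<Gamma>"
  shows "FPred induced \<Gamma> (fm_class T \<Gamma> \<phi>) = fmI C S \<Gamma> \<phi>"
proof -
  let ?\<psi> = "rep (fm_class T \<Gamma> \<phi>)"
  have r: "(\<phi>, ?\<psi>) \<in> fm_eq T \<Gamma>" by (rule fm_rep[OF assms])
  then have "?\<psi> \<in> formulas Lg Sg \<Gamma>" using fm_eq_formulas[OF assms(1) fm_eq_sym] by blast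
  then have "fmI C S \<Gamma> ?\<psi> \<in> Pred C (ctx \<Gamma>)" "fmI C S \<Gamma> \<phi> \<in> Pred C (ctx \<Gamma>)"
    using assms fmI_pred by (auto simp: formulas_def)
  moreover have "Le C (ctx \<Gamma>) (fmI C S \<Gamma> ?\<psi>) (fmI C S \<Gamma> \<phi>)" "Le C (ctx \<Gamma>) (fmI C S \<Gamma> \<phi>)
    (fmI C S \<Gamma> ?\<psi>)"
    using r models by (force simp: fm_eq_def)+
  ultimately show ?thesis using le_antisym[OF ctx_obj[OF assms(1)]] by (simp add: induced_def)
qed

lemma induced_functor: "is_functor CT C induced"
proof -
  have "FArr induced f \<in> hom C (ctx \<Gamma>') (ctx \<Gamma>)" if "f \<in> hom CT \<Gamma>' \<Gamma>" for f \<Gamma>' \<Gamma>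
    using that by (elim hom_classifyingE) (simp add: induced_arr tmsI_hom)
  moreover have "FArr induced (g \<odot>\<^bsub>CT\<^esub> f) = FArr induced g \<odot> FArr induced f"
    if f: "f \<in> hom CT \<Gamma>' \<Gamma>" and g: "g \<in> hom CT \<Gamma> \<Delta>" for f g \<Gamma>' \<Gamma> \<Delta>
  proof -
    obtain Ns where N: "\<Gamma>' \<in> contexts Sg" "\<Gamma> \<in> contexts Sg" "Ns \<in> term_lists Sg \<Gamma>' \<Gamma>" "f =
      tm_class T \<Gamma>' \<Gamma> Ns"
      using f by (elim hom_classifyingE)
    obtain Ms where M: "\<Delta> \<in> contexts Sg" "Ms \<in> term_lists Sg \<Gamma> \<Delta>" "g = tm_class T \<Gamma> \<Delta> Ms"
      using g by (elim hom_classifyingE)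
    show ?thesis
      unfolding N(4) M(3) comp_tm_class[OF N(1,2) M(1) N(3) M(2)]
      using induced_arr[OF N(1) M(1) subst_term_lists[OF N(1,2) M(1) N(3) M(2)]]
        induced_arr[OF N(1-3)] induced_arr[OF N(2) M(1,2)] tmsI_comp[OF N(2,1,3) M(2)] by simp
  qed
  ultimately show ?thesis
    unfolding is_functor_def by (auto simp: ctx_obj induced_arr var_term_lists tmsI_vars)
qed

section \<open>The clauses of a morphism in FA\<close>

lemma induced_pr:
  assumes "\<Gamma> \<in> contexts Sg" "\<Delta> \<in> contexts Sg"
  shows "FArr induced (Pr1 CT \<Gamma> \<Delta>) = tmsI (\<Gamma> @ \<Delta>) (map V [0..<length \<Gamma>])"
    and "FArr induced (Pr2 CT \<Gamma> \<Delta>) = tmsI (\<Gamma> @ \<Delta>) (map V [length \<Gamma>..<length \<Gamma> + length \<Delta>])"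
  using assms by (simp_all add: induced_arr var_term_lists)

text \<open>\<open>ctx (\<Gamma> @ \<Delta>)\<close> is bracketed to the left and in general differs
  from \<open>Times C (ctx \<Gamma>) (ctx \<Delta>)\<close>; what is verified is the universal
  property, by regrouping the flat product.\<close>

lemma induced_products: "preserves_products CT C induced"
proof -
  have "is_product C (ctx \<Gamma>) (ctx \<Delta>) (ctx (\<Gamma> @ \<Delta>)) (FArr induced (Pr1 CT \<Gamma> \<Delta>)) (FArr induced
    (Pr2 CT \<Gamma> \<Delta>))"
    if "\<Gamma> \<in> contexts Sg" "\<Delta> \<in> contexts Sg" for \<Gamma> \<Delta>
  proof -
    have c: "\<Gamma> @ \<Delta> \<in> contexts Sg" using that by simp
    show ?thesis
      unfolding induced_pr[OF that]
    proof (rule product_of_list_products[OF ctx_product[OF that(1)] ctx_product[OF that(2)]])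
      show "is_list_product C (sortsI \<Gamma> @ sortsI \<Delta>) (ctx (\<Gamma> @ \<Delta>))
          (map (\<lambda>r. r \<odot> tmsI (\<Gamma> @ \<Delta>) (map V [0..<length \<Gamma>])) (projs C (sortsI \<Gamma>)) @
           map (\<lambda>r. r \<odot> tmsI (\<Gamma> @ \<Delta>) (map V [length \<Gamma>..<length \<Gamma> + length \<Delta>])) (projs C
             (sortsI \<Delta>)))"
        using ctx_product[OF c] unfolding projs_append[OF that] by simp
    qed (rule tmsI_hom[OF c var_term_lists(2)] tmsI_hom[OF c var_term_lists(3)])+
  qed
  moreover have "ctx [] = One C" by (simp add: ctxI_def)
  ultimately show ?thesis
    unfolding preserves_products_def using one_terminal by (simp del: classifying_simps(5,6))
qed

text \<open>The inverse of \<open>prod_map\<close> need not be computed: \<open>fmI_quantify\<close>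
  accepts any arrow with the canonical components, and those of the inverse follow by cancelling
  \<open>prod_map\<close>.\<close>

lemma induced_quant:
  assumes q: "q \<in> quantifiers Lg" and G: "\<Gamma> \<in> contexts Sg" and D: "\<Delta> \<in> contexts Sg"
    and \<phi>: "\<phi> \<in> formulas Lg Sg (\<Gamma> @ \<Delta>)"
  shows "fmI C S \<Gamma> (quantify q \<Delta> \<phi>) =
    Quant C q (ctx \<Gamma>) (ctx \<Delta>) (Act C (inv_arr C (prod_map CT C induced \<Gamma> \<Delta>)) (fmI C S (\<Gamma> @ \<Delta>) \<phi>))"
proof -
  let ?m = "prod_map CT C induced \<Gamma> \<Delta>"
  let ?p = "tmsI (\<Gamma> @ \<Delta>) (map V [0..<length \<Gamma>])"
    and ?q = "tmsI (\<Gamma> @ \<Delta>) (map V [length \<Gamma>..<length \<Gamma> + length \<Delta>])"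
  have c: "\<Gamma> @ \<Delta> \<in> contexts Sg" using G D by simp
  have G': "\<Gamma> \<in> Obj CT" "\<Delta> \<in> Obj CT" using G D by auto
  note pm = syn.prod_map[OF cartesian_category_axioms induced_functor induced_products G',
      unfolded induced_pr[OF G D] induced_obj classifying_simps(3)]
  note i = inv_arr[OF pm(4) pm(1)]
  note h = tmsI_hom[OF c var_term_lists(2)] tmsI_hom[OF c var_term_lists(3)]
  note pr = pr1_hom[OF ctx_obj[OF G] ctx_obj[OF D]] pr2_hom[OF ctx_obj[OF G] ctx_obj[OF D]]
  have "?p \<odot> inv_arr C ?m = Pr1 C (ctx \<Gamma>) (ctx \<Delta>)" "?q \<odot> inv_arr C ?m = Pr2 C (ctx \<Gamma>) (ctx \<Delta>)"
    using comp_assoc[OF pr(1) pm(1) i(1)] comp_assoc[OF pr(2) pm(1) i(1)] pm(2,3) i(3)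
      comp_ident[OF pr(1)] comp_ident[OF pr(2)] by simp_all
  then have "map (\<lambda>p. p \<odot> inv_arr C ?m) (projs C (sortsI (\<Gamma> @ \<Delta>))) =
      map (\<lambda>p. p \<odot> Pr1 C (ctx \<Gamma>) (ctx \<Delta>)) (projs C (sortsI \<Gamma>)) @
      map (\<lambda>p. p \<odot> Pr2 C (ctx \<Gamma>) (ctx \<Delta>)) (projs C (sortsI \<Delta>))"
    unfolding projs_append[OF G D, symmetric] unfolding map_append
    using cone_comp_comp[OF ctx_projs[OF G] h(1) i(1)] cone_comp_comp[OF ctx_projs[OF D] h(2) i(1)]
    by (simp del: map_eq_conv)
  from fmI_quantify[OF q G D _ i(1) this] \<phi> show ?thesis by (simp add: formulas_def)
qed

lemma induced_mor: "FA_mor Lg CT C induced"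
  unfolding FA_mor_def
proof (intro conjI ballI allI impI induced_functor induced_products)
  fix \<Gamma> X assume G: "\<Gamma> \<in> Obj CT" and X: "X \<in> Pred CT \<Gamma>"
  obtain \<phi> where p: "\<phi> \<in> formulas Lg Sg \<Gamma>" "X = fm_class T \<Gamma> \<phi>" using X by (elim pred_classifyingE)
  show "FPred induced \<Gamma> X \<in> Pred C (FObj induced \<Gamma>)"
    using p G induced_pred fmI_pred by (simp add: formulas_def)
  fix Y assume Y: "Y \<in> Pred CT \<Gamma>" and le: "Le CT \<Gamma> X Y"
  obtain \<psi> where q: "\<psi> \<in> formulas Lg Sg \<Gamma>" "Y = fm_class T \<Gamma> \<psi>" using Y by (elim pred_classifyingE)
  have "Sequent \<Gamma> [\<phi>] \<psi> \<in> T" using le_fm_class p q le G by simp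
  from models[OF this] show "Le C (FObj induced \<Gamma>) (FPred induced \<Gamma> X) (FPred induced \<Gamma> Y)"
    using p q G by (simp add: induced_pred)
next
  fix \<Gamma>' \<Gamma> f X assume f: "f \<in> hom CT \<Gamma>' \<Gamma>" and X: "X \<in> Pred CT \<Gamma>"
  obtain \<phi> where p: "\<phi> \<in> formulas Lg Sg \<Gamma>" "X = fm_class T \<Gamma> \<phi>" using X by (elim pred_classifyingE)
  obtain Ns where N: "\<Gamma>' \<in> contexts Sg" "\<Gamma> \<in> contexts Sg" "Ns \<in> term_lists Sg \<Gamma>' \<Gamma>" "f =
    tm_class T \<Gamma>' \<Gamma> Ns"
    using f by (elim hom_classifyingE)
  show "FPred induced \<Gamma>' (Act CT f X) = Act C (FArr induced f) (FPred induced \<Gamma> X)"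
    unfolding p N act_fm_class[OF N(1-3) p(1)] induced_arr[OF N(1-3)] induced_pred[OF N(2) p(1)]
      induced_pred[OF N(1) subst_formulas[OF N(1-3) p(1)]]
    using fmI_subst[OF N(2,1,3)] p(1) by (simp add: formulas_def)
next
  fix \<Gamma> k Xs assume G: "\<Gamma> \<in> Obj CT" and k: "connectives Lg k =
    Some (length Xs)" and Xs: "set Xs \<subseteq> Pred CT \<Gamma>"
  \<comment> \<open>Representatives are picked one at a time, so that a list of predicates becomes
    the list of classes of one list of formulas.\<close>
  have "\<exists>\<phi>s. set \<phi>s \<subseteq> formulas Lg Sg \<Gamma> \<and> Xs = map (fm_class T \<Gamma>) \<phi>s"
    using Xs
  proof (induction Xs)
    case (Cons X Xs)
    then obtain \<phi>s where 1: "set \<phi>s \<subseteq> formulas Lg Sg \<Gamma>" "Xs = map (fm_class T \<Gamma>) \<phi>s" by auto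
    obtain \<phi> where 2: "\<phi> \<in> formulas Lg Sg \<Gamma>" "X = fm_class T \<Gamma> \<phi>"
      using Cons.prems pred_classifyingE[of X \<Gamma>] by auto
    show ?case by (rule exI[of _ "\<phi> # \<phi>s"]) (simp add: 1 2)
  qed simp
  then obtain \<phi>s where p: "set \<phi>s \<subseteq> formulas Lg Sg \<Gamma>" "Xs = map (fm_class T \<Gamma>) \<phi>s" by blast
  have k': "connectives Lg k = Some (length \<phi>s)" using k p by simp
  have "Cn k \<phi>s \<in> formulas Lg Sg \<Gamma>" using p k' by (auto simp: formulas_def)
  moreover have "map (FPred induced \<Gamma>) Xs = map (fmI C S \<Gamma>) \<phi>s"
    using p G induced_pred by auto
  ultimately show "FPred induced \<Gamma> (Con CT \<Gamma> k Xs) =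
    Con C (FObj induced \<Gamma>) k (map (FPred induced \<Gamma>) Xs)"
    using con_fm_class[OF _ k' p(1)] G p(2) by (simp add: induced_pred del: map_map)
next
  fix q \<Gamma> \<Delta> X assume q: "q \<in> quantifiers Lg" and "\<Gamma> \<in> Obj CT" "\<Delta> \<in> Obj CT"
    and "X \<in> Pred CT (Times CT \<Gamma> \<Delta>)"
  then have G: "\<Gamma> \<in> contexts Sg" "\<Delta> \<in> contexts Sg" "\<Gamma> @ \<Delta> \<in> contexts Sg"
    and X: "X \<in> Pred CT (\<Gamma> @ \<Delta>)" by auto
  obtain \<phi> where p: "\<phi> \<in> formulas Lg Sg (\<Gamma> @ \<Delta>)" "X = fm_class T (\<Gamma> @ \<Delta>) \<phi>" using X
    by (elim pred_classifyingE)
  show "FPred induced \<Gamma> (Quant CT q \<Gamma> \<Delta> X) =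
      Quant C q (FObj induced \<Gamma>) (FObj induced \<Delta>)
        (Act C (inv_arr C (prod_map CT C induced \<Gamma> \<Delta>)) (FPred induced (Times CT \<Gamma> \<Delta>) X))"
    unfolding p(2) quant_fm_class[OF q G(1,2) p(1)] induced_obj classifying_simps(3)
      induced_pred[OF G(1) quantify_formulas[OF q G(1,2) p(1)]] induced_pred[OF G(3) p(1)]
    by (rule induced_quant[OF q G(1,2) p(1)])
next
  fix \<Gamma> assume "\<Gamma> \<in> Obj CT"
  then have G: "\<Gamma> \<in> contexts Sg" "\<Gamma> @ \<Gamma> \<in> contexts Sg" by auto
  \<comment> \<open>Unfolded, \<open>prod_map\<close> is the pair of the images of the two
    projections, which is the arrow in \<open>fmI_eq_fm\<close>.\<close>
  show "FPred induced (Times CT \<Gamma> \<Gamma>) (EqP CT \<Gamma>) =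
    Act C (prod_map CT C induced \<Gamma> \<Gamma>) (EqP C (FObj induced \<Gamma>))"
    unfolding prod_map_def induced_pr[OF G(1,1)] induced_obj classifying_simps(3,8)
      induced_pred[OF G(2) eq_fm_formulas[OF G(1)]]
    by (rule fmI_eq_fm[OF G(1)])
qed

section \<open>The image of the generic model\<close>

lemma ctx_generic: "\<Gamma> \<in> contexts Sg \<Longrightarrow> ctxI CT (generic Sg T) \<Gamma> = \<Gamma>"
  using singleton_products by (simp add: ctxI_def generic_def)

text \<open>The comparison arrow tuples the interpretations of all variables, that is, all
  projections. Hence the inverses in \<open>image_str\<close> become identities, and the image of
  the generic model equals \<open>S\<close> strictly rather than up to isomorphism.\<close>

lemma list_prod_map_induced:
  assumes "\<Gamma> \<in> contexts Sg"
  shows "list_prod_map CT C induced (map (\<lambda>\<sigma>. [\<sigma>]) \<Gamma>) = Ident C (ctx \<Gamma>)"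
proof -
  have "FArr induced (tm_class T \<Gamma> [\<Gamma> ! i] [V i]) = tmI C S \<Gamma> (V i)" if "i < length \<Gamma>" for i
  proof -
    have "\<Gamma> ! i \<in> sorts Sg" using assms that by (auto simp: contexts_def)
    then show ?thesis using assms that by (simp add: induced_arr term_lists_def tmsI_def)
  qed
  then have "list_prod_map CT C induced (map (\<lambda>\<sigma>. [\<sigma>]) \<Gamma>) = tmsI \<Gamma> (map V [0..<length \<Gamma>])"
    using singleton_products[OF assms]
    by (auto simp: list_prod_map_def tmsI_def intro!: arg_cong[of _ _ "tuple C (ctx \<Gamma>)"])
  then show ?thesis using tmsI_vars[OF assms] by simp
qed

lemma symbol_formulas:
  assumes "rels Sg R = Some \<sigma>s"
  shows "\<sigma>s \<in> contexts Sg" "Rl R (map V [0..<length \<sigma>s]) \<in> formulas Lg Sg \<sigma>s"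
  using assms signature var_term_lists(1)[of \<sigma>s Sg]
  by (auto simp: wf_sig_def contexts_def formulas_def term_lists_def)

lemma symbol_terms:
  assumes "funs Sg f = Some (\<sigma>s, \<tau>)"
  shows "\<sigma>s \<in> contexts Sg" "[\<tau>] \<in> contexts Sg" "[Fn f (map V [0..<length \<sigma>s])]
    \<in> term_lists Sg \<sigma>s [\<tau>]"
  using assms signature var_term_lists(1)[of \<sigma>s Sg]
  by (auto simp: wf_sig_def contexts_def term_lists_def)

lemma image_generic_induced: "str_eq Sg (image_str Sg CT C induced (generic Sg T)) S"
  unfolding str_eq_def
proof (intro conjI ballI)
  fix \<sigma> assume "\<sigma> \<in> sorts Sg"
  then show "SortI (image_str Sg CT C induced (generic Sg T)) \<sigma> = SortI S \<sigma>"
    by (simp add: image_str_def generic_def ctxI_def)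
next
  fix f assume "f \<in> dom (funs Sg)"
  then obtain \<sigma>s \<tau> where f: "funs Sg f = Some (\<sigma>s, \<tau>)" by auto
  note c = symbol_terms[OF f]
  have "FunI S f \<in> hom C (ctx \<sigma>s) (SortI S \<tau>)" using str f by (simp add: is_structure_def)
  then have "FArr induced (tm_class T \<sigma>s [\<tau>] [Fn f (map V [0..<length \<sigma>s])]) = FunI S f"
    "FunI S f \<odot> Ident C (ctx \<sigma>s) = FunI S f"
    using tmsI_vars[OF c(1)] comp_ident by (simp_all add: induced_arr[OF c] tmsI_def)
  then show "FunI (image_str Sg CT C induced (generic Sg T)) f = FunI S f"
    using f list_prod_map_induced[OF c(1)] inv_arr_ident[OF ctx_obj[OF c(1)]]
    by (simp add: image_str_def generic_def)
next
  fix R assume "R \<in> dom (rels Sg)"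
  then obtain \<sigma>s where R: "rels Sg R = Some \<sigma>s" by auto
  note c = symbol_formulas[OF R]
  have "RelI S R \<in> Pred C (ctx \<sigma>s)" using str R by (simp add: is_structure_def)
  then have "FPred induced \<sigma>s (fm_class T \<sigma>s (Rl R (map V [0..<length \<sigma>s]))) = RelI S R"
    "Act C (Ident C (ctx \<sigma>s)) (RelI S R) = RelI S R"
    using tmsI_vars[OF c(1)] act_ident ctx_obj[OF c(1)]
      by (simp_all add: induced_pred[OF c] tmsI_def)
  then show "RelI (image_str Sg CT C induced (generic Sg T)) R = RelI S R"
    using R list_prod_map_induced[OF c(1)] inv_arr_ident[OF ctx_obj[OF c(1)]] ctx_generic[OF c(1)]
    by (simp add: image_str_def generic_def)
qed

end


section \<open>Uniqueness\<close>

locale generic_extension = theory_model Lg C Sg S T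
  for Lg :: "('q, 'k) lang" and C :: "('o, 'm, 'p, 'q, 'k) propcat" (structure)
    and Sg :: "('s, 'f, 'r) sig" and S :: "('s, 'f, 'r, 'o, 'm, 'p) str"
    and T :: "('s, 'f, 'r, 'q, 'k) thy" +
  fixes F :: "('s list, ('s, 'f) syn_arr, ('s, 'f, 'r, 'q, 'k) fm set, 'o, 'm, 'p) mor"
  assumes mor: "FA_mor Lg CT C F"
    and image: "str_eq Sg (image_str Sg CT C F (generic Sg T)) S"
begin

text \<open>The source is \<open>FObj F \<Gamma>\<close> by \<open>singleton_products\<close>; the
  target is \<open>ctx \<Gamma>\<close> because equality of structures equates the objects
  \<open>FObj F [\<sigma>]\<close> and \<open>SortI S \<sigma>\<close>.\<close>

definition compare :: "'s list \<Rightarrow> 'm" where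
  "compare \<Gamma> = list_prod_map CT C F (map (\<lambda>\<sigma>. [\<sigma>]) \<Gamma>)"

lemma F_functor: "is_functor CT C F" and F_products: "preserves_products CT C F"
  using mor unfolding FA_mor_def by blast+

lemma F_obj: "\<Gamma> \<in> contexts Sg \<Longrightarrow> FObj F \<Gamma> \<in> Obj C"
  using F_functor by (simp add: is_functor_def)

lemma F_hom:
  "\<Gamma>' \<in> contexts Sg \<Longrightarrow> \<Gamma> \<in> contexts Sg \<Longrightarrow> Ns \<in> term_lists Sg \<Gamma>' \<Gamma> \<Longrightarrow>
    FArr F (tm_class T \<Gamma>' \<Gamma> Ns) \<in> hom C (FObj F \<Gamma>') (FObj F \<Gamma>)"
  using F_functor tm_class_hom unfolding is_functor_def by blast

lemma F_comp:
  assumes "\<Gamma>' \<in> contexts Sg" "\<Gamma> \<in> contexts Sg" "\<Delta> \<in> contexts Sg"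
    and "Ns \<in> term_lists Sg \<Gamma>' \<Gamma>" "Ms \<in> term_lists Sg \<Gamma> \<Delta>"
  shows "FArr F (tm_class T \<Gamma>' \<Delta> (map (tsubst Ns) Ms)) =
    FArr F (tm_class T \<Gamma> \<Delta> Ms) \<odot> FArr F (tm_class T \<Gamma>' \<Gamma> Ns)"
  unfolding comp_tm_class[OF assms, symmetric]
  using F_functor tm_class_hom[OF assms(1,2,4)] tm_class_hom[OF assms(2,3,5)]
    unfolding is_functor_def by blast

lemma F_act:
  assumes "\<Gamma>' \<in> contexts Sg" "\<Gamma> \<in> contexts Sg" "Ns \<in> term_lists Sg \<Gamma>' \<Gamma>" "\<phi> \<in> formulas Lg Sg \<Gamma>"
  shows "FPred F \<Gamma>' (fm_class T \<Gamma>' (fsubst (length \<Gamma>') Ns \<phi>)) =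
    Act C (FArr F (tm_class T \<Gamma>' \<Gamma> Ns)) (FPred F \<Gamma> (fm_class T \<Gamma> \<phi>))"
  unfolding act_fm_class[OF assms, symmetric]
  using mor tm_class_hom[OF assms(1-3)] fm_class_pred[OF assms(4)] unfolding FA_mor_def by blast

lemma F_sort: "\<sigma> \<in> sorts Sg \<Longrightarrow> FObj F [\<sigma>] = SortI S \<sigma>"
  using image by (simp add: str_eq_def image_str_def generic_def)

lemma F_sorts: "\<Gamma> \<in> contexts Sg \<Longrightarrow> map (FObj F) (map (\<lambda>\<sigma>. [\<sigma>]) \<Gamma>) = sortsI \<Gamma>"
  using F_sort by (auto simp: contexts_def)

lemma compare_char:
  assumes "\<Gamma> \<in> contexts Sg"
  shows compare_hom: "compare \<Gamma> \<in> hom C (FObj F \<Gamma>) (ctx \<Gamma>)"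
    and projs_compare: "map (\<lambda>p. p \<odot> compare \<Gamma>) (projs C (sortsI \<Gamma>)) =
      map (\<lambda>i. FArr F (tm_class T \<Gamma> [\<Gamma> ! i] [V i])) [0..<length \<Gamma>]"
    and compare_iso: "is_iso C (compare \<Gamma>)"
  using syn.list_prod_map[OF cartesian_category_axioms F_functor F_products singleton_contexts[OF
    assms]]
  unfolding F_sorts[OF assms] conjunct1[OF singleton_products[OF assms]]
    conjunct2[OF singleton_products[OF assms]]
  by (simp_all add: compare_def ctxI_def o_def)

lemma var_in: "\<Gamma> \<in> contexts Sg \<Longrightarrow> i < length \<Gamma> \<Longrightarrow> [V i] \<in> term_lists Sg \<Gamma> [\<Gamma> ! i] \<and> [\<Gamma> ! i]
  \<in> contexts Sg"
  by (auto simp: term_lists_def contexts_def)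

text \<open>Before naturality is available, a composite with \<open>compare \<Gamma>\<close> is
  known through its components, which by functoriality are the images of the single terms.\<close>

lemma projs_compare_arr:
  assumes "\<Gamma>' \<in> contexts Sg" "\<Gamma> \<in> contexts Sg" "Ns \<in> term_lists Sg \<Gamma>' \<Gamma>"
  shows "map (\<lambda>p. p \<odot> (compare \<Gamma> \<odot> FArr F (tm_class T \<Gamma>' \<Gamma> Ns))) (projs C (sortsI \<Gamma>)) =
    map (\<lambda>i. FArr F (tm_class T \<Gamma>' [\<Gamma> ! i] [Ns ! i])) [0..<length \<Gamma>]"
proof -
  have "FArr F (tm_class T \<Gamma> [\<Gamma> ! i] [V i]) \<odot> FArr F (tm_class T \<Gamma>' \<Gamma> Ns) =
    FArr F (tm_class T \<Gamma>' [\<Gamma> ! i] [Ns ! i])"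
    if "i < length \<Gamma>" for i
    using F_comp[OF assms(1,2) _ assms(3), of "[\<Gamma> ! i]" "[V i]"] var_in[OF assms(2) that] by simp
  then have "map (\<lambda>p. p \<odot> FArr F (tm_class T \<Gamma>' \<Gamma> Ns)) (map (\<lambda>i. FArr F (tm_class T \<Gamma> [\<Gamma> ! i]
    [V i])) [0..<length \<Gamma>]) =
      map (\<lambda>i. FArr F (tm_class T \<Gamma>' [\<Gamma> ! i] [Ns ! i])) [0..<length \<Gamma>]"
    by simp
  then show ?thesis
    by (rule trans[OF cone_comp_comp[OF ctx_projs[OF assms(2)] compare_hom[OF assms(2)]
      F_hom[OF assms],
            unfolded projs_compare[OF assms(2)], symmetric]])
qed

text \<open>The hypothesis on the image of the generic model, solved for \<open>F\<close>:
  \<open>image_str\<close> contains the inverse of \<open>compare \<sigma>s\<close>, and composing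
  with \<open>compare \<sigma>s\<close> removes it. \<open>F_rel\<close> is the analogue for
  predicates.\<close>

lemma F_fun:
  assumes "funs Sg f = Some (\<sigma>s, \<tau>)"
  shows "FArr F (tm_class T \<sigma>s [\<tau>] [Fn f (map V [0..<length \<sigma>s])]) = FunI S f \<odot> compare \<sigma>s"
proof -
  note c = symbol_terms[OF assms]
  note i = inv_arr[OF compare_iso[OF c(1)] compare_hom[OF c(1)]]
  note h = F_hom[OF c]
  have "FunI (image_str Sg CT C F (generic Sg T)) f = FunI S f"
    using image assms by (auto simp: str_eq_def)
  then have "FunI S f = FArr F (tm_class T \<sigma>s [\<tau>] [Fn f (map V [0..<length \<sigma>s])]) \<odot> inv_arr C
    (compare \<sigma>s)"
    using assms by (simp add: image_str_def generic_def compare_def)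
  then show ?thesis
    using comp_assoc[OF h i(1) compare_hom[OF c(1)]] i(2) comp_ident[OF h] by simp
qed

lemma F_rel:
  assumes "rels Sg R = Some \<sigma>s"
  shows "FPred F \<sigma>s (fm_class T \<sigma>s (Rl R (map V [0..<length \<sigma>s]))) = Act C (compare \<sigma>s) (RelI S R)"
proof -
  note c = symbol_formulas[OF assms]
  note i = inv_arr[OF compare_iso[OF c(1)] compare_hom[OF c(1)]]
  let ?x = "FPred F \<sigma>s (fm_class T \<sigma>s (Rl R (map V [0..<length \<sigma>s])))"
  have x: "?x \<in> Pred C (FObj F \<sigma>s)"
    using mor c(1) fm_class_pred[OF c(2)] unfolding FA_mor_def by auto
  have "RelI S R = Act C (inv_arr C (compare \<sigma>s)) ?x"
    using image assms ctx_generic[OF c(1)]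
    by (auto simp: str_eq_def image_str_def generic_def compare_def dom_def)
  then show ?thesis
    using act_comp[OF i(1) compare_hom[OF c(1)] x] i(2) act_ident[OF F_obj[OF c(1)] x] by simp
qed

text \<open>Passage from single terms to lists. The claim for single terms is an assumption, so that
  the lemma can be used inside the induction of \<open>F_tm\<close>, where it is the induction
  hypothesis, and again for \<open>compare_natural\<close>.\<close>

lemma F_tms:
  assumes "\<Gamma>' \<in> contexts Sg" "\<Gamma> \<in> contexts Sg" "Ns \<in> term_lists Sg \<Gamma>' \<Gamma>"
    and "\<And>i. i < length \<Gamma> \<Longrightarrow> FArr F (tm_class T \<Gamma>' [\<Gamma> ! i] [Ns ! i]) =
      tmI C S \<Gamma>' (Ns ! i) \<odot> compare \<Gamma>'"
  shows "compare \<Gamma> \<odot> FArr F (tm_class T \<Gamma>' \<Gamma> Ns) =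
    tuple C (FObj F \<Gamma>') (map (\<lambda>N. tmI C S \<Gamma>' N \<odot> compare \<Gamma>') Ns)"
proof (rule sym, rule tuple_eqI[OF sortsI_objs[OF assms(2)]])
  show "compare \<Gamma> \<odot> FArr F (tm_class T \<Gamma>' \<Gamma> Ns) \<in> hom C (FObj F \<Gamma>') (list_prod C (sortsI \<Gamma>))"
    using comp_hom[OF compare_hom[OF assms(2)] F_hom[OF assms(1-3)]] by (simp add: ctxI_def)
  show "map (\<lambda>p. p \<odot> (compare \<Gamma> \<odot> FArr F (tm_class T \<Gamma>' \<Gamma> Ns))) (projs C (sortsI \<Gamma>)) =
      map (\<lambda>N. tmI C S \<Gamma>' N \<odot> compare \<Gamma>') Ns"
    unfolding projs_compare_arr[OF assms(1-3)]
    using assms(3,4) by (auto intro!: nth_equalityI simp: term_lists_def list_all2_conv_all_nth)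
qed

lemma F_tm:
  assumes "\<Gamma> \<in> contexts Sg" "tm_in Sg \<Gamma> M \<tau>"
  shows "FArr F (tm_class T \<Gamma> [\<tau>] [M]) = tmI C S \<Gamma> M \<odot> compare \<Gamma>"
  using assms(2)
proof (induction rule: tm_in.induct)
  case (tm_in_V i)
  then show ?case
    using arg_cong[OF projs_compare[OF assms(1)], of "\<lambda>l. l ! i"]
      cone_length[OF ctx_projs[OF assms(1)]] by simp
next
  case (tm_in_Fn f \<sigma>s \<tau> Ms)
  note c = symbol_terms[OF tm_in_Fn(1)]
  have Ms: "list_all2 (tm_in Sg \<Gamma>) Ms \<sigma>s" using tm_in_Fn(2) by (auto elim: list_all2_mono)
  then have Ms': "Ms \<in> term_lists Sg \<Gamma> \<sigma>s" by (simp add: term_lists_def)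
  \<comment> \<open>A compound term is the substitution of its arguments into the generic term of
    its function symbol, so functoriality reduces it to \<open>F_fun\<close>.\<close>
  have "map (tsubst Ms) (map V [0..<length \<sigma>s]) = Ms"
    using Ms by (auto intro!: nth_equalityI simp: list_all2_conv_all_nth)
  then have "FArr F (tm_class T \<Gamma> [\<tau>] [Fn f Ms]) =
      FArr F (tm_class T \<sigma>s [\<tau>] [Fn f (map V [0..<length \<sigma>s])]) \<odot> FArr F (tm_class T \<Gamma> \<sigma>s Ms)"
    using F_comp[OF assms(1) c(1,2) Ms' c(3)] by simp
  also have "\<dots> = FunI S f \<odot> (compare \<sigma>s \<odot> FArr F (tm_class T \<Gamma> \<sigma>s Ms))"
    unfolding F_fun[OF tm_in_Fn(1)]
  proof (rule comp_assoc[OF _ compare_hom[OF c(1)] F_hom[OF assms(1) c(1) Ms']])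
    show "FunI S f \<in> hom C (ctx \<sigma>s) (SortI S \<tau>)" using str tm_in_Fn(1)
      by (simp add: is_structure_def)
  qed
  also have "compare \<sigma>s \<odot> FArr F (tm_class T \<Gamma> \<sigma>s Ms) =
    tuple C (FObj F \<Gamma>) (map (\<lambda>M. tmI C S \<Gamma> M \<odot> compare \<Gamma>) Ms)"
    using tm_in_Fn(2) by (intro F_tms[OF assms(1) c(1) Ms']) (simp add: list_all2_conv_all_nth)
  also have "FunI S f \<odot> \<dots> = tmI C S \<Gamma> (Fn f Ms) \<odot> compare \<Gamma>"
    by (rule tmI_Fn_comp[OF assms(1) tm_in_Fn(1) Ms compare_hom[OF assms(1)], symmetric])
  finally show ?case .
qed

lemma compare_natural:
  assumes "\<Gamma>' \<in> contexts Sg" "\<Gamma> \<in> contexts Sg" "Ns \<in> term_lists Sg \<Gamma>' \<Gamma>"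
  shows "compare \<Gamma> \<odot> FArr F (tm_class T \<Gamma>' \<Gamma> Ns) = tmsI \<Gamma>' Ns \<odot> compare \<Gamma>'"
proof -
  have "compare \<Gamma> \<odot> FArr F (tm_class T \<Gamma>' \<Gamma> Ns) =
    tuple C (FObj F \<Gamma>') (map (\<lambda>N. tmI C S \<Gamma>' N \<odot> compare \<Gamma>') Ns)"
    using assms(3) F_tm[OF assms(1)]
    by (intro F_tms[OF assms]) (auto simp: term_lists_def list_all2_conv_all_nth)
  then show ?thesis
    using tuple_comp[OF tms_cone[OF assms(1,3)] compare_hom[OF assms(1)]]
      by (simp add: tmsI_def o_def)
qed

text \<open>Every atomic formula is a substitution instance of a generic one whose value under
  \<open>F\<close> is known: for relation symbols by the image of the generic model, for equations
  by preservation of \<open>Eq\<close>. For a quantifier, \<open>compare\<close> at the extended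
  context is factored so that naturality of \<open>Quant\<close> applies.\<close>

lemma F_fm: "\<Gamma> \<in> contexts Sg \<Longrightarrow> fm_in Lg Sg \<Gamma> \<phi> \<Longrightarrow>
    FPred F \<Gamma> (fm_class T \<Gamma> \<phi>) = Act C (compare \<Gamma>) (fmI C S \<Gamma> \<phi>)"
proof (induction \<phi> arbitrary: \<Gamma>)
  case (Rl R Ms)
  then obtain \<sigma>s where R: "rels Sg R = Some \<sigma>s" and Ms: "Ms \<in> term_lists Sg \<Gamma> \<sigma>s"
    by (auto simp: term_lists_def)
  note c = symbol_formulas[OF R]
  have RI: "RelI S R \<in> Pred C (ctx \<sigma>s)" using str R by (simp add: is_structure_def)
  have "map (tsubst Ms) (map V [0..<length \<sigma>s]) = Ms"
    using Ms by (auto intro!: nth_equalityI simp: term_lists_def list_all2_conv_all_nth)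
  then have "FPred F \<Gamma> (fm_class T \<Gamma> (Rl R Ms)) =
    Act C (FArr F (tm_class T \<Gamma> \<sigma>s Ms)) (Act C (compare \<sigma>s) (RelI S R))"
    using F_act[OF Rl(1) c(1) Ms c(2)] F_rel[OF R] by simp
  also have "\<dots> = Act C (compare \<Gamma>) (Act C (tmsI \<Gamma> Ms) (RelI S R))"
    unfolding act_comp[OF compare_hom[OF c(1)] F_hom[OF Rl(1) c(1) Ms] RI, symmetric]
      act_comp[OF tmsI_hom[OF Rl(1) Ms] compare_hom[OF Rl(1)] RI, symmetric]
      compare_natural[OF Rl(1) c(1) Ms] ..
  finally show ?case by (simp add: tmsI_def)
next
  case (Eqn \<sigma> M N)
  then have M: "\<sigma> \<in> sorts Sg" "tm_in Sg \<Gamma> M \<sigma>" "tm_in Sg \<Gamma> N \<sigma>" by auto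
  have s: "[\<sigma>] \<in> contexts Sg" "[\<sigma>, \<sigma>] \<in> contexts Sg" using M by (auto simp: contexts_def)
  have MN: "[M, N] \<in> term_lists Sg \<Gamma> [\<sigma>, \<sigma>]" using M by (simp add: term_lists_def)
  have pv: "[V 0] \<in> term_lists Sg [\<sigma>, \<sigma>] [\<sigma>]" "[V (Suc 0)] \<in> term_lists Sg [\<sigma>, \<sigma>] [\<sigma>]"
    by (simp_all add: term_lists_def)
  let ?m = "prod_map CT C F [\<sigma>] [\<sigma>]" and ?f = "FArr F (tm_class T \<Gamma> [\<sigma>, \<sigma>] [M, N])" and ?c =
    "SortI S \<sigma>"
  have s': "[\<sigma>] \<in> Obj CT" using s by simp
  note pm = syn.prod_map[OF cartesian_category_axioms F_functor F_products s' s']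
  note pm' = pm[unfolded F_sort[OF M(1)]]
  note so = sort_obj[OF M(1)]
  have m: "?m \<in> hom C (FObj F [\<sigma>, \<sigma>]) (Times C ?c ?c)" using pm'(1) by simp
  note f = F_hom[OF Eqn(1) s(2) MN]
  have "Pr1 C ?c ?c \<odot> (?m \<odot> ?f) = tmI C S \<Gamma> M \<odot> compare \<Gamma>"
    using comp_assoc[OF pr1_hom[OF so so] m f] pm'(2) F_comp[OF Eqn(1) s(2,1) MN pv(1)]
      F_tm[OF Eqn(1) M(2)]
    by simp
  moreover have "Pr2 C ?c ?c \<odot> (?m \<odot> ?f) = tmI C S \<Gamma> N \<odot> compare \<Gamma>"
    using comp_assoc[OF pr2_hom[OF so so] m f] pm'(3) F_comp[OF Eqn(1) s(2,1) MN pv(2)]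
      F_tm[OF Eqn(1) M(3)]
    by simp
  moreover note p = pair_comp[OF tmI_hom[OF Eqn(1) M(2)] tmI_hom[OF Eqn(1) M(3)]
    compare_hom[OF Eqn(1)]]
  ultimately have eq: "?m \<odot> ?f = pair C (tmI C S \<Gamma> M) (tmI C S \<Gamma> N) \<odot> compare \<Gamma>"
    using pair_eqI[OF so so comp_hom[OF m f]] by simp
  have "FPred F (Times CT [\<sigma>] [\<sigma>]) (EqP CT [\<sigma>]) = Act C ?m (EqP C (FObj F [\<sigma>]))"
    using mor s' unfolding FA_mor_def by blast
  then have "FPred F [\<sigma>, \<sigma>] (fm_class T [\<sigma>, \<sigma>] (eq_fm Lg [\<sigma>])) = Act C ?m (EqP C ?c)"
    using F_sort[OF M(1)] by simp
  \<comment> \<open>Over a single sort the tensor in \<open>eq_fm\<close> is just one equation,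
    between levels 0 and 1.\<close>
  moreover have "fsubst (length \<Gamma>) [M, N] (eq_fm Lg [\<sigma>]) = Eqn \<sigma> M N"
    by (simp add: eq_fm_def)
  moreover have "eq_fm Lg [\<sigma>] \<in> formulas Lg Sg [\<sigma>, \<sigma>]" using eq_fm_formulas[OF s(1)] by simp
  ultimately have "FPred F \<Gamma> (fm_class T \<Gamma> (Eqn \<sigma> M N)) = Act C ?f (Act C ?m (EqP C ?c))"
    using F_act[OF Eqn(1) s(2) MN] by metis
  also have "\<dots> = Act C (compare \<Gamma>) (Act C (pair C (tmI C S \<Gamma> M) (tmI C S \<Gamma> N)) (EqP C ?c))"
    unfolding act_comp[OF m f eq_pred[OF so], symmetric] eq
    by (rule act_comp[OF pair_hom[OF tmI_hom[OF Eqn(1) M(2)] tmI_hom[OF Eqn(1) M(3)]]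
      compare_hom[OF Eqn(1)] eq_pred[OF so]])
  finally show ?case by simp
next
  case (Cn k \<phi>s)
  then have k: "connectives Lg k = Some (length \<phi>s)" and p: "set \<phi>s \<subseteq> formulas Lg Sg \<Gamma>"
    by (auto simp: formulas_def)
  have "set (map (fm_class T \<Gamma>) \<phi>s) \<subseteq> Pred CT \<Gamma>" using p fm_class_pred by auto
  moreover have "connectives Lg k = Some (length (map (fm_class T \<Gamma>) \<phi>s))" "\<Gamma> \<in> Obj CT"
    using k Cn(2) by auto
  ultimately have "FPred F \<Gamma> (Con CT \<Gamma> k (map (fm_class T \<Gamma>) \<phi>s)) =
      Con C (FObj F \<Gamma>) k (map (FPred F \<Gamma>) (map (fm_class T \<Gamma>) \<phi>s))"
    using mor unfolding FA_mor_def by blast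
  also have "map (FPred F \<Gamma>) (map (fm_class T \<Gamma>) \<phi>s) = map (Act C (compare \<Gamma>)) (map (fmI C S \<Gamma>) \<phi>s)"
    using Cn by simp
  also have "Con C (FObj F \<Gamma>) k \<dots> = Act C (compare \<Gamma>) (Con C (ctx \<Gamma>) k (map (fmI C S \<Gamma>) \<phi>s))"
  proof (rule act_con[OF compare_hom[OF Cn(2)], symmetric])
    show "set (map (fmI C S \<Gamma>) \<phi>s) \<subseteq> Pred C (ctx \<Gamma>)" using p fmI_pred[OF Cn(2)]
      by (auto simp: formulas_def)
  qed (simp add: k)
  finally show ?case using con_fm_class[OF Cn(2) k p] by simp
next
  case (Qt q \<sigma> \<phi>)
  then have q: "q \<in> quantifiers Lg" and s: "\<sigma> \<in> sorts Sg" and f: "fm_in Lg Sg (\<Gamma> @ [\<sigma>]) \<phi>" by auto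
  have c: "[\<sigma>] \<in> contexts Sg" "\<Gamma> @ [\<sigma>] \<in> contexts Sg" using s Qt(2) by auto
  have o: "\<Gamma> \<in> Obj CT" "[\<sigma>] \<in> Obj CT" using Qt(2) c by auto
  have f': "\<phi> \<in> formulas Lg Sg (\<Gamma> @ [\<sigma>])" using f by (simp add: formulas_def)
  let ?c = "SortI S \<sigma>" and ?X = "fmI C S (\<Gamma> @ [\<sigma>]) \<phi>" and ?m = "prod_map CT C F \<Gamma> [\<sigma>]"
  let ?A = "FObj F \<Gamma>" and ?sn = "snoc_map C (sortsI \<Gamma>) (SortI S \<sigma>)" and ?P =
    "\<lambda>\<Gamma>. projs C (sortsI \<Gamma>)"
  let ?V = "map V [0..<length \<Gamma>]"
  note so = sort_obj[OF s] and A = F_obj[OF Qt(2)]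
  note X = fmI_pred[OF c(2) f]
  note pm = syn.prod_map[OF cartesian_category_axioms F_functor F_products o,
      unfolded F_sort[OF s] classifying_simps(3)]
  note i = inv_arr[OF pm(4) pm(1)]
  note sn = snoc_map_ctx(1)[OF Qt(2) s]
  note g = compare_hom[OF Qt(2)] and gs = compare_hom[OF c(2)]
  note p = pr1_hom[OF A so] pr2_hom[OF A so] and p' =
    pr1_hom[OF ctx_obj[OF Qt(2)] so] pr2_hom[OF ctx_obj[OF Qt(2)] so]
  \<comment> \<open>This is \<open>compare \<Gamma> \<times> id\<close>; an identity suffices in the
    second factor because \<open>FObj F [\<sigma>]\<close> equals
    \<open>SortI S \<sigma>\<close>.\<close>
  let ?k = "pair C (compare \<Gamma> \<odot> Pr1 C ?A ?c) (Pr2 C ?A ?c)"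
  note gp = comp_hom[OF g p(1)]
  note k = pair_hom[OF gp p(2)]
  note km = comp_hom[OF k pm(1)]
  note V = var_term_lists(2)[of \<Gamma> Sg "[\<sigma>]"]
  have k1: "Pr1 C (ctx \<Gamma>) ?c \<odot> (?k \<odot> ?m) = compare \<Gamma> \<odot> FArr F (tm_class T (\<Gamma> @ [\<sigma>]) \<Gamma> ?V)"
    using comp_assoc[OF p'(1) k pm(1)] pr1_pair[OF gp p(2)] comp_assoc[OF g p(1) pm(1)] pm(2)
      by simp
  have k2: "Pr2 C (ctx \<Gamma>) ?c \<odot> (?k \<odot> ?m) = FArr F (tm_class T (\<Gamma> @ [\<sigma>]) [\<sigma>] [V (length \<Gamma>)])"
    using comp_assoc[OF p'(2) k pm(1)] pr2_pair[OF gp p(2)] pm(3) by simp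
  \<comment> \<open>The comparison arrow of the extended context factors through the product
    comparison \<open>?m\<close> of \<open>F\<close>. Cancelling \<open>?m\<close> then removes the
    inverse from the quantifier clause of \<open>F\<close>.\<close>
  have "?sn \<odot> (?k \<odot> ?m) = compare (\<Gamma> @ [\<sigma>])"
  proof (rule list_product_eq[OF ctx_product[OF c(2)] comp_hom[OF sn km] gs])
    have "map (\<lambda>p. p \<odot> (?sn \<odot> (?k \<odot> ?m))) (?P (\<Gamma> @ [\<sigma>])) =
        map (\<lambda>p. p \<odot> (?k \<odot> ?m)) (map (\<lambda>p. p \<odot> Pr1 C (ctx \<Gamma>) ?c) (?P \<Gamma>) @ [Pr2 C (ctx \<Gamma>) ?c])"
      using cone_comp_comp[OF ctx_projs[OF c(2)] sn km] unfolding snoc_map_ctx(2)[OF Qt(2) s]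
        by (rule sym)
    also have "\<dots> = map (\<lambda>p. p \<odot> (compare \<Gamma> \<odot> FArr F (tm_class T (\<Gamma> @ [\<sigma>]) \<Gamma> ?V))) (?P \<Gamma>) @
        [FArr F (tm_class T (\<Gamma> @ [\<sigma>]) [\<sigma>] [V (length \<Gamma>)])]"
      using cone_comp_comp[OF ctx_projs[OF Qt(2)] p'(1) km] k1 k2 by (simp del: map_eq_conv)
    also have "\<dots> = map (\<lambda>i. FArr F (tm_class T (\<Gamma> @ [\<sigma>]) [(\<Gamma> @ [\<sigma>]) ! i] [V i])) [0..<length (\<Gamma> @
      [\<sigma>])]"
      unfolding projs_compare_arr[OF c(2) Qt(2) V] by (simp add: nth_append)
    also have "\<dots> = map (\<lambda>p. p \<odot> compare (\<Gamma> @ [\<sigma>])) (?P (\<Gamma> @ [\<sigma>]))"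
      by (rule projs_compare[OF c(2), symmetric])
    finally show "map (\<lambda>p. p \<odot> (?sn \<odot> (?k \<odot> ?m))) (?P (\<Gamma> @ [\<sigma>])) =
      map (\<lambda>p. p \<odot> compare (\<Gamma> @ [\<sigma>])) (?P (\<Gamma> @ [\<sigma>]))" .
  qed
  then have "compare (\<Gamma> @ [\<sigma>]) \<odot> inv_arr C ?m = (?sn \<odot> ?k) \<odot> (?m \<odot> inv_arr C ?m)"
    using comp_assoc[OF sn k pm(1)] comp_assoc[OF comp_hom[OF sn k] pm(1) i(1)] by simp
  then have eq: "compare (\<Gamma> @ [\<sigma>]) \<odot> inv_arr C ?m = ?sn \<odot> ?k"
    using i(3) comp_ident[OF comp_hom[OF sn k]] by simp
  have "fm_class T (\<Gamma> @ [\<sigma>]) \<phi> \<in> Pred CT (Times CT \<Gamma> [\<sigma>])" using fm_class_pred[OF f'] by simp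
  then have "FPred F \<Gamma> (Quant CT q \<Gamma> [\<sigma>] (fm_class T (\<Gamma> @ [\<sigma>]) \<phi>)) =
      Quant C q ?A (FObj F [\<sigma>]) (Act C (inv_arr C ?m) (FPred F (Times CT \<Gamma> [\<sigma>]) (fm_class T (\<Gamma> @
        [\<sigma>]) \<phi>)))"
    using mor q o unfolding FA_mor_def by blast
  then have "FPred F \<Gamma> (fm_class T \<Gamma> (Qt q \<sigma> \<phi>)) =
      Quant C q ?A ?c (Act C (inv_arr C ?m) (Act C (compare (\<Gamma> @ [\<sigma>])) ?X))"
    using quant_fm_class[OF q Qt(2) c(1) f'] Qt.IH[OF c(2) f] F_sort[OF s]
      by (simp add: quantify_def)
  also have "\<dots> = Quant C q ?A ?c (Act C ?k (Act C ?sn ?X))"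
    using act_comp[OF gs i(1) X] act_comp[OF sn k X] eq by simp
  \<comment> \<open>Naturality of \<open>Quant\<close> along \<open>compare \<Gamma>\<close>, read
    from right to left.\<close>
  also have "\<dots> = Act C (compare \<Gamma>) (fmI C S \<Gamma> (Qt q \<sigma> \<phi>))"
    using act_quant[OF q g so act_pred[OF sn X]] by simp
  finally show ?case .
qed

lemma two_isomorphic_induced: "two_isomorphic CT C F induced"
proof -
  have "is_2cell CT C F induced compare"
    unfolding is_2cell_def
  proof (intro conjI ballI allI)
    show "compare \<Gamma> \<in> hom C (FObj F \<Gamma>) (FObj induced \<Gamma>)" if "\<Gamma> \<in> Obj CT" for \<Gamma>
      using compare_hom that by simp
    show "compare \<Gamma> \<odot> FArr F f = FArr induced f \<odot> compare \<Gamma>'" if "f \<in> hom CT \<Gamma>' \<Gamma>" for \<Gamma>' \<Gamma> f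
      using that by (elim hom_classifyingE) (simp add: compare_natural induced_arr)
    show "FPred F \<Gamma> X = Act C (compare \<Gamma>) (FPred induced \<Gamma> X)" if "\<Gamma> \<in> Obj CT"
      "X \<in> Pred CT \<Gamma>" for \<Gamma> X
      using that(2)
    proof (rule pred_classifyingE)
      fix \<phi> assume "\<phi> \<in> formulas Lg Sg \<Gamma>" "X = fm_class T \<Gamma> \<phi>"
      then show ?thesis using that(1) F_fm by (simp add: induced_pred formulas_def)
    qed
  qed
  moreover have "is_iso C (compare \<Gamma>)" if "\<Gamma> \<in> Obj CT" for \<Gamma> using compare_iso that by simp
  ultimately show ?thesis unfolding two_isomorphic_def by blast
qed

end

theorem mainTheorem6:
  fixes Lg :: "('q, 'k) lang"
    and L :: "('s, 'f, 'r, 'q, 'k) logic"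
    and Sg :: "('s, 'f, 'r) sig"
    and T :: "('s, 'f, 'r, 'q, 'k) thy"
    and C :: "('o, 'm, 'p, 'q, 'k) propcat"
    and S :: "('s, 'f, 'r, 'o, 'm, 'p) str"
  assumes "wf_lang Lg"
    and "is_logic Lg L"
    and "adequate Lg L"
    and "wf_sig Sg"
    and "is_theory_of Lg L Sg T"
    and "FA_obj Lg C"
    and "is_model Lg Sg T C S"
  shows "\<exists>Sbar. FA_mor Lg (classifying Lg Sg T) C Sbar \<and>
           str_eq Sg (image_str Sg (classifying Lg Sg T) C Sbar (generic Sg T)) S \<and>
           (\<forall>F. FA_mor Lg (classifying Lg Sg T) C F \<longrightarrow>
                str_eq Sg (image_str Sg (classifying Lg Sg T) C F (generic Sg T)) S \<longrightarrow>
                two_isomorphic (classifying Lg Sg T) C F Sbar)"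
proof -
  interpret theory_model Lg C Sg S T
    using assms by unfold_locales (auto simp: adequate_def is_model_def)
  have "two_isomorphic CT C F induced"
    if "FA_mor Lg CT C F" "str_eq Sg (image_str Sg CT C F (generic Sg T)) S" for F
  proof -
    interpret generic_extension Lg C Sg S T F by unfold_locales (rule that)+
    show ?thesis by (rule two_isomorphic_induced)
  qed
  then show ?thesis using induced_mor image_generic_induced by blast
qed

end
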